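(* For any nilpotent matrix $A$, by linking and extending defining equations of the type $$x_0=f(x_1)+\sum_{0<j<j+k\leq n}x_jx_kx_n^{n-j-k}\qquad(n>2,\ f:\mathbb{R}\to\mathbb{R}\ \text{twice differentiable}),$$ one can obtain defining equations of uniformly $2$-nondegenerate hypersurfaces with rank $1$ Levi kernel having Levi kernel adjoint operators represented by $A$ at every point. In particular, for any twice differentiable functions $f_1,\dots,f_\mu:\mathbb{R}\to\mathbb{R}$ and positive integers $n_1,\dots,n_\mu$, the hypersurface $$M:=\Bigl\{z\in\mathbb{C}^2\oplus\mathbb{C}^{n_1}\oplus\cdots\oplus\mathbb{C}^{n_\mu}\ \Big|\ \mathrm{Re}(z_0)=\sum_{j=1}^{\mu}P_{f_j,n_j}(\mathrm{Re}\,z_{j,1},\dots,\mathrm{Re}\,z_{j,n_j})\Bigr\}$$ has Levi kernel adjoint operators at every point represented by the nilpotent matrix $$A=T_{n_1}\oplus\cdots\oplus T_{n_\mu}.$$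
   Context: Coordinates $z_j=x_j+iy_j$; sums over $0<j<j+k\le n$ run over ordered pairs of positive integers $(j,k)$ with $j+k\le n$. Coordinates on $\mathbb{C}^2\oplus\mathbb{C}^{n_1}\oplus\cdots\oplus\mathbb{C}^{n_\mu}$ are $(z_0,\xi,z_{1,1},\dots,z_{1,n_1},\dots,z_{\mu,1},\dots,z_{\mu,n_\mu})$. For $f:\mathbb{R}\to\mathbb{R}$ and an integer $m>0$, $P_{f,m}$ is the function of the $m+1$ real variables $x_1,\dots,x_m,\mathrm{Re}\,\xi$ given by $$P_{f,m}(x_1,\dots,x_m):=f(x_1)+\sum_{j,k\ge1,\ j+k\leq m+1}x_jx_k(\mathrm{Re}\,\xi)^{m+1-j-k}.$$ $T_k$ is the $k\times k$ matrix with $(T_k)_{r,s}=1$ if $r-s=1$ and $0$ otherwise. Extension: a ($2$-dimensional) extension of $\{\mathrm{Re}(z_0)=\Phi(z_1,\dots,z_n,\bar z_1,\dots,\bar z_n)\}\subset\mathbb{C}^{n+1}$ is a hypersurface $\{\mathrm{Re}(z_0)=\Phi+\epsilon(\mathrm{Re}\,z_{n+1})^2\}\subset\mathbb{C}^{n+2}$ with $\epsilon\in\{-1,1\}$. Link: let $\{\mathrm{Re}(z_0)=\Phi_i(z_1,\dots,z_{n_i},\overline{z_1},\dots,\overline{z_{n_i}})\}\subset\mathbb{C}^{n_i+1}$, $n_i\ge1$, $i=1,2$, be $2$-nondegenerate hypersurfaces such that the first $n_i-1$ of the tangent $(1,0)$ vector fields $(X_i)_k=\partial_{z_k}+(\text{the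 appropriate multiple of }\partial\Phi_i/\partial z_k)\,\partial_{z_0}$, $k=1,\dots,n_i$, are not in the Levi kernel of the $i$-th hypersurface. Their link is $\{\mathrm{Re}(z_0)=\Phi\}\subset\mathbb{C}^{n_1+n_2}$, where $$\Phi=\Phi_1(z_1,\dots,z_{n_1-1},\xi,\overline{z_1},\dots,\overline{z_{n_1-1}},\overline{\xi})+\Phi_2(z_{n_1},\dots,z_{n_1+n_2-2},\xi,\overline{z_{n_1}},\dots,\overline{z_{n_1+n_2-2}},\overline{\xi}),$$ i.e. the last variables of $\Phi_1$ and $\Phi_2$ are identified with a single variable $\xi$ (the last coordinate) and the remaining variables are kept independent. For a real hypersurface $M$ with holomorphic tangent bundle $H=T^{1,0}M$, let $K\subset H$ be the Levi kernel (kernel of the Levi form). When $K$ has constant rank, for $v\in K_q$ the Levi kernel adjoint operator $\mathrm{ad}_v:H_q/K_q\to H_q/K_q$ is the antilinear map $\mathrm{ad}_v(X_q+K_q)=[V,\overline X]_q\pmod{\overline H\oplus K}$, where $V\in\Gamma(K)$, $V_q=v$, $X\in\Gamma(H)$ (using $(H\oplus\overline H)/(\overline H\oplus K)\cong H/K$). When $K$ has rank $1$, "the Levi kernel adjoint operators are represented by $A$ at $q$" means that there are a nonzero $v\in K_q$ and a basis of $H_q/K_q$ with respect to which $\mathrm{ad}_v$ has matrix $A$ (so all the operators $\mathrm{ad}_v$, $v\in K_q$, are scalar multiples of it). Uniformly $2$-nondegenerate means that at every point $q$ the map $v\mapsto\mathrm{ad}_v$ is injective on $K_q$.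
   Formalization: Three corrections: A is nonzero; "nilpotent" means that the antilinear operator w ↦ A·conj(w) is nilpotent (the usual notion for real A); and in the explicit family f_j'' is never -2 for those j with n_j = 1. The claim fails in the excluded cases. *)

theory Defs
  imports
    "HOL-Analysis.Analysis"
    "HOL-Library.Function_Algebras"
    "Jordan_Normal_Form.Conjugate"
    "Jordan_Normal_Form.Matrix"
begin

section \<open>Differential calculus on complex coordinate spaces\<close>

text \<open>
  The dimension of the ambient space varies inside the statement, so \<open>\<complex>\<^sup>J\<close>, for a finite set
  \<open>J\<close> of coordinate labels, is the set of all functions from labels to complex numbers that vanish
  off \<open>J\<close>. It carries the topology induced by the product topology, which for finite \<open>J\<close> is the
  Euclidean one.
\<close>

definition cspace :: "'i set \<Rightarrow> ('i \<Rightarrow> complex) set" where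
  "cspace J = {z. \<forall>j. j \<notin> J \<longrightarrow> z j = 0}"

definition partial_x :: "'i \<Rightarrow> (('i \<Rightarrow> complex) \<Rightarrow> complex) \<Rightarrow> ('i \<Rightarrow> complex) \<Rightarrow> complex" where
  "partial_x j g q = vector_derivative (\<lambda>t::real. g (q(j := q j + of_real t))) (at 0)"

definition partial_y :: "'i \<Rightarrow> (('i \<Rightarrow> complex) \<Rightarrow> complex) \<Rightarrow> ('i \<Rightarrow> complex) \<Rightarrow> complex" where
  "partial_y j g q = vector_derivative (\<lambda>t::real. g (q(j := q j + \<i> * of_real t))) (at 0)"

definition partial_z :: "'i \<Rightarrow> (('i \<Rightarrow> complex) \<Rightarrow> complex) \<Rightarrow> ('i \<Rightarrow> complex) \<Rightarrow> complex" where
  "partial_z j g q = (partial_x j g q - \<i> * partial_y j g q) / 2"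

definition partial_zbar :: "'i \<Rightarrow> (('i \<Rightarrow> complex) \<Rightarrow> complex) \<Rightarrow> ('i \<Rightarrow> complex) \<Rightarrow> complex" where
  "partial_zbar j g q = (partial_x j g q + \<i> * partial_y j g q) / 2"

text \<open>
  Real (Frechet) differentiability at \<open>q\<close> of a function on \<open>\<complex>\<^sup>J\<close>. The type of functions is not
  normed, so the definition of the library does not apply. The differential is written with the
  Wirtinger derivatives: \<open>dg = \<Sum>\<^sub>j (\<partial>g/\<partial>z\<^sub>j) dz\<^sub>j + (\<partial>g/\<partial>zbar\<^sub>j) dzbar\<^sub>j\<close>.
\<close>

definition real_differentiable_at ::
    "'i set \<Rightarrow> (('i \<Rightarrow> complex) \<Rightarrow> complex) \<Rightarrow> ('i \<Rightarrow> complex) \<Rightarrow> bool" where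
  "real_differentiable_at J g q \<longleftrightarrow>
     ((\<lambda>w. (g w - g q
              - (\<Sum>j\<in>J. partial_z j g q * (w j - q j) + partial_zbar j g q * cnj (w j - q j)))
            / of_real (\<Sum>j\<in>J. norm (w j - q j)))
       \<longlongrightarrow> 0) (at q within cspace J)"


section \<open>Complexified tangent vectors and vector fields\<close>

text \<open>
  A complexified tangent vector \<open>\<Sum>\<^sub>j a\<^sub>j \<partial>/\<partial>z\<^sub>j + b\<^sub>j \<partial>/\<partial>zbar\<^sub>j\<close> of \<open>\<complex>\<^sup>J\<close> is the pair \<open>(a, b)\<close>.
\<close>

type_synonym 'i cvector = "('i \<Rightarrow> complex) \<times> ('i \<Rightarrow> complex)"

definition scale_cvector :: "complex \<Rightarrow> 'i cvector \<Rightarrow> 'i cvector" where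
  "scale_cvector c W = (\<lambda>j. c * fst W j, \<lambda>j. c * snd W j)"

definition conj_cvector :: "'i cvector \<Rightarrow> 'i cvector" where
  "conj_cvector W = (\<lambda>j. cnj (snd W j), \<lambda>j. cnj (fst W j))"

definition derivative_along ::
    "'i set \<Rightarrow> 'i cvector \<Rightarrow> (('i \<Rightarrow> complex) \<Rightarrow> complex) \<Rightarrow> ('i \<Rightarrow> complex) \<Rightarrow> complex" where
  "derivative_along J W g q = (\<Sum>j\<in>J. fst W j * partial_z j g q + snd W j * partial_zbar j g q)"

definition lie_bracket ::
    "'i set \<Rightarrow> (('i \<Rightarrow> complex) \<Rightarrow> 'i cvector) \<Rightarrow> (('i \<Rightarrow> complex) \<Rightarrow> 'i cvector)
       \<Rightarrow> ('i \<Rightarrow> complex) \<Rightarrow> 'i cvector" where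
  "lie_bracket J X Y q =
     (\<lambda>j. derivative_along J (X q) (\<lambda>p. fst (Y p) j) q
           - derivative_along J (Y q) (\<lambda>p. fst (X p) j) q,
      \<lambda>j. derivative_along J (X q) (\<lambda>p. snd (Y p) j) q
           - derivative_along J (Y q) (\<lambda>p. snd (X p) j) q)"


section \<open>Real hypersurfaces, Levi kernel and adjoint operators\<close>

text \<open>Throughout, \<open>\<rho>\<close> is a real defining function on \<open>\<complex>\<^sup>J\<close>.\<close>

definition hypersurface :: "'i set \<Rightarrow> (('i \<Rightarrow> complex) \<Rightarrow> real) \<Rightarrow> ('i \<Rightarrow> complex) set" where
  "hypersurface J \<rho> = {z \<in> cspace J. \<rho> z = 0}"

definition complex_tangent ::
    "'i set \<Rightarrow> (('i \<Rightarrow> complex) \<Rightarrow> real) \<Rightarrow> ('i \<Rightarrow> complex) \<Rightarrow> 'i cvector set" where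
  "complex_tangent J \<rho> q =
     {W \<in> cspace J \<times> cspace J. derivative_along J W (\<lambda>p. of_real (\<rho> p)) q = 0}"

definition T10 :: "'i set \<Rightarrow> (('i \<Rightarrow> complex) \<Rightarrow> real) \<Rightarrow> ('i \<Rightarrow> complex) \<Rightarrow> 'i cvector set" where
  "T10 J \<rho> q = {W \<in> complex_tangent J \<rho> q. snd W = 0}"

definition T01 :: "'i set \<Rightarrow> (('i \<Rightarrow> complex) \<Rightarrow> real) \<Rightarrow> ('i \<Rightarrow> complex) \<Rightarrow> 'i cvector set" where
  "T01 J \<rho> q = conj_cvector ` T10 J \<rho> q"

definition set_sum :: "'i cvector set \<Rightarrow> 'i cvector set \<Rightarrow> 'i cvector set" where
  "set_sum U V = {u + v | u v. u \<in> U \<and> v \<in> V}"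

text \<open>
  Sections over the hypersurface \<open>M\<close> of a family \<open>E\<close> of subspaces of its complexified tangent
  spaces. They are represented by vector fields on the ambient space, differentiable at the points
  of \<open>M\<close>; for sections tangent to \<open>M\<close>, the bracket at a point of \<open>M\<close> depends only on the
  restrictions to \<open>M\<close>. Only first order differentiability is required, since the hypersurfaces
  considered below are in general only twice differentiable.
\<close>

definition sections ::
    "'i set \<Rightarrow> (('i \<Rightarrow> complex) \<Rightarrow> real) \<Rightarrow> (('i \<Rightarrow> complex) \<Rightarrow> 'i cvector set)
       \<Rightarrow> (('i \<Rightarrow> complex) \<Rightarrow> 'i cvector) set" where
  "sections J \<rho> E =
     {X. (\<forall>p\<in>cspace J. X p \<in> cspace J \<times> cspace J)
       \<and> (\<forall>p\<in>hypersurface J \<rho>. X p \<in> E p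
            \<and> (\<forall>j\<in>J. real_differentiable_at J (\<lambda>p. fst (X p) j) p
                    \<and> real_differentiable_at J (\<lambda>p. snd (X p) j) p))}"

text \<open>
  The Levi form at \<open>q\<close> sends \<open>(X\<^sub>q, Y\<^sub>q)\<close> to a constant multiple of the class of the bracket of \<open>X\<close>
  with the conjugate of \<open>Y\<close> modulo \<open>T10 \<oplus> T01\<close>; this is its kernel.
\<close>

definition levi_kernel ::
    "'i set \<Rightarrow> (('i \<Rightarrow> complex) \<Rightarrow> real) \<Rightarrow> ('i \<Rightarrow> complex) \<Rightarrow> 'i cvector set" where
  "levi_kernel J \<rho> q =
     {X q | X. X \<in> sections J \<rho> (T10 J \<rho>)
       \<and> (\<forall>Y\<in>sections J \<rho> (T10 J \<rho>).
            lie_bracket J X (\<lambda>p. conj_cvector (Y p)) q \<in> set_sum (T10 J \<rho> q) (T01 J \<rho> q))}"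

text \<open>The classes of \<open>e 0, \<dots>, e (N-1)\<close> form a complex basis of the quotient \<open>U / W\<close>.\<close>

definition quotient_basis ::
    "nat \<Rightarrow> (nat \<Rightarrow> 'i cvector) \<Rightarrow> 'i cvector set \<Rightarrow> 'i cvector set \<Rightarrow> bool" where
  "quotient_basis N e U W \<longleftrightarrow>
     (\<forall>r<N. e r \<in> U) \<and>
     (\<forall>u\<in>U. \<exists>!c. c \<in> carrier_vec N \<and> u - (\<Sum>r<N. scale_cvector (vec_index c r) (e r)) \<in> W)"

definition has_rank :: "'i cvector set \<Rightarrow> nat \<Rightarrow> bool" where
  "has_rank U N \<longleftrightarrow> (\<exists>e. quotient_basis N e U {0})"

definition coset_in :: "'i cvector set \<Rightarrow> 'i cvector set \<Rightarrow> 'i cvector \<Rightarrow> 'i cvector set" where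
  "coset_in U W x = {u \<in> U. u - x \<in> W}"

text \<open>
  The value at the class of \<open>x\<close> of the operator \<open>ad\<^sub>v\<close>, as a subset of \<open>T10\<close>: the union, over all
  admissible choices of \<open>V\<close> and \<open>X\<close>, of the classes modulo the Levi kernel that are determined by
  the bracket. That this is a single class expresses that \<open>ad\<^sub>v\<close> is well defined.
\<close>

definition levi_ad ::
    "'i set \<Rightarrow> (('i \<Rightarrow> complex) \<Rightarrow> real) \<Rightarrow> ('i \<Rightarrow> complex) \<Rightarrow> 'i cvector \<Rightarrow> 'i cvector
       \<Rightarrow> 'i cvector set" where
  "levi_ad J \<rho> q v x =
     {u \<in> T10 J \<rho> q. \<exists>V X. V \<in> sections J \<rho> (levi_kernel J \<rho>) \<and> V q = v
        \<and> X \<in> sections J \<rho> (T10 J \<rho>) \<and> X q - x \<in> levi_kernel J \<rho> q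
        \<and> lie_bracket J V (\<lambda>p. conj_cvector (X p)) q - u
            \<in> set_sum (T01 J \<rho> q) (levi_kernel J \<rho> q)}"

text \<open>Matrix convention: column \<open>s\<close> of \<open>A\<close> holds the coordinates of the image of \<open>e s\<close>.\<close>

definition ad_represented_by ::
    "'i set \<Rightarrow> (('i \<Rightarrow> complex) \<Rightarrow> real) \<Rightarrow> ('i \<Rightarrow> complex) \<Rightarrow> complex mat \<Rightarrow> bool" where
  "ad_represented_by J \<rho> q A \<longleftrightarrow>
     square_mat A \<and> has_rank (levi_kernel J \<rho> q) 1 \<and>
     (\<exists>v e. v \<in> levi_kernel J \<rho> q \<and> v \<noteq> 0
        \<and> quotient_basis (dim_row A) e (T10 J \<rho> q) (levi_kernel J \<rho> q)
        \<and> (\<forall>s<dim_row A. levi_ad J \<rho> q v (e s)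
             = coset_in (T10 J \<rho> q) (levi_kernel J \<rho> q)
                 (\<Sum>r<dim_row A. scale_cvector (A $$ (r, s)) (e r))))"

text \<open>The rank is required to be positive: Levi-nondegenerate hypersurfaces are excluded.\<close>

definition uniformly_2_nondegenerate :: "'i set \<Rightarrow> (('i \<Rightarrow> complex) \<Rightarrow> real) \<Rightarrow> bool" where
  "uniformly_2_nondegenerate J \<rho> \<longleftrightarrow>
     (\<exists>k\<ge>1. \<forall>q\<in>hypersurface J \<rho>. has_rank (levi_kernel J \<rho> q) k) \<and>
     (\<forall>q\<in>hypersurface J \<rho>. inj_on (\<lambda>v. restrict (levi_ad J \<rho> q v) (T10 J \<rho> q)) (levi_kernel J \<rho> q))"


section \<open>Defining equations, extensions and links\<close>

text \<open>The defining function of the hypersurface \<open>Re z\<^sub>o = \<Phi>\<close>.\<close>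

definition graph_eq :: "'i \<Rightarrow> (('i \<Rightarrow> complex) \<Rightarrow> real) \<Rightarrow> ('i \<Rightarrow> complex) \<Rightarrow> real" where
  "graph_eq o' \<Phi> z = Re (z o') - \<Phi> z"

definition twice_differentiable :: "(real \<Rightarrow> real) \<Rightarrow> bool" where
  "twice_differentiable f \<longleftrightarrow> f differentiable_on UNIV \<and> deriv f differentiable_on UNIV"

text \<open>Below, \<open>\<Phi>\<close> is a function of the coordinates labelled \<open>1, \<dots>, n\<close>.\<close>

definition model :: "nat \<Rightarrow> (real \<Rightarrow> real) \<Rightarrow> (nat \<Rightarrow> complex) \<Rightarrow> real" where
  "model n f z = f (Re (z 1)) +
     (\<Sum>(j, k) \<in> {(j, k). 0 < j \<and> j < j + k \<and> j + k \<le> n}. Re (z j) * Re (z k) * Re (z n) ^ (n - j - k))"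

definition extension ::
    "nat \<Rightarrow> real \<Rightarrow> ((nat \<Rightarrow> complex) \<Rightarrow> real) \<Rightarrow> (nat \<Rightarrow> complex) \<Rightarrow> real" where
  "extension n \<epsilon> \<Phi> z = \<Phi> z + \<epsilon> * (Re (z (n + 1)))\<^sup>2"

text \<open>In the link the common variable \<open>\<xi>\<close> has label \<open>n\<^sub>1 + n\<^sub>2 - 1\<close>.\<close>

definition link ::
    "nat \<Rightarrow> ((nat \<Rightarrow> complex) \<Rightarrow> real) \<Rightarrow> nat \<Rightarrow> ((nat \<Rightarrow> complex) \<Rightarrow> real)
       \<Rightarrow> (nat \<Rightarrow> complex) \<Rightarrow> real" where
  "link n\<^sub>1 \<Phi>\<^sub>1 n\<^sub>2 \<Phi>\<^sub>2 z =
     (let \<xi> = z (n\<^sub>1 + n\<^sub>2 - 1) in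
       \<Phi>\<^sub>1 (\<lambda>i. if 1 \<le> i \<and> i < n\<^sub>1 then z i else if i = n\<^sub>1 then \<xi> else 0) +
       \<Phi>\<^sub>2 (\<lambda>i. if 1 \<le> i \<and> i < n\<^sub>2 then z (n\<^sub>1 - 1 + i) else if i = n\<^sub>2 then \<xi> else 0))"

text \<open>
  The \<open>(1,0)\<close> field \<open>\<partial>/\<partial>z\<^sub>k + 2 (\<partial>\<Phi>/\<partial>z\<^sub>k) \<partial>/\<partial>z\<^sub>0\<close>; the factor is 2 because
  \<open>\<partial>(Re z\<^sub>0)/\<partial>z\<^sub>0 = 1/2\<close>.
\<close>

definition tangent_field ::
    "((nat \<Rightarrow> complex) \<Rightarrow> real) \<Rightarrow> nat \<Rightarrow> (nat \<Rightarrow> complex) \<Rightarrow> nat cvector" where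
  "tangent_field \<Phi> k q =
     (\<lambda>j. if j = k then 1 else if j = 0 then 2 * partial_z k (\<lambda>p. of_real (\<Phi> p)) q else 0, 0)"

definition linkable :: "nat \<Rightarrow> ((nat \<Rightarrow> complex) \<Rightarrow> real) \<Rightarrow> bool" where
  "linkable n \<Phi> \<longleftrightarrow>
     n \<ge> 1 \<and> uniformly_2_nondegenerate {0..n} (graph_eq 0 \<Phi>) \<and>
     (\<forall>k\<in>{1..<n}. \<forall>q\<in>hypersurface {0..n} (graph_eq 0 \<Phi>).
        tangent_field \<Phi> k q \<notin> levi_kernel {0..n} (graph_eq 0 \<Phi>) q)"

text \<open>\<open>obtainable n \<Phi>\<close>: the equation \<open>Re z\<^sub>0 = \<Phi>(z\<^sub>1, \<dots>, z\<^sub>n)\<close> arises by linking and extending.\<close>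

inductive obtainable :: "nat \<Rightarrow> ((nat \<Rightarrow> complex) \<Rightarrow> real) \<Rightarrow> bool" where
  obtainable_model: "n > 2 \<Longrightarrow> twice_differentiable f \<Longrightarrow> obtainable n (model n f)"
| obtainable_extension: "obtainable n \<Phi> \<Longrightarrow> \<epsilon> \<in> {-1, 1} \<Longrightarrow> obtainable (n + 1) (extension n \<epsilon> \<Phi>)"
| obtainable_link: "obtainable n\<^sub>1 \<Phi>\<^sub>1 \<Longrightarrow> obtainable n\<^sub>2 \<Phi>\<^sub>2 \<Longrightarrow> linkable n\<^sub>1 \<Phi>\<^sub>1 \<Longrightarrow> linkable n\<^sub>2 \<Phi>\<^sub>2
    \<Longrightarrow> obtainable (n\<^sub>1 + n\<^sub>2 - 1) (link n\<^sub>1 \<Phi>\<^sub>1 n\<^sub>2 \<Phi>\<^sub>2)"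


section \<open>The explicit family\<close>

text \<open>Labels of the coordinates \<open>z\<^sub>0\<close>, \<open>\<xi>\<close> and \<open>z\<^sub>j\<^sub>,\<^sub>i\<close> (\<open>Z j i\<close>).\<close>

datatype coord = Z0 | Xi | Z nat nat

definition coords :: "nat \<Rightarrow> (nat \<Rightarrow> nat) \<Rightarrow> coord set" where
  "coords \<mu> n = {Z0, Xi} \<union> {Z j i | j i. j \<in> {1..\<mu>} \<and> i \<in> {1..n j}}"

text \<open>The last argument \<open>t\<close> is the value of \<open>Re \<xi>\<close>.\<close>

definition P :: "(real \<Rightarrow> real) \<Rightarrow> nat \<Rightarrow> (nat \<Rightarrow> real) \<Rightarrow> real \<Rightarrow> real" where
  "P f m x t = f (x 1) +
     (\<Sum>(j, k) \<in> {(j, k). j \<ge> 1 \<and> k \<ge> 1 \<and> j + k \<le> m + 1}. x j * x k * t ^ (m + 1 - j - k))"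

definition family_eq :: "nat \<Rightarrow> (nat \<Rightarrow> real \<Rightarrow> real) \<Rightarrow> (nat \<Rightarrow> nat) \<Rightarrow> (coord \<Rightarrow> complex) \<Rightarrow> real" where
  "family_eq \<mu> f n =
     graph_eq Z0 (\<lambda>z. \<Sum>j=1..\<mu>. P (f j) (n j) (\<lambda>i. Re (z (Z j i))) (Re (z Xi)))"

definition T_mat :: "nat \<Rightarrow> complex mat" where
  "T_mat k = mat k k (\<lambda>(r, s). if r = s + 1 then 1 else 0)"


section \<open>Nilpotency\<close>

text \<open>
  The adjoint operators are antilinear, and a change of basis \<open>B\<close> turns a representing matrix \<open>A\<close>
  into \<open>B\<inverse> A conj(B)\<close>, which preserves nilpotency of the operator \<open>w \<mapsto> A conj(w)\<close> but not of the
  matrix \<open>A\<close>. Nilpotency of a representing matrix is therefore understood as nilpotency of this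
  operator. For real matrices this is ordinary nilpotency (lemma below). For complex matrices it is
  not: \<open>[[1, \<i>], [\<i>, -1]]\<close> has square zero, but its antilinear operator has a nonzero eigenvalue.
\<close>

definition antilinear_nilpotent :: "complex mat \<Rightarrow> bool" where
  "antilinear_nilpotent A \<longleftrightarrow>
     (\<exists>k. \<forall>w\<in>carrier_vec (dim_col A).
        ((\<lambda>w. A *\<^sub>v conjugate w) ^^ k) w = 0\<^sub>v (dim_row A))"

lemma antilinear_nilpotent_real_iff:
  fixes A :: "real mat"
  assumes A: "A \<in> carrier_mat N N"
  shows "antilinear_nilpotent (map_mat of_real A) \<longleftrightarrow> (\<exists>k. A ^\<^sub>m k = 0\<^sub>m N N)"
proof -
  let ?B = "map_mat of_real A :: complex mat"
  let ?F = "\<lambda>w. ?B *\<^sub>v conjugate w"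
  have B: "?B \<in> carrier_mat N N" using A by simp
  have conjB: "conjugate (?B *\<^sub>v w) = ?B *\<^sub>v conjugate w" if "w \<in> carrier_vec N" for w
    using that A by (intro eq_vecI) (auto simp: scalar_prod_def)
  have carr: "(?F ^^ k) w \<in> carrier_vec N" if "w \<in> carrier_vec N" for k w
    using that B by (induction k) auto
  have pow: "?B ^\<^sub>m k \<in> carrier_mat N N" for k
    using B by (rule pow_carrier_mat)
  have iter: "(?F ^^ k) w = ?B ^\<^sub>m k *\<^sub>v (if even k then w else conjugate w)"
    if w: "w \<in> carrier_vec N" for k w
    using w
  proof (induction k arbitrary: w)
    case 0
    then show ?case using B by simp
  next
    case (Suc k)
    have "(?F ^^ Suc k) w = (?F ^^ k) (?B *\<^sub>v conjugate w)"
      by (simp only: funpow_Suc_right o_apply)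
    also have "\<dots> = ?B ^\<^sub>m k *\<^sub>v (?B *\<^sub>v (if even (Suc k) then w else conjugate w))"
      using Suc.IH[of "?B *\<^sub>v conjugate w"] B Suc.prems conjB[of "conjugate w"] by simp
    also have "\<dots> = ?B ^\<^sub>m Suc k *\<^sub>v (if even (Suc k) then w else conjugate w)"
      using B Suc.prems pow[of k] by (simp add: assoc_mult_mat_vec[of _ N N _ N])
    finally show ?case .
  qed
  have zero_iff: "(\<forall>w\<in>carrier_vec N. (?F ^^ k) w = 0\<^sub>v N) \<longleftrightarrow> ?B ^\<^sub>m k = 0\<^sub>m N N" for k
  proof
    assume L: "\<forall>w\<in>carrier_vec N. (?F ^^ k) w = 0\<^sub>v N"
    have all0: "?B ^\<^sub>m k *\<^sub>v u = 0\<^sub>v N" if u: "u \<in> carrier_vec N" for u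
    proof -
      have "conjugate u \<in> carrier_vec N" using u by simp
      then show ?thesis
        using L iter[OF u, of k] iter[of "conjugate u" k] u by (cases "even k") auto
    qed
    show "?B ^\<^sub>m k = 0\<^sub>m N N"
    proof (rule eq_matI)
      fix i j assume ij: "i < dim_row (0\<^sub>m N N :: complex mat)" "j < dim_col (0\<^sub>m N N :: complex mat)"
      have "vec_index (?B ^\<^sub>m k *\<^sub>v unit_vec N j) i = (?B ^\<^sub>m k) $$ (i, j)"
        using ij A carrier_matD[OF pow[of k]] by (simp add: scalar_prod_right_unit)
      then show "(?B ^\<^sub>m k) $$ (i, j) = (0\<^sub>m N N :: complex mat) $$ (i, j)"
        using all0[of "unit_vec N j"] ij by simp
    qed (use pow[of k] in auto)
  next
    assume "?B ^\<^sub>m k = 0\<^sub>m N N"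
    then show "\<forall>w\<in>carrier_vec N. (?F ^^ k) w = 0\<^sub>v N"
      using iter[of _ k] by auto
  qed
  have real_pow: "?B ^\<^sub>m k = 0\<^sub>m N N \<longleftrightarrow> A ^\<^sub>m k = 0\<^sub>m N N" for k
  proof -
    have "?B ^\<^sub>m k = map_mat of_real (A ^\<^sub>m k)"
      by (rule of_real_hom.mat_hom_pow[OF A, symmetric])
    moreover have "A ^\<^sub>m k \<in> carrier_mat N N" using A by (rule pow_carrier_mat)
    ultimately show ?thesis by (auto simp: mat_eq_iff)
  qed
  show ?thesis
    unfolding antilinear_nilpotent_def using zero_iff real_pow A by auto
qed

end

theory Submission
  imports Defs
begin

text \<open>
  For a tube hypersurface \<open>Re z\<^sub>0 = \<Phi>(Re z)\<close> the Levi form is the Hessian of \<open>\<Phi>\<close>. In a block of the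
  family put \<open>t = Re \<xi>\<close> and \<open>y = (1 - t T)\<^sup>-\<^sup>1 x\<close>: the gradient of \<open>\<Phi>\<close> depends on \<open>y\<close> and \<open>x\<^sub>1\<close>
  only, so the field \<open>\<partial>/\<partial>\<xi> - \<Sum>\<^sub>r y\<^sub>r\<^sub>-\<^sub>1 \<partial>/\<partial>x\<^sub>r\<close>, along which these are constant, spans the Levi
  kernel. Differentiating its coefficients, the adjoint operator is, up to a scalar, the real
  matrix \<open>T (1 - t T)\<^sup>-\<^sup>1\<close> on each block, which is a single nilpotent Jordan block in a real basis.
  It remains to know that an antilinear nilpotent operator has a basis made of chains; its chains of
  length at least 2 are realized by linking, those of length 1 by extending.
\<close>

section \<open>Differentiability on coordinate spaces\<close>

text \<open>The obstacle is antilinearity: a basis change \<open>B\<close> replaces \<open>A\<close>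
  by \<open>B\<^sup>-\<^sup>1 A conj(B)\<close>, so the usual Jordan form does not apply. On the
  geometric side this does no harm, because all functions depend on real parts only, the matrices
  \<open>T (1 - t T)\<^sup>-\<^sup>1\<close> are real, and their chains can be taken real, hence
  fixed by conjugation. On the algebraic side a chain decomposition is proved directly for
  semilinear maps. The variable \<open>y\<close> comes from the polynomial itself: expanding
  \<open>(1 - t T)\<^sup>-\<^sup>1\<close> in powers of \<open>t\<close> shows that the double sum
  in \<open>P\<close> equals the sum of the products of \<open>x\<^sub>i\<close> and
  \<open>y\<^sub>m\<^sub>+\<^sub>1\<^sub>-\<^sub>i\<close>. Reversing the rows of this Toeplitz
  matrix makes it symmetric, which is what removes \<open>x\<close> from the gradient. A function
  \<open>f\<^sub>j\<close> contributes to the Hessian only in the direction of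
  \<open>x\<^sub>j\<^sub>,\<^sub>1\<close>, where the kernel field has component
  \<open>- y\<^sub>0 = 0\<close>. The adjoint operators are therefore the same for all admissible
  \<open>f\<^sub>j\<close>, and a given matrix can be realized with zero functions. Second
  derivatives need not be continuous, so relations valid on the hypersurface are differentiated
  pointwise, along curves inside it.\<close>

definition has_wirtinger ::
    "'i set \<Rightarrow> (('i \<Rightarrow> complex) \<Rightarrow> complex) \<Rightarrow> ('i \<Rightarrow> complex) \<Rightarrow> ('i \<Rightarrow> complex) \<Rightarrow> ('i \<Rightarrow> complex) \<Rightarrow> bool" where
  "has_wirtinger J g a b q \<longleftrightarrow>
     ((\<lambda>w. (g w - g q - (\<Sum>j\<in>J. a j * (w j - q j) + b j * cnj (w j - q j)))
            / of_real (\<Sum>j\<in>J. norm (w j - q j))) \<longlongrightarrow> 0) (at q within cspace J)"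

lemma tendsto_fun_iff:
  fixes f :: "'a \<Rightarrow> 'i \<Rightarrow> 'b::topological_space"
  shows "(f \<longlongrightarrow> l) F \<longleftrightarrow> (\<forall>i. ((\<lambda>x. f x i) \<longlongrightarrow> l i) F)"
proof -
  have "(f \<longlongrightarrow> l) F \<longleftrightarrow> limitin (product_topology (\<lambda>i::'i. (euclidean::'b topology)) UNIV) f l F"
    by (simp add: euclidean_product_topology limitin_canonical_iff)
  then show ?thesis
    by (simp add: limitin_componentwise limitin_canonical_iff)
qed

lemma tendsto_coordinate: "((\<lambda>w. w i) \<longlongrightarrow> q i) (at q within S)"
  using tendsto_fun_iff[of "\<lambda>w. w" q "at q within S"] by (simp add: tendsto_ident_at)

lemma cspace_eqI:
  assumes "p \<in> cspace J" "q \<in> cspace J" "\<And>j. j \<in> J \<Longrightarrow> p j = q j"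
  shows "p = q"
  using assms by (fastforce simp: cspace_def)

lemma coordinate_dist_pos:
  assumes "finite J" "w \<in> cspace J" "q \<in> cspace J" "w \<noteq> q"
  shows "(\<Sum>j\<in>J. norm (w j - q j)) > 0"
proof -
  obtain j where "j \<in> J" "w j \<noteq> q j"
    using assms cspace_eqI by blast
  then have "0 < norm (w j - q j)" by simp
  also have "\<dots> \<le> (\<Sum>j\<in>J. norm (w j - q j))"
    using assms(1) \<open>j \<in> J\<close> by (intro member_le_sum) auto
  finally show ?thesis .
qed


lemma vector_derivative_quotient:
  fixes f :: "real \<Rightarrow> 'a::real_normed_vector"
  assumes "(f has_vector_derivative d) (at 0)"
  shows "((\<lambda>t. (f t - f 0) /\<^sub>R t) \<longlongrightarrow> d) (at 0)"
proof (rule Lim_null[THEN iffD2], rule tendsto_norm_zero_cancel)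
  have "((\<lambda>h. norm (f h - f 0 - h *\<^sub>R d) / norm h) \<longlongrightarrow> 0) (at 0)"
    using assms by (simp add: has_vector_derivative_def has_derivative_at)
  moreover have "\<forall>\<^sub>F h in at 0. norm (f h - f 0 - h *\<^sub>R d) / norm h = norm ((f h - f 0) /\<^sub>R h - d)"
  proof (rule eventually_mono[OF eventually_neq_at_within[of 0]])
    fix h :: real assume "h \<noteq> 0"
    then have "(f h - f 0) /\<^sub>R h - d = (f h - f 0 - h *\<^sub>R d) /\<^sub>R h"
      by (simp add: scaleR_diff_right)
    then show "norm (f h - f 0 - h *\<^sub>R d) / norm h = norm ((f h - f 0) /\<^sub>R h - d)"
      by (simp add: divide_inverse_commute)
  qed
  ultimately show "((\<lambda>t. norm ((f t - f 0) /\<^sub>R t - d)) \<longlongrightarrow> 0) (at 0)"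
    by (rule Lim_transform_eventually)
qed

text \<open>Chain rule. The remainder divided by the absolute value of \<open>t\<close> is
  \<open>h (\<gamma> t)\<close> times the sum of the norms of the difference quotients of the
  coordinates; the first factor tends to 0, the second to a finite limit.\<close>

lemma has_wirtinger_curve:
  assumes J: "finite J" and q: "q \<in> cspace J" and g: "has_wirtinger J g a b q"
    and \<gamma>: "\<And>t. \<gamma> t \<in> cspace J" "\<gamma> 0 = q"
    and d: "\<And>j. j \<in> J \<Longrightarrow> ((\<lambda>t. \<gamma> t j) has_vector_derivative d j) (at (0::real))"
  shows "((\<lambda>t. g (\<gamma> t)) has_vector_derivative (\<Sum>j\<in>J. a j * d j + b j * cnj (d j))) (at 0)"
proof -
  define L where "L w = (\<Sum>j\<in>J. a j * (w j - q j) + b j * cnj (w j - q j))" for w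
  define S where "S w = (\<Sum>j\<in>J. norm (w j - q j))" for w
  define r where "r w = g w - g q - L w" for w
  define h where "h w = r w / of_real (S w)" for w
  have rq: "r q = 0" "h q = 0" by (simp_all add: r_def L_def h_def)
  have "(h \<longlongrightarrow> 0) (at q within cspace J)"
    using g unfolding has_wirtinger_def h_def[abs_def] r_def L_def S_def .
  \<comment> \<open>Since \<open>h q = 0\<close>, the punctured limit extends to full neighbourhoods
    of \<open>q\<close>. This matters because \<open>\<gamma>\<close> may return to \<open>q\<close>
    at nonzero times.\<close>
  then have lim_h: "(h \<longlongrightarrow> 0) (inf (nhds q) (principal (cspace J)))"
    by (simp add: tendsto_at_iff_tendsto_nhds_within rq)
  have "((\<lambda>t. \<gamma> t j) \<longlongrightarrow> q j) (at 0)" for j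
  proof (cases "j \<in> J")
    case True
    have "continuous (at 0) (\<lambda>t. \<gamma> t j)"
      using d[OF True] by (rule has_vector_derivative_continuous)
    then show ?thesis using \<gamma>(2) by (simp add: continuous_at)
  next
    case False
    then have "(\<lambda>t. \<gamma> t j) = (\<lambda>t. q j)" using \<gamma>(1) q by (auto simp: cspace_def)
    then show ?thesis by simp
  qed
  then have lim: "(\<gamma> \<longlongrightarrow> q) (at 0)" by (simp add: tendsto_fun_iff)
  have h0: "((\<lambda>t. h (\<gamma> t)) \<longlongrightarrow> 0) (at 0)"
    by (rule filterlim_compose[OF lim_h])
      (use lim \<gamma>(1) in \<open>simp add: filterlim_inf filterlim_principal\<close>)
  have quot: "((\<lambda>t. (\<gamma> t j - q j) /\<^sub>R t) \<longlongrightarrow> d j) (at 0)" if "j \<in> J" for j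
    using vector_derivative_quotient[OF d[OF that]] \<gamma>(2) by simp
  have "((\<lambda>t. h (\<gamma> t) * of_real (\<Sum>j\<in>J. norm ((\<gamma> t j - q j) /\<^sub>R t)))
      \<longlongrightarrow> 0 * of_real (\<Sum>j\<in>J. norm (d j))) (at 0)"
    by (intro tendsto_intros h0 quot)
  moreover have "h (\<gamma> t) * of_real (\<Sum>j\<in>J. norm ((\<gamma> t j - q j) /\<^sub>R t)) = r (\<gamma> t) / of_real \<bar>t\<bar>" for t
  proof (cases "\<gamma> t = q")
    case True
    then show ?thesis by (simp add: rq)
  next
    case False
    then have "S (\<gamma> t) > 0" unfolding S_def using coordinate_dist_pos[OF J \<gamma>(1) q] by blast
    moreover have "(\<Sum>j\<in>J. norm ((\<gamma> t j - q j) /\<^sub>R t)) = S (\<gamma> t) / \<bar>t\<bar>"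
      by (simp add: S_def divide_inverse sum_distrib_left mult.commute)
    ultimately show ?thesis by (simp add: h_def)
  qed
  ultimately have "((\<lambda>t. r (\<gamma> t) / of_real \<bar>t\<bar>) \<longlongrightarrow> 0) (at 0)" by simp
  then have "((\<lambda>t. norm (r (\<gamma> t) / of_real \<bar>t\<bar>)) \<longlongrightarrow> 0) (at 0)"
    by (rule tendsto_norm_zero)
  then have "((\<lambda>t. r (\<gamma> t)) has_vector_derivative 0) (at 0)"
    by (simp add: has_vector_derivative_def has_derivative_at \<gamma>(2) rq norm_divide)
  moreover have "((\<lambda>t. g q + L (\<gamma> t)) has_vector_derivative
      0 + (\<Sum>j\<in>J. a j * (d j - 0) + b j * cnj (d j - 0))) (at 0)"
    unfolding L_def
    by (intro has_vector_derivative_add has_vector_derivative_const has_vector_derivative_sum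
        has_vector_derivative_mult_right has_vector_derivative_cnj has_vector_derivative_diff d)
  ultimately have "((\<lambda>t. (g q + L (\<gamma> t)) + r (\<gamma> t)) has_vector_derivative
      (0 + (\<Sum>j\<in>J. a j * (d j - 0) + b j * cnj (d j - 0))) + 0) (at 0)"
    using has_vector_derivative_add by blast
  then show ?thesis by (simp add: r_def)
qed

text \<open>Moving coordinate \<open>j\<close> with velocity \<open>c\<close> gives the derivative
  \<open>a j * c + b j * cnj c\<close>; the values \<open>c = 1\<close> and \<open>c = \<i>\<close>
  separate the two coefficients, which are therefore unique.\<close>

lemma has_wirtinger_partial:
  assumes J: "finite J" and q: "q \<in> cspace J" and g: "has_wirtinger J g a b q" and j: "j \<in> J"
  shows "partial_z j g q = a j" "partial_zbar j g q = b j"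
proof -
  have *: "((\<lambda>t. g (q(j := q j + c * of_real t))) has_vector_derivative a j * c + b j * cnj c) (at 0)" for c
  proof -
    have "((\<lambda>t. g (q(j := q j + c * of_real t))) has_vector_derivative
       (\<Sum>k\<in>J. a k * (if k = j then c else 0) + b k * cnj (if k = j then c else 0))) (at 0)"
    proof (rule has_wirtinger_curve[OF J q g])
      show "((\<lambda>t. (q(j := q j + c * of_real t)) k) has_vector_derivative (if k = j then c else 0)) (at 0)" for k
      proof -
        have "((\<lambda>t. q j + c * of_real t) has_vector_derivative 0 + c * of_real 1) (at 0)"
          by (intro has_vector_derivative_add has_vector_derivative_const has_vector_derivative_mult_right
              has_vector_derivative_of_real DERIV_ident)
        then show ?thesis by auto
      qed
    qed (use q j in \<open>auto simp: cspace_def\<close>)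
    also have "(\<Sum>k\<in>J. a k * (if k = j then c else 0) + b k * cnj (if k = j then c else 0))
        = (\<Sum>k\<in>J. if k = j then a k * c + b k * cnj c else 0)"
      by (rule sum.cong) auto
    also have "\<dots> = a j * c + b j * cnj c" using J j by simp
    finally show ?thesis .
  qed
  have px: "partial_x j g q = a j + b j"
    unfolding partial_x_def using *[of 1] by (intro vector_derivative_at) simp
  have py: "partial_y j g q = \<i> * (a j - b j)"
    unfolding partial_y_def using *[of "\<i>"] by (intro vector_derivative_at) (simp add: algebra_simps)
  show "partial_z j g q = a j" "partial_zbar j g q = b j"
    by (simp_all add: partial_z_def partial_zbar_def px py algebra_simps)
qed

text \<open>The definition prescribes the partial derivatives as coefficients. By uniqueness any
  coefficients that work are these, so closure properties can be proved by exhibiting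
  coefficients.\<close>

lemma real_differentiable_at_iff:
  assumes "finite J" "q \<in> cspace J"
  shows "real_differentiable_at J g q \<longleftrightarrow> (\<exists>a b. has_wirtinger J g a b q)"
proof
  assume "\<exists>a b. has_wirtinger J g a b q"
  then obtain a b where g: "has_wirtinger J g a b q" by blast
  then show "real_differentiable_at J g q"
    unfolding real_differentiable_at_def has_wirtinger_def
    by (simp add: has_wirtinger_partial[OF assms g] cong: sum.cong)
qed (auto simp: real_differentiable_at_def has_wirtinger_def)

lemma derivative_along_has_wirtinger:
  assumes "finite J" "q \<in> cspace J" "has_wirtinger J g a b q"
  shows "derivative_along J W g q = (\<Sum>j\<in>J. fst W j * a j + snd W j * b j)"
  unfolding derivative_along_def using has_wirtinger_partial[OF assms] by simp

section \<open>Closure rules with explicit coefficients\<close>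

lemma has_wirtinger_cong_space:
  assumes "has_wirtinger J g a b q" "q \<in> cspace J" "\<And>w. w \<in> cspace J \<Longrightarrow> g w = h w"
  shows "has_wirtinger J h a b q"
proof -
  have "\<forall>\<^sub>F w in at q within cspace J. w \<in> cspace J"
    by (simp add: eventually_at_filter)
  then show ?thesis
    using assms(1) unfolding has_wirtinger_def
    by (elim Lim_transform_eventually eventually_mono) (simp add: assms)
qed

lemma has_wirtinger_const: "has_wirtinger J (\<lambda>w. c) (\<lambda>j. 0) (\<lambda>j. 0) q"
  by (simp add: has_wirtinger_def)

lemma has_wirtinger_add:
  assumes "has_wirtinger J g a b q" "has_wirtinger J h a' b' q"
  shows "has_wirtinger J (\<lambda>w. g w + h w) (\<lambda>j. a j + a' j) (\<lambda>j. b j + b' j) q"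
proof -
  have "(\<Sum>j\<in>J. (a j + a' j) * (w j - q j) + (b j + b' j) * cnj (w j - q j))
      = (\<Sum>j\<in>J. a j * (w j - q j) + b j * cnj (w j - q j))
        + (\<Sum>j\<in>J. a' j * (w j - q j) + b' j * cnj (w j - q j))" for w
    unfolding sum.distrib[symmetric] by (rule sum.cong) (simp_all add: algebra_simps)
  then show ?thesis
    using tendsto_add[OF assms[unfolded has_wirtinger_def]]
    unfolding has_wirtinger_def add_divide_distrib[symmetric]
    by (simp only: add_0 algebra_simps diff_add_eq)
qed

lemma has_wirtinger_cnj:
  assumes "has_wirtinger J g a b q"
  shows "has_wirtinger J (\<lambda>w. cnj (g w)) (\<lambda>j. cnj (b j)) (\<lambda>j. cnj (a j)) q"
  using tendsto_cnj[OF assms[unfolded has_wirtinger_def]]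
  by (simp add: has_wirtinger_def algebra_simps sum.distrib)

lemma has_wirtinger_tendsto:
  assumes J: "finite J" and q: "q \<in> cspace J" and g: "has_wirtinger J g a b q"
  shows "(g \<longlongrightarrow> g q) (at q within cspace J)"
proof -
  define L where "L w = (\<Sum>j\<in>J. a j * (w j - q j) + b j * cnj (w j - q j))" for w
  define S where "S w = complex_of_real (\<Sum>j\<in>J. norm (w j - q j))" for w
  have "(S \<longlongrightarrow> of_real (\<Sum>j\<in>J. norm (q j - q j))) (at q within cspace J)"
    unfolding S_def by (intro tendsto_intros tendsto_coordinate)
  then have S0: "(S \<longlongrightarrow> 0) (at q within cspace J)" by simp
  have "(L \<longlongrightarrow> (\<Sum>j\<in>J. a j * (q j - q j) + b j * cnj (q j - q j))) (at q within cspace J)"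
    unfolding L_def by (intro tendsto_intros tendsto_coordinate)
  then have L0: "(L \<longlongrightarrow> 0) (at q within cspace J)" by simp
  have "((\<lambda>w. (g w - g q - L w) / S w) \<longlongrightarrow> 0) (at q within cspace J)"
    using g unfolding has_wirtinger_def L_def S_def .
  then have "((\<lambda>w. (g w - g q - L w) / S w * S w + (g q + L w)) \<longlongrightarrow> 0 * 0 + (g q + 0)) (at q within cspace J)"
    by (intro tendsto_intros S0 L0)
  moreover have "\<forall>\<^sub>F w in at q within cspace J. (g w - g q - L w) / S w * S w + (g q + L w) = g w"
  proof (unfold eventually_at_filter, intro always_eventually allI impI)
    fix w assume "w \<noteq> q" "w \<in> cspace J"
    then have "S w \<noteq> 0" using coordinate_dist_pos[OF J _ q] unfolding S_def by fastforce
    then show "(g w - g q - L w) / S w * S w + (g q + L w) = g w" by simp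
  qed
  ultimately show ?thesis by (auto dest: Lim_transform_eventually)
qed

lemma has_wirtinger_mult:
  assumes J: "finite J" and q: "q \<in> cspace J"
    and g: "has_wirtinger J g a b q" and h: "has_wirtinger J h a' b' q"
  shows "has_wirtinger J (\<lambda>w. g w * h w) (\<lambda>j. a j * h q + g q * a' j) (\<lambda>j. b j * h q + g q * b' j) q"
proof -
  define L where "L w = (\<Sum>j\<in>J. a j * (w j - q j) + b j * cnj (w j - q j))" for w
  define L' where "L' w = (\<Sum>j\<in>J. a' j * (w j - q j) + b' j * cnj (w j - q j))" for w
  define S where "S w = complex_of_real (\<Sum>j\<in>J. norm (w j - q j))" for w
  have hq: "((\<lambda>w. h w - h q) \<longlongrightarrow> h q - h q) (at q within cspace J)"
    by (intro tendsto_intros has_wirtinger_tendsto[OF J q h])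
  have bound: "norm (L w / S w) \<le> (\<Sum>j\<in>J. norm (a j) + norm (b j))" for w
  proof -
    have "norm (L w) \<le> (\<Sum>j\<in>J. (norm (a j) + norm (b j)) * norm (w j - q j))"
      unfolding L_def
    proof (rule sum_norm_le)
      fix j
      have "norm (a j * (w j - q j) + b j * cnj (w j - q j))
          \<le> norm (a j * (w j - q j)) + norm (b j * cnj (w j - q j))" by (rule norm_triangle_ineq)
      also have "\<dots> = (norm (a j) + norm (b j)) * norm (w j - q j)"
        using complex_mod_cnj[of "w j - q j"] unfolding norm_mult by (simp add: algebra_simps)
      finally show "norm (a j * (w j - q j) + b j * cnj (w j - q j)) \<le> (norm (a j) + norm (b j)) * norm (w j - q j)" .
    qed
    also have "\<dots> \<le> (\<Sum>j\<in>J. (norm (a j) + norm (b j)) * norm (S w))"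
    proof (rule sum_mono)
      fix i assume "i \<in> J"
      then have "norm (w i - q i) \<le> (\<Sum>j\<in>J. norm (w j - q j))" using J by (intro member_le_sum) auto
      also have "\<dots> \<le> norm (S w)" unfolding S_def norm_of_real by simp
      finally show "(norm (a i) + norm (b i)) * norm (w i - q i) \<le> (norm (a i) + norm (b i)) * norm (S w)"
        by (rule mult_left_mono) simp
    qed
    finally have *: "norm (L w) \<le> (\<Sum>j\<in>J. norm (a j) + norm (b j)) * norm (S w)"
      by (simp add: sum_distrib_right)
    show ?thesis
    proof (cases "S w = 0")
      case True
      then show ?thesis by (simp add: sum_nonneg)
    next
      case False
      then show ?thesis using * by (simp add: norm_divide divide_simps)
    qed
  qed
  \<comment> \<open>This is the one term in the expansion of the product remainder that contains no
    remainder of a factor: \<open>L w / S w\<close> is bounded and \<open>h w - h q\<close> tends to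
    0.\<close>
  have cross: "((\<lambda>w. (h w - h q) * (L w / S w)) \<longlongrightarrow> 0) (at q within cspace J)"
  proof (rule Lim_null_comparison)
    show "\<forall>\<^sub>F w in at q within cspace J. norm ((h w - h q) * (L w / S w))
        \<le> norm (h w - h q) * (\<Sum>j\<in>J. norm (a j) + norm (b j))"
      unfolding norm_mult by (intro always_eventually allI mult_left_mono bound) simp
    have "((\<lambda>w. norm (h w - h q) * (\<Sum>j\<in>J. norm (a j) + norm (b j))) \<longlongrightarrow>
        norm (h q - h q) * (\<Sum>j\<in>J. norm (a j) + norm (b j))) (at q within cspace J)"
      by (intro tendsto_intros hq)
    then show "((\<lambda>w. norm (h w - h q) * (\<Sum>j\<in>J. norm (a j) + norm (b j))) \<longlongrightarrow> 0) (at q within cspace J)"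
      by simp
  qed
  have "((\<lambda>w. (g w - g q - L w) / S w * h w + (h w - h q) * (L w / S w) + g q * ((h w - h q - L' w) / S w))
      \<longlongrightarrow> 0 * h q + 0 + g q * 0) (at q within cspace J)"
    using g h
    by (intro tendsto_intros cross has_wirtinger_tendsto[OF J q h])
      (simp_all add: has_wirtinger_def S_def L_def L'_def)
  moreover have "(\<Sum>j\<in>J. (a j * h q + g q * a' j) * (w j - q j) + (b j * h q + g q * b' j) * cnj (w j - q j))
      = h q * L w + g q * L' w" for w
    unfolding L_def L'_def sum_distrib_left sum.distrib[symmetric]
    by (rule sum.cong) (simp_all add: algebra_simps)
  moreover have "(g w - g q - L w) / S w * h w + (h w - h q) * (L w / S w) + g q * ((h w - h q - L' w) / S w)
     = (g w * h w - g q * h q - (h q * L w + g q * L' w)) / S w" for w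
    by (simp add: divide_inverse algebra_simps)
  ultimately show ?thesis by (simp only: has_wirtinger_def S_def add_0 mult_zero_left mult_zero_right)
qed

text \<open>The halves come from \<open>Re w = (w + cnj w) / 2\<close>. Differentiability at the
  single point suffices because the quotient \<open>h\<close>, with value 0 at \<open>x\<close>, is
  continuous there. The functions \<open>f j\<close> and their first derivatives enter the calculus
  through this lemma.\<close>

lemma has_wirtinger_of_real_Re:
  assumes J: "finite J" and q: "q \<in> cspace J" and k: "k \<in> J"
    and f: "(f has_real_derivative D) (at (Re (q k)))"
  shows "has_wirtinger J (\<lambda>w. of_real (f (Re (w k)))) (\<lambda>j. if j = k then of_real D / 2 else 0)
    (\<lambda>j. if j = k then of_real D / 2 else 0) q"
proof -
  define S where "S w = (\<Sum>j\<in>J. norm (w j - q j))" for w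
  define x where "x = Re (q k)"
  define h where "h y = (f y - f x - D * (y - x)) / (y - x)" for y
  have "((\<lambda>y. (f y - f x) / (y - x) - D) \<longlongrightarrow> D - D) (at x)"
    using f by (intro tendsto_intros) (simp add: has_field_derivative_iff x_def)
  moreover have "\<forall>\<^sub>F y in at x. (f y - f x) / (y - x) - D = h y"
    by (rule eventually_mono[OF eventually_neq_at_within[of x]]) (simp add: h_def divide_simps)
  ultimately have "(h \<longlongrightarrow> 0) (at x)" by (auto dest: Lim_transform_eventually)
  then have cont: "continuous (at x) h" by (simp add: continuous_at h_def)
  have "((\<lambda>w. h (Re (w k))) \<longlongrightarrow> h x) (at q within cspace J)"
    using continuous_within_tendsto_compose[of x UNIV h "\<lambda>w. Re (w k)"] cont
    by (simp add: tendsto_Re[OF tendsto_coordinate] x_def)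
  then have h0: "((\<lambda>w. h (Re (w k))) \<longlongrightarrow> 0) (at q within cspace J)" by (simp add: h_def)
  have "((\<lambda>w. (f (Re (w k)) - f x - D * (Re (w k) - x)) / S w) \<longlongrightarrow> 0) (at q within cspace J)"
  proof (rule Lim_null_comparison[OF _ tendsto_norm_zero[OF h0]], intro always_eventually allI)
    fix w
    have "\<bar>Re (w k) - x\<bar> \<le> norm (w k - q k)"
      using abs_Re_le_cmod[of "w k - q k"] by (simp add: x_def)
    also have "\<dots> \<le> S w" unfolding S_def using J k by (intro member_le_sum) auto
    finally have le: "\<bar>Re (w k) - x\<bar> \<le> S w" .
    have eq: "f (Re (w k)) - f x - D * (Re (w k) - x) = h (Re (w k)) * (Re (w k) - x)"
      by (simp add: h_def)
    have "\<bar>Re (w k) - x\<bar> / \<bar>S w\<bar> \<le> 1" using le by (auto simp: divide_le_eq_1)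
    then have "\<bar>h (Re (w k))\<bar> * (\<bar>Re (w k) - x\<bar> / \<bar>S w\<bar>) \<le> \<bar>h (Re (w k))\<bar> * 1"
      by (intro mult_left_mono) auto
    then show "norm ((f (Re (w k)) - f x - D * (Re (w k) - x)) / S w) \<le> norm (h (Re (w k)))"
      unfolding eq by (simp add: abs_mult)
  qed
  from tendsto_of_real[OF this, where 'a = complex]
  have "((\<lambda>w. (of_real (f (Re (w k))) - of_real (f x) - of_real D * of_real (Re (w k) - x)) / complex_of_real (S w))
     \<longlongrightarrow> 0) (at q within cspace J)" by simp
  moreover have "(\<Sum>j\<in>J. (if j = k then of_real D / 2 else 0) * (w j - q j)
      + (if j = k then of_real D / 2 else 0) * cnj (w j - q j)) = of_real D * of_real (Re (w k) - x)" for w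
  proof -
    have "(\<Sum>j\<in>J. (if j = k then of_real D / 2 else 0) * (w j - q j)
      + (if j = k then of_real D / 2 else 0) * cnj (w j - q j))
      = (\<Sum>j\<in>J. if j = k then of_real D / 2 * (w j - q j) + of_real D / 2 * cnj (w j - q j) else 0)"
      by (rule sum.cong) auto
    also have "\<dots> = of_real D / 2 * ((w k - q k) + cnj (w k - q k))"
      using J k by (simp add: distrib_left)
    also have "\<dots> = of_real D * of_real (Re (w k) - x)"
      unfolding complex_add_cnj by (simp add: x_def)
    finally show ?thesis .
  qed
  ultimately show ?thesis by (simp add: has_wirtinger_def S_def x_def)
qed


lemma has_wirtinger_eq:
  assumes "has_wirtinger J g a b q" "\<And>w. g w = h w"
    "\<And>j. j \<in> J \<Longrightarrow> a j = a' j" "\<And>j. j \<in> J \<Longrightarrow> b j = b' j"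
  shows "has_wirtinger J h a' b' q"
  using assms by (simp add: has_wirtinger_def cong: sum.cong)

section \<open>Derivatives along a complexified vector at a fixed point\<close>

context
  fixes J :: "'i set" and q :: "'i \<Rightarrow> complex"
  assumes J: "finite J" and q: "q \<in> cspace J"
begin

lemma real_differentiable_const: "real_differentiable_at J (\<lambda>w. c) q"
  unfolding real_differentiable_at_iff[OF J q] using has_wirtinger_const by blast

lemma real_differentiable_add:
  "real_differentiable_at J g q \<Longrightarrow> real_differentiable_at J h q
    \<Longrightarrow> real_differentiable_at J (\<lambda>w. g w + h w) q"
  unfolding real_differentiable_at_iff[OF J q] using has_wirtinger_add by blast

lemma real_differentiable_mult:
  "real_differentiable_at J g q \<Longrightarrow> real_differentiable_at J h q
    \<Longrightarrow> real_differentiable_at J (\<lambda>w. g w * h w) q"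
  unfolding real_differentiable_at_iff[OF J q] using has_wirtinger_mult[OF J q] by blast

lemma real_differentiable_sum:
  "(\<And>k. k \<in> A \<Longrightarrow> real_differentiable_at J (g k) q)
    \<Longrightarrow> real_differentiable_at J (\<lambda>w. \<Sum>k\<in>A. g k w) q"
  by (induction A rule: infinite_finite_induct)
    (auto intro: real_differentiable_const real_differentiable_add)

lemma real_differentiable_cong_space:
  "real_differentiable_at J g q \<Longrightarrow> (\<And>w. w \<in> cspace J \<Longrightarrow> g w = h w)
    \<Longrightarrow> real_differentiable_at J h q"
  unfolding real_differentiable_at_iff[OF J q] using has_wirtinger_cong_space[OF _ q] by blast

lemma derivative_along_const: "derivative_along J W (\<lambda>w. c) q = 0"
  using derivative_along_has_wirtinger[OF J q has_wirtinger_const] by simp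

lemma derivative_along_add:
  assumes "real_differentiable_at J g q" "real_differentiable_at J h q"
  shows "derivative_along J W (\<lambda>w. g w + h w) q = derivative_along J W g q + derivative_along J W h q"
proof -
  obtain a b a' b' where g: "has_wirtinger J g a b q" and h: "has_wirtinger J h a' b' q"
    using assms by (auto simp: real_differentiable_at_iff[OF J q])
  show ?thesis
    unfolding derivative_along_has_wirtinger[OF J q g] derivative_along_has_wirtinger[OF J q h]
      derivative_along_has_wirtinger[OF J q has_wirtinger_add[OF g h]]
    by (simp add: algebra_simps sum.distrib)
qed

lemma derivative_along_mult:
  assumes "real_differentiable_at J g q" "real_differentiable_at J h q"
  shows "derivative_along J W (\<lambda>w. g w * h w) q
    = derivative_along J W g q * h q + g q * derivative_along J W h q"
proof -
  obtain a b a' b' where g: "has_wirtinger J g a b q" and h: "has_wirtinger J h a' b' q"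
    using assms by (auto simp: real_differentiable_at_iff[OF J q])
  show ?thesis
    unfolding derivative_along_has_wirtinger[OF J q g] derivative_along_has_wirtinger[OF J q h]
      derivative_along_has_wirtinger[OF J q has_wirtinger_mult[OF J q g h]]
      sum_distrib_left sum_distrib_right sum.distrib[symmetric]
    by (rule sum.cong) (simp_all add: algebra_simps)
qed

lemma derivative_along_sum:
  assumes "\<And>k. k \<in> A \<Longrightarrow> real_differentiable_at J (g k) q"
  shows "derivative_along J W (\<lambda>w. \<Sum>k\<in>A. g k w) q = (\<Sum>k\<in>A. derivative_along J W (g k) q)"
  using assms
  by (induction A rule: infinite_finite_induct)
    (simp_all add: derivative_along_const derivative_along_add real_differentiable_sum)

lemma derivative_along_cnj:
  assumes "real_differentiable_at J g q"
  shows "derivative_along J W (\<lambda>w. cnj (g w)) q = cnj (derivative_along J (conj_cvector W) g q)"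
proof -
  obtain a b where g: "has_wirtinger J g a b q"
    using assms by (auto simp: real_differentiable_at_iff[OF J q])
  show ?thesis
    unfolding derivative_along_has_wirtinger[OF J q g] derivative_along_has_wirtinger[OF J q has_wirtinger_cnj[OF g]]
    by (simp add: conj_cvector_def add.commute)
qed

lemma derivative_along_cong_space:
  assumes "real_differentiable_at J g q" "\<And>w. w \<in> cspace J \<Longrightarrow> g w = h w"
  shows "derivative_along J W g q = derivative_along J W h q"
proof -
  obtain a b where g: "has_wirtinger J g a b q"
    using assms by (auto simp: real_differentiable_at_iff[OF J q])
  show ?thesis
    using derivative_along_has_wirtinger[OF J q g]
      derivative_along_has_wirtinger[OF J q has_wirtinger_cong_space[OF g q assms(2)]] by simp
qed

text \<open>A complexified direction \<open>W\<close> is \<open>V + \<i> V'\<close> with \<open>V\<close> and \<open>V'\<close> real, and real directions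
  are velocities of curves.\<close>

lemma derivative_along_zero_of_real_directions:
  assumes g: "real_differentiable_at J g q"
    and V: "\<And>d. d = (\<lambda>j. (fst W j + cnj (snd W j)) / 2) \<or> d = (\<lambda>j. (fst W j - cnj (snd W j)) / (2 * \<i>))
        \<Longrightarrow> derivative_along J (d, \<lambda>j. cnj (d j)) g q = 0"
  shows "derivative_along J W g q = 0"
proof -
  define d where "d = (\<lambda>j. (fst W j + cnj (snd W j)) / 2)"
  define d' where "d' = (\<lambda>j. (fst W j - cnj (snd W j)) / (2 * \<i>))"
  obtain a b where ab: "has_wirtinger J g a b q"
    using g by (auto simp: real_differentiable_at_iff[OF J q])
  have "fst W j = d j + \<i> * d' j" "snd W j = cnj (d j) + \<i> * cnj (d' j)" for j
    by (auto simp: d_def d'_def field_simps)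
  then have "derivative_along J W g q = derivative_along J (d, \<lambda>j. cnj (d j)) g q
      + \<i> * derivative_along J (d', \<lambda>j. cnj (d' j)) g q"
    unfolding derivative_along_has_wirtinger[OF J q ab] sum_distrib_left sum.distrib[symmetric]
    by (intro sum.cong) (simp_all add: algebra_simps)
  then show ?thesis using V[of d] V[of d'] by (simp add: d_def d'_def)
qed

end


section \<open>Tube hypersurfaces\<close>

lemma fst_sum_apply: "fst (sum f A) j = (\<Sum>r\<in>A. fst (f r) j)"
  by (induction A rule: infinite_finite_induct) auto

lemma snd_sum_apply: "snd (sum f A) j = (\<Sum>r\<in>A. snd (f r) j)"
  by (induction A rule: infinite_finite_induct) auto

text \<open>\<open>G\<close> and \<open>H\<close> are the gradient and the Hessian of \<open>\<Phi>\<close> with respect to the real parts of the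
  coordinates; \<open>u\<close> is the field in the kernel of \<open>H\<close> normalized by \<open>u \<xi> = 1\<close>, and \<open>U\<close> is its
  differential. The condition \<open>U_ker\<close> says that \<open>u\<close> is constant along its flow.\<close>

locale tube =
  fixes J :: "'i set" and o' \<xi> :: 'i
    and \<Phi> :: "('i \<Rightarrow> complex) \<Rightarrow> real"
    and G :: "'i \<Rightarrow> ('i \<Rightarrow> complex) \<Rightarrow> real"
    and H :: "'i \<Rightarrow> 'i \<Rightarrow> ('i \<Rightarrow> complex) \<Rightarrow> real"
    and u :: "'i \<Rightarrow> ('i \<Rightarrow> complex) \<Rightarrow> real"
    and U :: "'i \<Rightarrow> 'i \<Rightarrow> ('i \<Rightarrow> complex) \<Rightarrow> real"
  assumes finJ: "finite J" and oJ: "o' \<in> J" and xJ: "\<xi> \<in> J" and ox: "o' \<noteq> \<xi>"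
    and Phi_diff: "q \<in> cspace J \<Longrightarrow>
      has_wirtinger J (\<lambda>p. of_real (\<Phi> p)) (\<lambda>j. of_real (G j q) / 2) (\<lambda>j. of_real (G j q) / 2) q"
    and G_o: "G o' q = 0"
    and Phi_o: "\<Phi> (q(o' := c)) = \<Phi> q"
    and G_diff: "q \<in> cspace J \<Longrightarrow> k \<in> J - {o'} \<Longrightarrow>
      has_wirtinger J (\<lambda>p. of_real (G k p)) (\<lambda>l. of_real (H k l q) / 2) (\<lambda>l. of_real (H k l q) / 2) q"
    and H_o: "H k o' q = 0"
    and H_sym: "k \<in> J - {o'} \<Longrightarrow> l \<in> J - {o'} \<Longrightarrow> H k l q = H l k q"
    and H_ker: "k \<in> J - {o'} \<Longrightarrow> (\<Sum>l\<in>J - {o'}. H k l q * u l q) = 0"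
    and H_nondeg: "\<forall>k\<in>J - {o', \<xi>}. (\<Sum>l\<in>J - {o', \<xi>}. of_real (H k l q) * d l) = 0
      \<Longrightarrow> l \<in> J - {o', \<xi>} \<Longrightarrow> d l = (0::complex)"
    and u_xi: "u \<xi> q = 1"
    and u_diff: "q \<in> cspace J \<Longrightarrow> r \<in> J - {o', \<xi>} \<Longrightarrow>
      has_wirtinger J (\<lambda>p. of_real (u r p)) (\<lambda>l. of_real (U r l q) / 2) (\<lambda>l. of_real (U r l q) / 2) q"
    and U_o: "U r o' q = 0"
    and U_ker: "r \<in> J - {o', \<xi>} \<Longrightarrow> (\<Sum>l\<in>J - {o'}. U r l q * u l q) = 0"
begin

abbreviation "\<rho> \<equiv> graph_eq o' \<Phi>"
abbreviation "M \<equiv> hypersurface J \<rho>"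
abbreviation "N \<equiv> J - {o'}"
abbreviation "I \<equiv> J - {o', \<xi>}"

section \<open>Tangent spaces of a tube\<close>

lemma M_cspace: "q \<in> M \<Longrightarrow> q \<in> cspace J"
  by (simp add: hypersurface_def)

lemma sum_J: "(\<Sum>j\<in>J. f j) = f o' + (\<Sum>j\<in>N. f j)" for f :: "'i \<Rightarrow> complex"
  using finJ oJ by (rule sum.remove)

lemma sum_N: "(\<Sum>j\<in>N. f j) = f \<xi> + (\<Sum>j\<in>I. f j)" for f :: "'i \<Rightarrow> complex"
proof -
  have "N - {\<xi>} = I" by auto
  then show ?thesis using sum.remove[of N \<xi> f] finJ xJ ox by simp
qed

lemma rho_diff:
  assumes q: "q \<in> cspace J"
  shows "has_wirtinger J (\<lambda>p. of_real (\<rho> p)) (\<lambda>j. if j = o' then 1 / 2 else - of_real (G j q) / 2)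
    (\<lambda>j. if j = o' then 1 / 2 else - of_real (G j q) / 2) q"
proof -
  have 1: "has_wirtinger J (\<lambda>w. of_real (Re (w o'))) (\<lambda>j. if j = o' then of_real 1 / 2 else 0)
    (\<lambda>j. if j = o' then of_real 1 / 2 else 0) q"
    by (rule has_wirtinger_of_real_Re[OF finJ q oJ DERIV_ident])
  have 2: "has_wirtinger J (\<lambda>w. of_real (Re (w o')) + (- 1) * of_real (\<Phi> w))
     (\<lambda>j. (if j = o' then of_real 1 / 2 else 0) + (0 * of_real (\<Phi> q) + (- 1) * (of_real (G j q) / 2)))
     (\<lambda>j. (if j = o' then of_real 1 / 2 else 0) + (0 * of_real (\<Phi> q) + (- 1) * (of_real (G j q) / 2))) q"
    by (intro has_wirtinger_add 1 has_wirtinger_mult[OF finJ q] has_wirtinger_const Phi_diff[OF q])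
  show ?thesis
    by (rule has_wirtinger_eq[OF 2]) (simp_all add: graph_eq_def G_o)
qed

lemma derivative_along_rho:
  assumes q: "q \<in> cspace J"
  shows "derivative_along J W (\<lambda>p. of_real (\<rho> p)) q
    = (fst W o' + snd W o') / 2 - (\<Sum>k\<in>N. of_real (G k q) * (fst W k + snd W k)) / 2"
proof -
  have "(\<Sum>k\<in>N. fst W k * (if k = o' then 1 / 2 else - of_real (G k q) / 2)
        + snd W k * (if k = o' then 1 / 2 else - of_real (G k q) / 2))
      = (\<Sum>k\<in>N. - (of_real (G k q) * (fst W k + snd W k) / 2))"
    by (rule sum.cong) (auto simp: field_simps)
  then show ?thesis
    unfolding derivative_along_has_wirtinger[OF finJ q rho_diff[OF q]] sum_J
    by (simp add: sum_negf sum_divide_distrib add_divide_distrib)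
qed

lemma complex_tangent_iff:
  assumes q: "q \<in> cspace J"
  shows "W \<in> complex_tangent J \<rho> q \<longleftrightarrow> fst W \<in> cspace J \<and> snd W \<in> cspace J
    \<and> fst W o' + snd W o' = (\<Sum>k\<in>N. of_real (G k q) * (fst W k + snd W k))"
  unfolding complex_tangent_def mem_Collect_eq derivative_along_rho[OF q] mem_Times_iff
    diff_divide_distrib[symmetric]
  by auto

lemma T10_iff:
  assumes q: "q \<in> cspace J"
  shows "W \<in> T10 J \<rho> q \<longleftrightarrow> fst W \<in> cspace J \<and> snd W = 0 \<and> fst W o' = (\<Sum>k\<in>N. of_real (G k q) * fst W k)"
  unfolding T10_def mem_Collect_eq complex_tangent_iff[OF q] by (auto simp: cspace_def)

lemma conj_cvector_involutive: "conj_cvector (conj_cvector W) = W"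
  by (simp add: conj_cvector_def)

lemma T01_iff: "W \<in> T01 J \<rho> q \<longleftrightarrow> conj_cvector W \<in> T10 J \<rho> q"
  unfolding T01_def by (metis (no_types, lifting) conj_cvector_involutive image_iff)

lemma conj_tangent:
  assumes q: "q \<in> cspace J" and W: "W \<in> complex_tangent J \<rho> q"
  shows "conj_cvector W \<in> complex_tangent J \<rho> q"
proof -
  have "cnj (fst W o' + snd W o') = cnj (\<Sum>k\<in>N. of_real (G k q) * (fst W k + snd W k))"
    using W by (simp add: complex_tangent_iff[OF q])
  then show ?thesis
    using W by (simp add: complex_tangent_iff[OF q] conj_cvector_def cspace_def add.commute)
qed

lemma T10_tangent: "W \<in> T10 J \<rho> q \<Longrightarrow> W \<in> complex_tangent J \<rho> q"
  by (simp add: T10_def)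

lemma set_sum_T10_T01_iff:
  assumes q: "q \<in> cspace J"
  shows "W \<in> set_sum (T10 J \<rho> q) (T01 J \<rho> q) \<longleftrightarrow>
    (fst W, 0) \<in> T10 J \<rho> q \<and> (\<lambda>j. cnj (snd W j), 0) \<in> T10 J \<rho> q"
proof
  assume "W \<in> set_sum (T10 J \<rho> q) (T01 J \<rho> q)"
  then obtain A B where W: "W = A + B" and A: "A \<in> T10 J \<rho> q" and B: "conj_cvector B \<in> T10 J \<rho> q"
    by (auto simp: set_sum_def T01_iff)
  have sA: "snd A = 0" and fB: "fst B = 0"
    using A B by (auto simp: T10_iff[OF q] conj_cvector_def fun_eq_iff)
  have "A = (fst W, 0)" "conj_cvector B = (\<lambda>j. cnj (snd W j), 0)"
    using sA fB by (auto simp: W prod_eq_iff conj_cvector_def fun_eq_iff)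
  then show "(fst W, 0) \<in> T10 J \<rho> q \<and> (\<lambda>j. cnj (snd W j), 0) \<in> T10 J \<rho> q" using A B by simp
next
  assume *: "(fst W, 0) \<in> T10 J \<rho> q \<and> (\<lambda>j. cnj (snd W j), 0) \<in> T10 J \<rho> q"
  have "conj_cvector (0, snd W) = (\<lambda>j. cnj (snd W j), 0)"
    by (auto simp: conj_cvector_def fun_eq_iff)
  then have "(0, snd W) \<in> T01 J \<rho> q" using * by (simp add: T01_iff)
  moreover have "W = (fst W, 0) + (0, snd W)" by (simp add: prod_eq_iff)
  ultimately show "W \<in> set_sum (T10 J \<rho> q) (T01 J \<rho> q)"
    unfolding set_sum_def using * by blast
qed

text \<open>The curve \<open>q + t d\<close> is pushed back into \<open>M\<close> by changing the real part of its \<open>z\<^sub>o\<close>-coordinate.\<close>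

lemma real_tangent_zero:
  assumes q: "q \<in> M" and g: "real_differentiable_at J g q" and zero: "\<And>p. p \<in> M \<Longrightarrow> g p = 0"
    and d: "d \<in> cspace J" "Re (d o') = (\<Sum>k\<in>N. G k q * Re (d k))"
  shows "derivative_along J (d, \<lambda>j. cnj (d j)) g q = 0"
proof -
  have qJ: "q \<in> cspace J" and q0: "Re (q o') = \<Phi> q"
    using q by (auto simp: hypersurface_def graph_eq_def)
  define l where "l t = (\<lambda>j. q j + of_real t * d j)" for t :: real
  define \<gamma> where "\<gamma> t = (l t)(o' := of_real (\<Phi> (l t)) + \<i> * of_real (Im (l t o')))" for t
  have lJ: "l t \<in> cspace J" for t using qJ d by (simp add: l_def cspace_def)
  have l0: "l 0 = q" by (simp add: l_def)
  have dl: "((\<lambda>t. l t j) has_vector_derivative d j) (at 0)" for j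
  proof -
    have "((\<lambda>t. q j + of_real t * d j) has_vector_derivative 0 + of_real 1 * d j) (at 0)"
      by (intro has_vector_derivative_add has_vector_derivative_const has_vector_derivative_mult_left
              has_vector_derivative_of_real DERIV_ident)
    then show ?thesis by (simp add: l_def)
  qed
  have \<gamma>J: "\<gamma> t \<in> cspace J" for t using lJ[of t] oJ by (auto simp: \<gamma>_def cspace_def)
  have \<gamma>M: "\<gamma> t \<in> M" for t
    using \<gamma>J[of t] by (simp add: hypersurface_def graph_eq_def \<gamma>_def Phi_o)
  have \<gamma>0: "\<gamma> 0 = q"
    using q0 by (auto simp: \<gamma>_def l0 fun_eq_iff complex_eq_iff)
  have "((\<lambda>t. of_real (\<Phi> (l t))) has_vector_derivative
      (\<Sum>j\<in>J. of_real (G j q) / 2 * d j + of_real (G j q) / 2 * cnj (d j))) (at 0)"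
    by (rule has_wirtinger_curve[OF finJ qJ Phi_diff[OF qJ] lJ l0 dl])
  also have "(\<Sum>j\<in>J. of_real (G j q) / 2 * d j + of_real (G j q) / 2 * cnj (d j))
      = (\<Sum>j\<in>N. of_real (G j q * Re (d j)))"
    unfolding sum_J distrib_left[symmetric] complex_add_cnj by (simp add: G_o)
  also have "\<dots> = of_real (Re (d o'))" using d by simp
  finally have dPhi: "((\<lambda>t. complex_of_real (\<Phi> (l t))) has_vector_derivative of_real (Re (d o'))) (at 0)" .
  have dIm: "((\<lambda>t. \<i> * complex_of_real (Im (l t o'))) has_vector_derivative \<i> * of_real (Im (d o'))) (at 0)"
    by (intro has_vector_derivative_mult_right has_vector_derivative_of_real)
      (use bounded_linear.has_vector_derivative[OF bounded_linear_Im dl]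
        in \<open>simp add: has_real_derivative_iff_has_vector_derivative\<close>)
  have d\<gamma>: "((\<lambda>t. \<gamma> t j) has_vector_derivative d j) (at 0)" for j
  proof (cases "j = o'")
    case True
    then show ?thesis
      using has_vector_derivative_add[OF dPhi dIm] by (simp add: \<gamma>_def complex_eq[symmetric])
  next
    case False
    then show ?thesis using dl by (simp add: \<gamma>_def)
  qed
  obtain a b where ab: "has_wirtinger J g a b q"
    using g by (auto simp: real_differentiable_at_iff[OF finJ qJ])
  have "((\<lambda>t. g (\<gamma> t)) has_vector_derivative (\<Sum>j\<in>J. a j * d j + b j * cnj (d j))) (at 0)"
    by (rule has_wirtinger_curve[OF finJ qJ ab \<gamma>J \<gamma>0 d\<gamma>])
  moreover have "(\<lambda>t. g (\<gamma> t)) = (\<lambda>t. 0)" using zero \<gamma>M by auto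
  ultimately have "(\<Sum>j\<in>J. a j * d j + b j * cnj (d j)) = 0"
    using vector_derivative_at[of "\<lambda>t. g (\<gamma> t)"] by (metis vector_derivative_const_at)
  then show ?thesis
    unfolding derivative_along_has_wirtinger[OF finJ qJ ab] by (simp add: mult.commute)
qed

text \<open>The tangency condition has real coefficients, so the real and imaginary parts of a
  tangent \<open>W\<close> are real tangent vectors. Consequently an identity between sections that
  holds on \<open>M\<close> may be differentiated in all complexified tangent directions.\<close>

lemma tangent_zero:
  assumes q: "q \<in> M" and g: "real_differentiable_at J g q" and zero: "\<And>p. p \<in> M \<Longrightarrow> g p = 0"
    and W: "W \<in> complex_tangent J \<rho> q"
  shows "derivative_along J W g q = 0"
proof (rule derivative_along_zero_of_real_directions[OF finJ M_cspace[OF q] g])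
  note W' = W[unfolded complex_tangent_iff[OF M_cspace[OF q]]]
  fix d
  assume "d = (\<lambda>j. (fst W j + cnj (snd W j)) / 2) \<or> d = (\<lambda>j. (fst W j - cnj (snd W j)) / (2 * \<i>))"
  then have "d \<in> cspace J \<and> Re (d o') = (\<Sum>k\<in>N. G k q * Re (d k))"
  proof
    assume d: "d = (\<lambda>j. (fst W j + cnj (snd W j)) / 2)"
    then have *: "Re (d j) = Re (fst W j + snd W j) / 2" for j by simp
    have "Re (d o') = (\<Sum>k\<in>N. G k q * Re (d k))"
      unfolding * W'[THEN conjunct2, THEN conjunct2]
      by (simp add: sum_divide_distrib del: plus_complex.sel)
    then show ?thesis using W' by (simp add: d cspace_def)
  next
    assume d: "d = (\<lambda>j. (fst W j - cnj (snd W j)) / (2 * \<i>))"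
    have *: "Re (d j) = Im (fst W j + snd W j) / 2" for j
      by (simp add: d Re_divide power2_eq_square field_simps)
    have "Re (d o') = (\<Sum>k\<in>N. G k q * Re (d k))"
      unfolding * W'[THEN conjunct2, THEN conjunct2]
      by (simp add: sum_divide_distrib del: plus_complex.sel)
    then show ?thesis using W' by (simp add: d cspace_def)
  qed
  then show "derivative_along J (d, \<lambda>j. cnj (d j)) g q = 0"
    using real_tangent_zero[OF q g zero] by blast
qed

section \<open>Fields prescribed by their coordinates\<close>

definition lift :: "('i \<Rightarrow> complex) \<Rightarrow> ('i \<Rightarrow> complex) \<Rightarrow> 'i cvector" where
  "lift q c = (\<lambda>j. if j = o' then \<Sum>k\<in>N. of_real (G k q) * c k else if j \<in> J then c j else 0, 0)"

lemma lift_apply: "k \<in> N \<Longrightarrow> fst (lift q c) k = c k"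
  by (simp add: lift_def)

lemma lift_T10: "q \<in> cspace J \<Longrightarrow> lift q c \<in> T10 J \<rho> q"
  using oJ by (auto simp: T10_iff lift_def cspace_def intro!: sum.cong)

text \<open>The gradient determines the \<open>o'\<close>-coordinate from those in \<open>N\<close>.
  Hence \<open>V = lift q (fst V)\<close> for \<open>V\<close> in \<open>T10\<close>, and fields can
  be built by prescribing their coordinates in \<open>N\<close> alone.\<close>

lemma T10_eqI:
  assumes q: "q \<in> cspace J" and V: "V \<in> T10 J \<rho> q" and W: "W \<in> T10 J \<rho> q"
    and eq: "\<And>k. k \<in> N \<Longrightarrow> fst V k = fst W k"
  shows "V = W"
proof (rule prod_eqI)
  note V' = V[unfolded T10_iff[OF q]] and W' = W[unfolded T10_iff[OF q]]
  have "(\<Sum>k\<in>N. of_real (G k q) * fst V k) = (\<Sum>k\<in>N. of_real (G k q) * fst W k)"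
    by (rule sum.cong) (use eq in auto)
  then have "fst V o' = fst W o'" using V' W' by simp
  then have "fst V j = fst W j" if "j \<in> J" for j using eq[of j] that by (cases "j = o'") auto
  then show "fst V = fst W" using V' W' cspace_eqI by blast
  show "snd V = snd W" using V' W' by simp
qed

lemma T10_diff:
  "q \<in> cspace J \<Longrightarrow> V \<in> T10 J \<rho> q \<Longrightarrow> W \<in> T10 J \<rho> q \<Longrightarrow> V - W \<in> T10 J \<rho> q"
  by (auto simp: T10_iff cspace_def sum_subtractf algebra_simps)

lemma rdiff_G: "q \<in> cspace J \<Longrightarrow> k \<in> N \<Longrightarrow> real_differentiable_at J (\<lambda>p. of_real (G k p)) q"
  using G_diff real_differentiable_at_iff[OF finJ] by blast

lemma rdiff_u:
  assumes q: "q \<in> cspace J" and k: "k \<in> N"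
  shows "real_differentiable_at J (\<lambda>p. of_real (u k p)) q"
proof (cases "k = \<xi>")
  case True
  then show ?thesis by (simp add: u_xi real_differentiable_const[OF finJ q])
next
  case False
  then show ?thesis
    using u_diff[OF q, of k] k real_differentiable_at_iff[OF finJ q] by blast
qed

lemma section_lift:
  assumes "\<And>q k. q \<in> cspace J \<Longrightarrow> k \<in> N \<Longrightarrow> real_differentiable_at J (c k) q"
    and E: "\<And>q. q \<in> M \<Longrightarrow> lift q (\<lambda>k. c k q) \<in> E q"
  shows "(\<lambda>q. lift q (\<lambda>k. c k q)) \<in> sections J \<rho> E"
proof -
  have "real_differentiable_at J (\<lambda>p. fst (lift p (\<lambda>k. c k p)) j) q" if q: "q \<in> cspace J" and j: "j \<in> J" for j q
  proof (cases "j = o'")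
    case True
    have "real_differentiable_at J (\<lambda>p. \<Sum>k\<in>N. of_real (G k p) * c k p) q"
      using assms(1) q finJ by (intro real_differentiable_sum real_differentiable_mult rdiff_G) auto
    then show ?thesis using True by (simp add: lift_def)
  next
    case False
    then show ?thesis using assms(1) q j by (simp add: lift_def)
  qed
  moreover have "lift q (\<lambda>k. c k q) \<in> cspace J \<times> cspace J" for q
    using oJ by (auto simp: lift_def cspace_def)
  moreover have "real_differentiable_at J (\<lambda>p. snd (lift p (\<lambda>k. c k p)) j) q" if "q \<in> cspace J" for j q
    using that by (simp add: lift_def real_differentiable_const finJ)
  ultimately show ?thesis
    using E M_cspace by (simp add: sections_def)
qed

text \<open>Extends an arbitrary vector of \<open>T10\<close> to a global section by freezing its
  coordinates in \<open>N\<close>; these are the test fields for the Levi kernel.\<close>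

lemma section_const: "(\<lambda>q. lift q c) \<in> sections J \<rho> (T10 J \<rho>)"
  by (rule section_lift) (use finJ M_cspace in \<open>auto intro: real_differentiable_const lift_T10\<close>)

lemma sections_D:
  assumes "X \<in> sections J \<rho> E" "q \<in> M"
  shows "X q \<in> E q"
    and "real_differentiable_at J (\<lambda>p. fst (X p) j) q"
    and "real_differentiable_at J (\<lambda>p. snd (X p) j) q"
proof -
  note q = M_cspace[OF assms(2)]
  show "X q \<in> E q" using assms by (simp add: sections_def)
  show "real_differentiable_at J (\<lambda>p. fst (X p) j) q"
  proof (cases "j \<in> J")
    case False
    then have "0 = fst (X p) j" if "p \<in> cspace J" for p
      using that assms by (auto simp: sections_def cspace_def)
    then show ?thesis
      by (rule real_differentiable_cong_space[OF finJ q real_differentiable_const[OF finJ q]])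
  qed (use assms in \<open>simp add: sections_def\<close>)
  show "real_differentiable_at J (\<lambda>p. snd (X p) j) q"
  proof (cases "j \<in> J")
    case False
    then have "0 = snd (X p) j" if "p \<in> cspace J" for p
      using that assms by (auto simp: sections_def cspace_def)
    then show ?thesis
      by (rule real_differentiable_cong_space[OF finJ q real_differentiable_const[OF finJ q]])
  qed (use assms in \<open>simp add: sections_def\<close>)
qed

lemma derivative_along_G:
  assumes "q \<in> cspace J" "k \<in> N"
  shows "derivative_along J W (\<lambda>p. of_real (G k p)) q
    = (\<Sum>l\<in>N. of_real (H k l q) * (fst W l + snd W l)) / 2"
  unfolding derivative_along_has_wirtinger[OF finJ assms(1) G_diff[OF assms]] sum_J
  by (simp add: H_o sum_divide_distrib algebra_simps add_divide_distrib)

text \<open>Differentiating along \<open>M\<close> the relation that expresses tangency of \<open>X\<close>.\<close>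

lemma section_derivative:
  assumes X: "X \<in> sections J \<rho> (T10 J \<rho>)" and q: "q \<in> M" and W: "W \<in> complex_tangent J \<rho> q"
  defines "y \<equiv> \<lambda>j. derivative_along J W (\<lambda>p. fst (X p) j) q"
  shows "y \<in> cspace J"
    and "y o' = (\<Sum>k\<in>N. of_real (G k q) * y k)
      + (\<Sum>k\<in>N. \<Sum>l\<in>N. fst (X q) k * of_real (H k l q) * (fst W l + snd W l)) / 2"
proof -
  note qJ = M_cspace[OF q]
  show "y \<in> cspace J"
    unfolding cspace_def
  proof (intro CollectI allI impI)
    fix j assume "j \<notin> J"
    then have "0 = fst (X p) j" if "p \<in> cspace J" for p
      using that X by (auto simp: sections_def cspace_def)
    then have "derivative_along J W (\<lambda>p. 0) q = derivative_along J W (\<lambda>p. fst (X p) j) q"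
      by (rule derivative_along_cong_space[OF finJ qJ real_differentiable_const[OF finJ qJ]])
    then show "y j = 0"
      by (simp add: y_def derivative_along_const[OF finJ qJ])
  qed
  note dX = sections_D(2)[OF X q]
  have dS: "real_differentiable_at J (\<lambda>p. of_real (G k p) * fst (X p) k) q" if "k \<in> N" for k
    by (intro real_differentiable_mult finJ qJ rdiff_G that dX)
  define S where "S p = (\<Sum>k\<in>N. of_real (G k p) * fst (X p) k)" for p
  have rS: "real_differentiable_at J S q"
    unfolding S_def[abs_def] by (intro real_differentiable_sum finJ qJ dS)
  have rS': "real_differentiable_at J (\<lambda>p. (- 1) * S p) q"
    by (intro real_differentiable_mult[of _ _ "\<lambda>p. - 1"] real_differentiable_const finJ qJ rS)
  have DS: "derivative_along J W S q
      = (\<Sum>k\<in>N. derivative_along J W (\<lambda>p. of_real (G k p)) q * fst (X q) k + of_real (G k q) * y k)"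
    unfolding S_def[abs_def] y_def
    by (subst derivative_along_sum[OF finJ qJ dS], assumption, rule sum.cong[OF refl],
        rule derivative_along_mult[OF finJ qJ rdiff_G[OF qJ] dX])
  have "derivative_along J W (\<lambda>p. fst (X p) o' + (- 1) * S p) q = 0"
  proof (rule tangent_zero[OF q _ _ W])
    show "real_differentiable_at J (\<lambda>p. fst (X p) o' + (- 1) * S p) q"
      by (intro real_differentiable_add finJ qJ dX rS')
    fix p assume p: "p \<in> M"
    show "fst (X p) o' + (- 1) * S p = 0"
      using sections_D(1)[OF X p] by (simp add: T10_iff[OF M_cspace[OF p]] S_def)
  qed
  moreover have "derivative_along J W (\<lambda>p. fst (X p) o' + (- 1) * S p) q = y o' - derivative_along J W S q"
    unfolding derivative_along_add[OF finJ qJ dX rS'] y_def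
      derivative_along_mult[OF finJ qJ real_differentiable_const[OF finJ qJ] rS]
      derivative_along_const[OF finJ qJ] by simp
  moreover note DS
  moreover have "(\<Sum>k\<in>N. derivative_along J W (\<lambda>p. of_real (G k p)) q * fst (X q) k)
      = (\<Sum>k\<in>N. \<Sum>l\<in>N. fst (X q) k * of_real (H k l q) * (fst W l + snd W l)) / 2"
    unfolding sum_divide_distrib
    by (rule sum.cong) (simp_all add: derivative_along_G[OF qJ] sum_distrib_left sum_distrib_right
        sum_divide_distrib mult.assoc mult.left_commute mult.commute)
  ultimately show "y o' = (\<Sum>k\<in>N. of_real (G k q) * y k)
      + (\<Sum>k\<in>N. \<Sum>l\<in>N. fst (X q) k * of_real (H k l q) * (fst W l + snd W l)) / 2"
    by (simp add: sum.distrib add.commute)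
qed


text \<open>In each half of the bracket one of the two derivatives drops out: it differentiates a
  component that vanishes on \<open>M\<close>, in a direction tangent to \<open>M\<close>.\<close>

lemma bracket_eq:
  assumes X: "X \<in> sections J \<rho> (T10 J \<rho>)" and Y: "Y \<in> sections J \<rho> (T10 J \<rho>)" and q: "q \<in> M"
  shows "lie_bracket J X (\<lambda>p. conj_cvector (Y p)) q =
    (\<lambda>j. - derivative_along J (conj_cvector (Y q)) (\<lambda>p. fst (X p) j) q,
     \<lambda>j. cnj (derivative_along J (conj_cvector (X q)) (\<lambda>p. fst (Y p) j) q))"
proof -
  note qJ = M_cspace[OF q]
  have zero: "derivative_along J W (\<lambda>p. snd (Z p) j) q = 0"
    if Z: "Z \<in> sections J \<rho> (T10 J \<rho>)" and W: "W \<in> complex_tangent J \<rho> q" for Z W j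
    by (rule tangent_zero[OF q sections_D(3)[OF Z q] _ W])
      (use sections_D(1)[OF Z] T10_iff M_cspace in auto)
  have tX: "X q \<in> complex_tangent J \<rho> q" and tY: "Y q \<in> complex_tangent J \<rho> q"
    using sections_D(1)[OF X q] sections_D(1)[OF Y q] T10_tangent by auto
  have "fst (conj_cvector W) j = cnj (snd W j)" "snd (conj_cvector W) j = cnj (fst W j)" for W :: "'i cvector" and j
    by (simp_all add: conj_cvector_def)
  then show ?thesis
    unfolding lie_bracket_def
    by (simp add: derivative_along_cnj[OF finJ qJ] sections_D[OF Y q]
        zero[OF X conj_tangent[OF qJ tY]] zero[OF Y conj_tangent[OF qJ tX]])
qed

section \<open>The Levi form and its kernel\<close>

definition levi :: "('i \<Rightarrow> complex) \<Rightarrow> 'i cvector \<Rightarrow> 'i cvector \<Rightarrow> complex" where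
  "levi q V W = (\<Sum>k\<in>N. \<Sum>l\<in>N. fst V k * of_real (H k l q) * cnj (fst W l))"

lemma levi_commute: "levi q W V = cnj (levi q V W)"
proof -
  have "levi q W V = (\<Sum>l\<in>N. \<Sum>k\<in>N. fst W k * of_real (H k l q) * cnj (fst V l))"
    unfolding levi_def by (rule sum.swap)
  also have "\<dots> = cnj (levi q V W)"
    unfolding levi_def cnj_sum by (intro sum.cong) (auto simp: H_sym)
  finally show ?thesis .
qed

text \<open>By \<open>section_derivative\<close>, the differentiated field violates the tangency
  equation for the \<open>o'\<close>-coordinate exactly by
  \<open>c * levi q (X q) V / 2\<close>.\<close>

lemma minus_derivative_T10_iff:
  assumes X: "X \<in> sections J \<rho> (T10 J \<rho>)" and q: "q \<in> M" and V: "V \<in> T10 J \<rho> q"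
  shows "(\<lambda>j. c * derivative_along J (conj_cvector V) (\<lambda>p. fst (X p) j) q, 0) \<in> T10 J \<rho> q
    \<longleftrightarrow> c = 0 \<or> levi q (X q) V = 0"
proof -
  note qJ = M_cspace[OF q]
  have "conj_cvector V \<in> complex_tangent J \<rho> q"
    using conj_tangent[OF qJ] T10_tangent[OF V] by blast
  note y = section_derivative[OF X q this]
  define y where "y = (\<lambda>j. derivative_along J (conj_cvector V) (\<lambda>p. fst (X p) j) q)"
  have "(\<Sum>k\<in>N. \<Sum>l\<in>N. fst (X q) k * of_real (H k l q) * (fst (conj_cvector V) l + snd (conj_cvector V) l))
      = levi q (X q) V"
    using V by (simp add: levi_def conj_cvector_def T10_iff[OF qJ])
  then have c: "c * y o' = (\<Sum>k\<in>N. of_real (G k q) * (c * y k)) + c * levi q (X q) V / 2"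
    using y(2) by (simp add: y_def algebra_simps sum_distrib_left)
  moreover have "(\<lambda>j. c * y j) \<in> cspace J" using y(1) by (simp add: y_def cspace_def)
  ultimately show ?thesis
    unfolding T10_iff[OF qJ] fst_conv snd_conv c[unfolded y_def] y_def by auto
qed

text \<open>The two halves of the bracket give the conditions \<open>levi q (X q) (Y q) = 0\<close>
  and \<open>levi q (Y q) (X q) = 0\<close>, which agree by Hermitian symmetry.\<close>

lemma bracket_levi:
  assumes X: "X \<in> sections J \<rho> (T10 J \<rho>)" and Y: "Y \<in> sections J \<rho> (T10 J \<rho>)" and q: "q \<in> M"
  shows "lie_bracket J X (\<lambda>p. conj_cvector (Y p)) q \<in> set_sum (T10 J \<rho> q) (T01 J \<rho> q)
    \<longleftrightarrow> levi q (X q) (Y q) = 0"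
  using minus_derivative_T10_iff[OF X q sections_D(1)[OF Y q], of "- 1"]
    minus_derivative_T10_iff[OF Y q sections_D(1)[OF X q], of 1] levi_commute[of q "Y q" "X q"]
  unfolding set_sum_T10_T01_iff[OF M_cspace[OF q]] bracket_eq[OF X Y q]
  by auto

lemma levi_kernelI:
  assumes "X \<in> sections J \<rho> (T10 J \<rho>)"
    and "\<And>Y. Y \<in> sections J \<rho> (T10 J \<rho>)
      \<Longrightarrow> lie_bracket J X (\<lambda>p. conj_cvector (Y p)) q \<in> set_sum (T10 J \<rho> q) (T01 J \<rho> q)"
  shows "X q \<in> levi_kernel J \<rho> q"
  unfolding levi_kernel_def mem_Collect_eq
  by (rule exI[of _ X], intro conjI refl ballI) (fact assms)+

lemma levi_kernel_field:
  assumes "\<And>k. k \<in> I \<Longrightarrow> fst V k = fst V \<xi> * of_real (u k q)"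
  shows "levi q V W = 0"
proof -
  have Vk: "fst V k = fst V \<xi> * of_real (u k q)" if "k \<in> N" for k
    using assms that by (cases "k = \<xi>") (auto simp: u_xi)
  have "levi q V W = (\<Sum>l\<in>N. \<Sum>k\<in>N. fst V k * of_real (H k l q) * cnj (fst W l))"
    unfolding levi_def by (rule sum.swap)
  also have "\<dots> = (\<Sum>l\<in>N. fst V \<xi> * cnj (fst W l) * of_real (\<Sum>k\<in>N. H l k q * u k q))"
    unfolding of_real_sum sum_distrib_left by (intro sum.cong refl) (auto simp: Vk H_sym)
  also have "\<dots> = 0" using H_ker by (intro sum.neutral) simp
  finally show ?thesis .
qed

lemma levi_kernel_iff:
  assumes q: "q \<in> M"
  shows "V \<in> levi_kernel J \<rho> q \<longleftrightarrow> V \<in> T10 J \<rho> q \<and> (\<forall>k\<in>I. fst V k = fst V \<xi> * of_real (u k q))"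
proof
  note qJ = M_cspace[OF q]
  assume "V \<in> levi_kernel J \<rho> q"
  then obtain X where V: "V = X q" and X: "X \<in> sections J \<rho> (T10 J \<rho>)"
    and bracket: "\<And>Y. Y \<in> sections J \<rho> (T10 J \<rho>)
      \<Longrightarrow> lie_bracket J X (\<lambda>p. conj_cvector (Y p)) q \<in> set_sum (T10 J \<rho> q) (T01 J \<rho> q)"
    unfolding levi_kernel_def mem_Collect_eq by blast
  have 0: "levi q V (Y q) = 0" if "Y \<in> sections J \<rho> (T10 J \<rho>)" for Y
    using bracket[OF that] bracket_levi[OF X that q] V by simp
  have H0: "(\<Sum>k\<in>N. of_real (H l k q) * fst V k) = 0" if l: "l \<in> N" for l
  proof -
    have *: "(\<Sum>j\<in>N. fst V k * of_real (H k j q) * cnj (fst (lift q (\<lambda>j. if j = l then 1 else 0)) j))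
        = of_real (H l k q) * fst V k" if k: "k \<in> N" for k
    proof -
      have "(\<Sum>j\<in>N. fst V k * of_real (H k j q) * cnj (fst (lift q (\<lambda>j. if j = l then 1 else 0)) j))
          = (\<Sum>j\<in>N. if j = l then fst V k * of_real (H k j q) else 0)"
        by (rule sum.cong) (simp_all add: lift_apply)
      then show ?thesis using l finJ H_sym[OF k l] by simp
    qed
    have "(\<Sum>k\<in>N. of_real (H l k q) * fst V k) = levi q V (lift q (\<lambda>j. if j = l then 1 else 0))"
      unfolding levi_def by (rule sum.cong[OF refl *[symmetric]])
    then show ?thesis using 0[OF section_const] by simp
  qed
  \<comment> \<open>Testing against lifts of unit vectors put \<open>fst V\<close> into the kernel
    of the Hessian. Subtracting the multiple of \<open>u\<close> with the same
    \<open>\<xi>\<close>-coordinate leaves a kernel vector supported on \<open>I\<close>, to which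
    \<open>H_nondeg\<close> applies.\<close>
  have "(\<Sum>k\<in>I. of_real (H l k q) * (fst V k - fst V \<xi> * of_real (u k q))) = 0" if l: "l \<in> I" for l
  proof -
    have lN: "l \<in> N" using l by blast
    have "(\<Sum>k\<in>N. of_real (H l k q) * (fst V k - fst V \<xi> * of_real (u k q)))
        = (\<Sum>k\<in>N. of_real (H l k q) * fst V k) - fst V \<xi> * of_real (\<Sum>k\<in>N. H l k q * u k q)"
      by (simp add: sum_subtractf sum_distrib_left algebra_simps)
    also have "\<dots> = 0" using H0[OF lN] H_ker[OF lN] by simp
    finally show ?thesis unfolding sum_N by (simp add: u_xi)
  qed
  then have "fst V k - fst V \<xi> * of_real (u k q) = 0" if "k \<in> I" for k
    using H_nondeg[of q "\<lambda>k. fst V k - fst V \<xi> * of_real (u k q)"] that by blast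
  then show "V \<in> T10 J \<rho> q \<and> (\<forall>k\<in>I. fst V k = fst V \<xi> * of_real (u k q))"
    using sections_D(1)[OF X q] V by simp
next
  note qJ = M_cspace[OF q]
  assume *: "V \<in> T10 J \<rho> q \<and> (\<forall>k\<in>I. fst V k = fst V \<xi> * of_real (u k q))"
  \<comment> \<open>The bracket condition is tested at \<open>q\<close> only, so \<open>V\<close> is
    extended with constant coordinates, although this extension may leave the kernel away from
    \<open>q\<close>.\<close>
  have V: "lift q (fst V) = V"
    by (rule T10_eqI[OF qJ lift_T10[OF qJ] conjunct1[OF *] lift_apply])
  have "levi q V W = 0" for W
    using * by (intro levi_kernel_field) auto
  then have "lie_bracket J (\<lambda>p. lift p (fst V)) (\<lambda>p. conj_cvector (Y p)) q \<in> set_sum (T10 J \<rho> q) (T01 J \<rho> q)"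
    if "Y \<in> sections J \<rho> (T10 J \<rho>)" for Y
    unfolding bracket_levi[OF section_const that q] V .
  then have "lift q (fst V) \<in> levi_kernel J \<rho> q"
    by (rule levi_kernelI[OF section_const])
  then show "V \<in> levi_kernel J \<rho> q" unfolding V .
qed

lemma levi_kernel_T10: "q \<in> M \<Longrightarrow> V \<in> levi_kernel J \<rho> q \<Longrightarrow> V \<in> T10 J \<rho> q"
  by (simp add: levi_kernel_iff)

lemma section_kernel: "(\<lambda>q. lift q (\<lambda>k. c * of_real (u k q))) \<in> sections J \<rho> (levi_kernel J \<rho>)"
proof (rule section_lift)
  show "real_differentiable_at J (\<lambda>q. c * of_real (u k q)) q" if "q \<in> cspace J" "k \<in> N" for q k
    using that by (intro real_differentiable_mult real_differentiable_const finJ rdiff_u)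
  show "lift q (\<lambda>k. c * of_real (u k q)) \<in> levi_kernel J \<rho> q" if q: "q \<in> M" for q
    using lift_T10[OF M_cspace[OF q]] xJ ox by (simp add: levi_kernel_iff[OF q] lift_apply u_xi)
qed

section \<open>Adjoint operators of the kernel\<close>

lemma sections_kernel_T10: "V \<in> sections J \<rho> (levi_kernel J \<rho>) \<Longrightarrow> V \<in> sections J \<rho> (T10 J \<rho>)"
  using levi_kernel_T10 by (auto simp: sections_def)

text \<open>Product rule for \<open>fst V r = fst V \<xi> * u r\<close>, an identity on
  \<open>M\<close>. The left side is the \<open>r\<close>-coordinate of the derivative of
  \<open>V\<close> modulo the kernel; the right side shows that it depends on \<open>V\<close> only
  through \<open>V q\<close>.\<close>

lemma kernel_section_derivative:
  assumes V: "V \<in> sections J \<rho> (levi_kernel J \<rho>)" and q: "q \<in> M" and W: "W \<in> complex_tangent J \<rho> q"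
    and r: "r \<in> I"
  shows "derivative_along J W (\<lambda>p. fst (V p) r) q
    - derivative_along J W (\<lambda>p. fst (V p) \<xi>) q * of_real (u r q)
    = fst (V q) \<xi> * (\<Sum>l\<in>N. of_real (U r l q) * (fst W l + snd W l)) / 2"
proof -
  note qJ = M_cspace[OF q]
  note V' = sections_kernel_T10[OF V]
  have rN: "r \<in> N" using r by blast
  note dV = sections_D(2)[OF V' q] and du = rdiff_u[OF qJ rN]
  note dVu = real_differentiable_mult[OF finJ qJ dV du]
  have dVu': "real_differentiable_at J (\<lambda>p. (- 1) * (fst (V p) \<xi> * of_real (u r p))) q"
    by (intro real_differentiable_mult[of _ _ "\<lambda>p. - 1"] real_differentiable_const finJ qJ dVu)
  have "0 = derivative_along J W (\<lambda>p. fst (V p) r + (- 1) * (fst (V p) \<xi> * of_real (u r p))) q"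
  proof (rule tangent_zero[OF q _ _ W, symmetric])
    show "real_differentiable_at J (\<lambda>p. fst (V p) r + (- 1) * (fst (V p) \<xi> * of_real (u r p))) q"
      by (intro real_differentiable_add finJ qJ dV dVu')
    fix p assume p: "p \<in> M"
    show "fst (V p) r + (- 1) * (fst (V p) \<xi> * of_real (u r p)) = 0"
      using sections_D(1)[OF V p] r by (simp add: levi_kernel_iff[OF p])
  qed
  also have "\<dots> = derivative_along J W (\<lambda>p. fst (V p) r) q
      - (derivative_along J W (\<lambda>p. fst (V p) \<xi>) q * of_real (u r q)
         + fst (V q) \<xi> * derivative_along J W (\<lambda>p. of_real (u r p)) q)"
    unfolding derivative_along_add[OF finJ qJ dV dVu']
      derivative_along_mult[OF finJ qJ real_differentiable_const[OF finJ qJ] dVu]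
      derivative_along_mult[OF finJ qJ dV du] derivative_along_const[OF finJ qJ] by simp
  also have "derivative_along J W (\<lambda>p. of_real (u r p)) q
      = (\<Sum>l\<in>N. of_real (U r l q) * (fst W l + snd W l)) / 2"
    unfolding derivative_along_has_wirtinger[OF finJ qJ u_diff[OF qJ r]] sum_J
    by (simp add: U_o sum_divide_distrib algebra_simps add_divide_distrib)
  finally show ?thesis by (simp add: diff_diff_eq[symmetric] diff_eq_eq add.commute)
qed

text \<open>In the coordinates \<open>fst w r - fst w \<xi> * u r\<close> of the quotient, the
  adjoint operator is \<open>x \<mapsto> - (fst v \<xi> / 2) U conj(x)\<close>. Independence of the
  section \<open>V\<close> is \<open>kernel_section_derivative\<close>; independence of the
  representative of \<open>x\<close> is \<open>U_ker\<close>.\<close>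

lemma levi_ad_iff:
  assumes q: "q \<in> M" and v: "v \<in> levi_kernel J \<rho> q" and x: "x \<in> T10 J \<rho> q"
  shows "w \<in> levi_ad J \<rho> q v x \<longleftrightarrow> w \<in> T10 J \<rho> q \<and> (\<forall>r\<in>I. fst w r - fst w \<xi> * of_real (u r q)
    = - fst v \<xi> * (\<Sum>l\<in>N. of_real (U r l q) * cnj (fst x l)) / 2)"
proof -
  note qJ = M_cspace[OF q]
  \<comment> \<open>Changing \<open>x\<close> by a kernel vector adds a multiple of
    \<open>U u\<close>, which is 0.\<close>
  have kernel_mod: "(\<Sum>l\<in>N. of_real (U r l q) * cnj (fst y l)) = (\<Sum>l\<in>N. of_real (U r l q) * cnj (fst x l))"
    if y: "y - x \<in> levi_kernel J \<rho> q" and r: "r \<in> I" for y r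
  proof -
    have "fst y l - fst x l = (fst y \<xi> - fst x \<xi>) * of_real (u l q)" if "l \<in> N" for l
      using y that by (cases "l = \<xi>") (auto simp: levi_kernel_iff[OF q] u_xi)
    then have yl: "fst y l = fst x l + (fst y \<xi> - fst x \<xi>) * of_real (u l q)" if "l \<in> N" for l
      using that by (simp add: algebra_simps)
    have "(\<Sum>l\<in>N. of_real (U r l q) * cnj (fst y l)) = (\<Sum>l\<in>N. of_real (U r l q) * cnj (fst x l))
        + cnj (fst y \<xi> - fst x \<xi>) * of_real (\<Sum>l\<in>N. U r l q * u l q)"
      unfolding of_real_sum sum_distrib_left sum.distrib[symmetric]
      by (rule sum.cong) (simp_all add: yl algebra_simps)
    then show ?thesis using U_ker[OF r] by simp
  qed
  have bracket: "lie_bracket J V (\<lambda>p. conj_cvector (X p)) q - w \<in> set_sum (T01 J \<rho> q) (levi_kernel J \<rho> q)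
      \<longleftrightarrow> (\<forall>r\<in>I. fst w r - fst w \<xi> * of_real (u r q)
        = - fst (V q) \<xi> * (\<Sum>l\<in>N. of_real (U r l q) * cnj (fst (X q) l)) / 2)" (is "?B - w \<in> ?S \<longleftrightarrow> ?R")
    if V: "V \<in> sections J \<rho> (levi_kernel J \<rho>)" and X: "X \<in> sections J \<rho> (T10 J \<rho>)"
      and w: "w \<in> T10 J \<rho> q" for V X
  proof -
    note V' = sections_kernel_T10[OF V]
    have Xq: "X q \<in> T10 J \<rho> q" by (rule sections_D(1)[OF X q])
    have tX: "conj_cvector (X q) \<in> complex_tangent J \<rho> q"
      by (rule conj_tangent[OF qJ T10_tangent[OF Xq]])
    have "levi q (V q) (X q) = 0"
      using sections_D(1)[OF V q] by (intro levi_kernel_field) (auto simp: levi_kernel_iff[OF q])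
    then have BT: "?B \<in> set_sum (T10 J \<rho> q) (T01 J \<rho> q)"
      using bracket_levi[OF V' X q] by simp
    then have fB: "(fst ?B, 0) \<in> T10 J \<rho> q" and sB: "(\<lambda>j. cnj (snd ?B j), 0) \<in> T10 J \<rho> q"
      by (auto simp: set_sum_T10_T01_iff[OF qJ])
    \<comment> \<open>The (0,1) half of the bracket is itself tangent, because the Levi form
      vanishes on \<open>V q\<close>; it is absorbed by \<open>T01\<close>, and only the (1,0) half
      is compared with \<open>w\<close>.\<close>
    have "?B - w \<in> ?S \<longleftrightarrow> (fst ?B - fst w, 0) \<in> levi_kernel J \<rho> q"
    proof
      assume "?B - w \<in> ?S"
      then obtain A K where BAK: "?B - w = A + K" and A: "conj_cvector A \<in> T10 J \<rho> q"
        and K: "K \<in> levi_kernel J \<rho> q"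
        by (auto simp: set_sum_def T01_iff)
      have "fst A = 0" "snd K = 0"
        using A levi_kernel_T10[OF q K] by (auto simp: T10_iff[OF qJ] conj_cvector_def fun_eq_iff)
      then have "K = (fst ?B - fst w, 0)"
        using BAK by (auto simp: prod_eq_iff)
      then show "(fst ?B - fst w, 0) \<in> levi_kernel J \<rho> q" using K by simp
    next
      assume K: "(fst ?B - fst w, 0) \<in> levi_kernel J \<rho> q"
      have "conj_cvector (0, snd ?B) = (\<lambda>j. cnj (snd ?B j), 0)"
        by (auto simp: conj_cvector_def fun_eq_iff)
      then have "(0, snd ?B) \<in> T01 J \<rho> q" using sB by (simp add: T01_iff)
      moreover have "?B - w = (0, snd ?B) + (fst ?B - fst w, 0)"
        using w by (simp add: prod_eq_iff T10_iff[OF qJ])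
      ultimately show "?B - w \<in> ?S" unfolding set_sum_def using K by blast
    qed
    also have "\<dots> \<longleftrightarrow> (\<forall>r\<in>I. fst ?B r - fst w r = (fst ?B \<xi> - fst w \<xi>) * of_real (u r q))"
    proof -
      have "(fst ?B - fst w, 0) = (fst ?B, 0) - w" using w by (simp add: prod_eq_iff T10_iff[OF qJ])
      then have "(fst ?B - fst w, 0) \<in> T10 J \<rho> q" using T10_diff[OF qJ fB w] by simp
      then show ?thesis by (simp add: levi_kernel_iff[OF q])
    qed
    also have "\<dots> \<longleftrightarrow> ?R"
    proof (rule ball_cong[OF refl])
      fix r assume r: "r \<in> I"
      have "(\<Sum>l\<in>N. of_real (U r l q) * (fst (conj_cvector (X q)) l + snd (conj_cvector (X q)) l))
          = (\<Sum>l\<in>N. of_real (U r l q) * cnj (fst (X q) l))"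
        using Xq by (simp add: conj_cvector_def T10_iff[OF qJ])
      then have *: "fst ?B r - fst ?B \<xi> * of_real (u r q)
          = - fst (V q) \<xi> * (\<Sum>l\<in>N. of_real (U r l q) * cnj (fst (X q) l)) / 2"
        using kernel_section_derivative[OF V q tX r] unfolding bracket_eq[OF V' X q] fst_conv
        by (metis (no_types, lifting) minus_diff_minus minus_divide_left mult_minus_left)
      show "fst ?B r - fst w r = (fst ?B \<xi> - fst w \<xi>) * of_real (u r q) \<longleftrightarrow>
        fst w r - fst w \<xi> * of_real (u r q)
          = - fst (V q) \<xi> * (\<Sum>l\<in>N. of_real (U r l q) * cnj (fst (X q) l)) / 2"
        unfolding *[symmetric] by (auto simp: algebra_simps)
    qed
    finally show ?thesis .
  qed
  show ?thesis
  proof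
    assume "w \<in> levi_ad J \<rho> q v x"
    then obtain V X where w: "w \<in> T10 J \<rho> q" and V: "V \<in> sections J \<rho> (levi_kernel J \<rho>)" "V q = v"
      and X: "X \<in> sections J \<rho> (T10 J \<rho>)" "X q - x \<in> levi_kernel J \<rho> q"
      and B: "lie_bracket J V (\<lambda>p. conj_cvector (X p)) q - w \<in> set_sum (T01 J \<rho> q) (levi_kernel J \<rho> q)"
      unfolding levi_ad_def by blast
    show "w \<in> T10 J \<rho> q \<and> (\<forall>r\<in>I. fst w r - fst w \<xi> * of_real (u r q)
      = - fst v \<xi> * (\<Sum>l\<in>N. of_real (U r l q) * cnj (fst x l)) / 2)"
      using B w by (simp add: bracket[OF V(1) X(1) w] V(2) kernel_mod[OF X(2)])
  next
    assume w: "w \<in> T10 J \<rho> q \<and> (\<forall>r\<in>I. fst w r - fst w \<xi> * of_real (u r q)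
      = - fst v \<xi> * (\<Sum>l\<in>N. of_real (U r l q) * cnj (fst x l)) / 2)"
    \<comment> \<open>Witnesses for membership: \<open>v\<close> is extended as a constant multiple
      of the kernel field \<open>u\<close>, and \<open>x\<close> with constant coordinates.\<close>
    define V where "V = (\<lambda>p. lift p (\<lambda>k. fst v \<xi> * of_real (u k p)))"
    define X where "X = (\<lambda>p. lift p (fst x))"
    have V: "V \<in> sections J \<rho> (levi_kernel J \<rho>)" unfolding V_def by (rule section_kernel)
    have X: "X \<in> sections J \<rho> (T10 J \<rho>)" unfolding X_def by (rule section_const)
    have Xq: "X q = x"
      unfolding X_def by (rule T10_eqI[OF qJ lift_T10[OF qJ] x]) (simp add: lift_apply)
    have Vq: "V q = v"
      unfolding V_def
    proof (rule T10_eqI[OF qJ lift_T10[OF qJ] levi_kernel_T10[OF q v]])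
      fix k assume "k \<in> N"
      then show "fst (lift q (\<lambda>k. fst v \<xi> * of_real (u k q))) k = fst v k"
        using v by (cases "k = \<xi>") (auto simp: lift_apply levi_kernel_iff[OF q] u_xi)
    qed
    have "X q - x \<in> levi_kernel J \<rho> q"
      unfolding Xq using T10_diff[OF qJ x x] by (simp add: levi_kernel_iff[OF q])
    then show "w \<in> levi_ad J \<rho> q v x"
      unfolding levi_ad_def mem_Collect_eq using w V X Vq Xq bracket[OF V X]
      by (intro conjI exI[of _ V] exI[of _ X]) simp_all
  qed
qed

text \<open>Modulo the Levi kernel every vector of \<open>T10\<close> is congruent to one with vanishing
  \<open>\<xi>\<close>-coordinate, so the quotient is identified with the functions on \<open>I\<close>.\<close>

lemma combination_T10:
  assumes "q \<in> cspace J"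
  shows "(\<Sum>s<m. scale_cvector (b s) (lift q (e s))) = lift q (\<lambda>j. \<Sum>s<m. b s * e s j)"
proof (rule prod_eqI; rule ext)
  fix j
  have "(\<Sum>s<m. b s * (\<Sum>k\<in>N. of_real (G k q) * e s k)) = (\<Sum>k\<in>N. of_real (G k q) * (\<Sum>s<m. b s * e s k))"
    unfolding sum_distrib_left by (subst sum.swap) (simp add: mult.left_commute)
  then show "fst (\<Sum>s<m. scale_cvector (b s) (lift q (e s))) j = fst (lift q (\<lambda>j. \<Sum>s<m. b s * e s j)) j"
    by (simp add: fst_sum_apply lift_def scale_cvector_def)
  show "snd (\<Sum>s<m. scale_cvector (b s) (lift q (e s))) j = snd (lift q (\<lambda>j. \<Sum>s<m. b s * e s j)) j"
    by (simp add: snd_sum_apply lift_def scale_cvector_def)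
qed

lemma diff_lift_kernel_iff:
  assumes q: "q \<in> M" and w: "w \<in> T10 J \<rho> q" and c: "c \<xi> = 0"
  shows "w - lift q c \<in> levi_kernel J \<rho> q \<longleftrightarrow> (\<forall>r\<in>I. fst w r - fst w \<xi> * of_real (u r q) = c r)"
  using T10_diff[OF M_cspace[OF q] w lift_T10[OF M_cspace[OF q], of c]] xJ ox c
  by (auto simp: levi_kernel_iff[OF q] lift_apply algebra_simps)

section \<open>Rank, representing matrices and nondegeneracy\<close>

lemma levi_kernel_rank_1:
  assumes q: "q \<in> M"
  shows "has_rank (levi_kernel J \<rho> q) 1"
proof -
  note qJ = M_cspace[OF q]
  define v where "v = lift q (\<lambda>k. of_real (u k q))"
  have vK: "v \<in> levi_kernel J \<rho> q"
    using lift_T10[OF qJ] xJ ox by (simp add: levi_kernel_iff[OF q] v_def lift_apply u_xi)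
  have vx: "fst v \<xi> = 1" using xJ ox by (simp add: v_def lift_apply u_xi)
  have *: "w - scale_cvector c v = 0 \<longleftrightarrow> c = fst w \<xi>" if w: "w \<in> levi_kernel J \<rho> q" for w c
  proof
    assume "w - scale_cvector c v = 0"
    then have "fst w \<xi> = fst (scale_cvector c v) \<xi>" by simp
    then show "c = fst w \<xi>" by (simp add: scale_cvector_def vx)
  next
    assume c: "c = fst w \<xi>"
    have "w = lift q (\<lambda>k. c * of_real (u k q))"
    proof (rule T10_eqI[OF qJ levi_kernel_T10[OF q w] lift_T10[OF qJ]])
      fix k assume "k \<in> N"
      then show "fst w k = fst (lift q (\<lambda>k. c * of_real (u k q))) k"
        using w by (cases "k = \<xi>") (auto simp: lift_apply levi_kernel_iff[OF q] u_xi c)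
    qed
    also have "\<dots> = scale_cvector c v"
      using combination_T10[OF qJ, of "\<lambda>_. c" "\<lambda>_ k. of_real (u k q)" "Suc 0"]
      by (simp add: v_def lessThan_Suc)
    finally show "w - scale_cvector c v = 0" by simp
  qed
  have "quotient_basis 1 (\<lambda>_. v) (levi_kernel J \<rho> q) {0}"
    unfolding quotient_basis_def
  proof (intro conjI ballI allI impI vK)
    fix w assume w: "w \<in> levi_kernel J \<rho> q"
    show "\<exists>!c. c \<in> carrier_vec 1 \<and> w - (\<Sum>r<1. scale_cvector (vec_index c r) v) \<in> {0}"
    proof (rule ex1I[of _ "vec 1 (\<lambda>_. fst w \<xi>)"])
      show "vec 1 (\<lambda>_. fst w \<xi>) \<in> carrier_vec 1 \<and> w - (\<Sum>r<1. scale_cvector (vec_index (vec 1 (\<lambda>_. fst w \<xi>)) r) v) \<in> {0}"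
        using *[OF w] by simp
    next
      fix c assume c: "c \<in> carrier_vec 1 \<and> w - (\<Sum>r<1. scale_cvector (vec_index c r) v) \<in> {0}"
      then have "vec_index c 0 = fst w \<xi>" using *[OF w, of "vec_index c 0"] by simp
      then show "c = vec 1 (\<lambda>_. fst w \<xi>)" using c by (auto intro!: eq_vecI)
    qed
  qed
  then show ?thesis unfolding has_rank_def by blast
qed

text \<open>With \<open>E\<close> the matrix whose columns are the functions \<open>e s\<close> on
  \<open>I\<close>, the hypotheses say that \<open>E\<close> is invertible and
  \<open>- U conj(E) = E A\<close>. These columns are the basis of the quotient in which the
  operator has matrix \<open>A\<close>.\<close>

theorem ad_represented_byI:
  assumes q: "q \<in> M" and A: "A \<in> carrier_mat m m"
    and basis: "\<And>w. \<exists>!c. c \<in> carrier_vec m \<and> (\<forall>r\<in>I. (\<Sum>s<m. vec_index c s * e s r) = w r)"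
    and ad: "\<And>s r. s < m \<Longrightarrow> r \<in> I \<Longrightarrow>
      - (\<Sum>l\<in>I. of_real (U r l q) * cnj (e s l)) = (\<Sum>k<m. A $$ (k, s) * e k r)"
  shows "ad_represented_by J \<rho> q A"
proof -
  note qJ = M_cspace[OF q]
  \<comment> \<open>Each class in the quotient is represented by its vector with
    \<open>\<xi>\<close>-coordinate 0.\<close>
  define e' where "e' s = (\<lambda>j. if j = \<xi> then 0 else e s j)" for s
  \<comment> \<open>The factor 2 cancels the denominator in \<open>levi_ad_iff\<close>, which stems
    from the Wirtinger derivatives.\<close>
  define v where "v = lift q (\<lambda>k. 2 * of_real (u k q))"
  have vK: "v \<in> levi_kernel J \<rho> q"
    using lift_T10[OF qJ] xJ ox by (simp add: levi_kernel_iff[OF q] v_def lift_apply u_xi)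
  have vx: "fst v \<xi> = 2" using xJ ox by (simp add: v_def lift_apply u_xi)
  have comb: "(\<Sum>s<m. b s * e' s \<xi>) = 0" "r \<in> I \<Longrightarrow> (\<Sum>s<m. b s * e' s r) = (\<Sum>s<m. b s * e s r)" for b r
    by (auto simp: e'_def)
  have "quotient_basis m (\<lambda>s. lift q (e' s)) (T10 J \<rho> q) (levi_kernel J \<rho> q)"
    unfolding quotient_basis_def
  proof (intro conjI ballI allI impI lift_T10[OF qJ])
    fix w assume w: "w \<in> T10 J \<rho> q"
    have "w - (\<Sum>s<m. scale_cvector (vec_index c s) (lift q (e' s))) \<in> levi_kernel J \<rho> q
        \<longleftrightarrow> (\<forall>r\<in>I. (\<Sum>s<m. vec_index c s * e s r) = fst w r - fst w \<xi> * of_real (u r q))" for c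
      unfolding combination_T10[OF qJ] diff_lift_kernel_iff[OF q w, where c = "\<lambda>j. \<Sum>s<m. _ s * e' s j", OF comb(1)]
      by (intro ball_cong refl, subst comb(2), assumption, rule eq_commute)
    then show "\<exists>!c. c \<in> carrier_vec m
        \<and> w - (\<Sum>s<m. scale_cvector (vec_index c s) (lift q (e' s))) \<in> levi_kernel J \<rho> q"
      using basis by simp
  qed
  moreover have "levi_ad J \<rho> q v (lift q (e' s)) = coset_in (T10 J \<rho> q) (levi_kernel J \<rho> q)
      (\<Sum>r<m. scale_cvector (A $$ (r, s)) (lift q (e' r)))" if s: "s < m" for s
  proof (rule Set.set_eqI)
    fix w
    have sumU: "(\<Sum>l\<in>N. of_real (U r l q) * cnj (fst (lift q (e' s)) l)) = - (\<Sum>k<m. A $$ (k, s) * e k r)"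
      if r: "r \<in> I" for r
      unfolding ad[OF s r, symmetric] sum_N using xJ ox by (simp add: lift_apply e'_def)
    show "w \<in> levi_ad J \<rho> q v (lift q (e' s)) \<longleftrightarrow> w \<in> coset_in (T10 J \<rho> q) (levi_kernel J \<rho> q)
      (\<Sum>r<m. scale_cvector (A $$ (r, s)) (lift q (e' r)))"
      unfolding levi_ad_iff[OF q vK lift_T10[OF qJ]] coset_in_def mem_Collect_eq combination_T10[OF qJ]
    proof (rule conj_cong[OF refl])
      assume w: "w \<in> T10 J \<rho> q"
      show "(\<forall>r\<in>I. fst w r - fst w \<xi> * of_real (u r q)
          = - fst v \<xi> * (\<Sum>l\<in>N. of_real (U r l q) * cnj (fst (lift q (e' s)) l)) / 2)
        \<longleftrightarrow> w - lift q (\<lambda>j. \<Sum>k<m. A $$ (k, s) * e' k j) \<in> levi_kernel J \<rho> q"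
        by (subst diff_lift_kernel_iff[OF q w]) (auto simp: comb vx sumU)
    qed
  qed
  moreover have "v \<noteq> 0" using vx by auto
  ultimately show ?thesis
    unfolding ad_represented_by_def carrier_matD(1)[OF A]
    using A levi_kernel_rank_1[OF q] vK
    by (intro conjI exI[of _ v] exI[of _ "\<lambda>s. lift q (e' s)"]) simp_all
qed

text \<open>Applied to the unit vector \<open>s\<close>, the adjoint operator of \<open>v\<close>
  has \<open>r\<close>-coordinate \<open>- fst v \<xi> * U r s / 2\<close>. This recovers
  \<open>fst v \<xi>\<close>, and a kernel vector is determined by its
  \<open>\<xi>\<close>-coordinate.\<close>

theorem uniformly_2_nondegenerateI:
  assumes U: "\<And>q. q \<in> M \<Longrightarrow> \<exists>r\<in>I. \<exists>s\<in>I. U r s q \<noteq> 0"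
  shows "uniformly_2_nondegenerate J \<rho>"
  unfolding uniformly_2_nondegenerate_def
proof (intro conjI exI[of _ 1] ballI inj_onI)
  fix q v v'
  assume q: "q \<in> M" and v: "v \<in> levi_kernel J \<rho> q" and v': "v' \<in> levi_kernel J \<rho> q"
    and eq: "restrict (levi_ad J \<rho> q v) (T10 J \<rho> q) = restrict (levi_ad J \<rho> q v') (T10 J \<rho> q)"
  note qJ = M_cspace[OF q]
  obtain r s where r: "r \<in> I" and s: "s \<in> I" and Urs: "U r s q \<noteq> 0" using U[OF q] by blast
  define x where "x = lift q (\<lambda>k. if k = s then 1 else 0)"
  have x: "x \<in> T10 J \<rho> q" unfolding x_def by (rule lift_T10[OF qJ])
  have sumU: "(\<Sum>l\<in>N. of_real (U r' l q) * cnj (fst x l)) = of_real (U r' s q)" for r'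
  proof -
    have "(\<Sum>l\<in>N. of_real (U r' l q) * cnj (fst x l)) = (\<Sum>l\<in>N. if l = s then of_real (U r' l q) else 0)"
      by (rule sum.cong) (auto simp: x_def lift_apply)
    then show ?thesis using s finJ by auto
  qed
  define w where "w = lift q (\<lambda>r'. if r' = \<xi> then 0 else - fst v \<xi> * of_real (U r' s q) / 2)"
  have "w \<in> levi_ad J \<rho> q v x"
    unfolding levi_ad_iff[OF q v x] sumU
    using lift_T10[OF qJ] xJ ox by (auto simp: w_def lift_apply)
  then have "w \<in> levi_ad J \<rho> q v' x"
    using fun_cong[OF eq, of x] x by simp
  then have "fst v \<xi> * of_real (U r s q) = fst v' \<xi> * of_real (U r s q)"
    unfolding levi_ad_iff[OF q v' x] sumU using r xJ ox by (auto simp: w_def lift_apply)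
  then have vv: "fst v \<xi> = fst v' \<xi>" using Urs by simp
  show "v = v'"
  proof (rule T10_eqI[OF qJ levi_kernel_T10[OF q v] levi_kernel_T10[OF q v']])
    fix k assume "k \<in> N"
    then show "fst v k = fst v' k"
      using v v' vv by (cases "k = \<xi>") (auto simp: levi_kernel_iff[OF q])
  qed
qed (use levi_kernel_rank_1 in simp_all)

end


section \<open>Chains of nilpotent semilinear operators\<close>

context vector_space
begin

notation scale (infixr "\<cdot>" 75)

text \<open>Coefficients are indexed by \<open>D\<close> rather than by the image because
  \<open>f\<close> need not be injective; vectors of different chains may coincide.\<close>

lemma span_image_sum:
  assumes "finite D" "x \<in> span (f ` D)"
  shows "\<exists>c. x = (\<Sum>d\<in>D. c d \<cdot> f d)"
  using assms(2)
proof (induction rule: span_induct_alt)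
  case base
  show ?case by (rule exI[of _ "\<lambda>_. 0"]) simp
next
  case (step a x y)
  then obtain d c where d: "d \<in> D" "x = f d" and c: "y = (\<Sum>d\<in>D. c d \<cdot> f d)" by auto
  have "a \<cdot> x + y = (\<Sum>e\<in>D. (if e = d then a \<cdot> f e else 0) + c e \<cdot> f e)"
    using d assms(1) by (simp add: sum.distrib c)
  also have "\<dots> = (\<Sum>e\<in>D. ((if e = d then a else 0) + c e) \<cdot> f e)"
    by (rule sum.cong) (auto simp: scale_left_distrib)
  finally show ?case by (intro exI[of _ "\<lambda>e. (if e = d then a else 0) + c e"])
qed

text \<open>Among the systems of chains \<open>v, F v, F\<^sup>2 v, \<dots>\<close> spanning \<open>S\<close>, one with the least total
  length is linearly independent: a power of \<open>F\<close> turns a linear relation into a relation between the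
  last vectors of some chains, and dividing the latter by a power of \<open>F\<close> replaces the generator of the
  shortest of these chains by one whose chain is shorter.\<close>

lemma semilinear_nilpotent_chains:
  fixes F :: "'b \<Rightarrow> 'b" and \<sigma> :: "'a \<Rightarrow> 'a" and v :: "nat \<Rightarrow> 'b" and n :: "nat \<Rightarrow> nat"
  assumes F_add: "\<And>x y. F (x + y) = F x + F y"
    and F_scale: "\<And>c x. F (c \<cdot> x) = \<sigma> c \<cdot> F x"
    and \<sigma>: "bij \<sigma>" "\<sigma> 0 = 0"
    and S: "subspace S" "\<And>x. x \<in> S \<Longrightarrow> F x \<in> S"
    and v: "\<And>j. j < k \<Longrightarrow> v j \<in> S" "\<And>j. j < k \<Longrightarrow> (F ^^ n j) (v j) = 0"
    and span: "S \<subseteq> span ((\<lambda>(j, i). (F ^^ i) (v j)) ` (SIGMA j:{..<k}. {..<n j}))"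
  shows "\<exists>v n. (\<forall>j<k. v j \<in> S \<and> (F ^^ n j) (v j) = 0)
    \<and> S \<subseteq> span ((\<lambda>(j, i). (F ^^ i) (v j)) ` (SIGMA j:{..<k}. {..<n j}))
    \<and> (\<forall>c. (\<Sum>(j, i)\<in>(SIGMA j:{..<k}. {..<n j}). c j i \<cdot> (F ^^ i) (v j)) = 0
          \<longrightarrow> (\<forall>j<k. \<forall>i<n j. c j i = 0))"
  using v span
proof (induction "\<Sum>j<k. n j" arbitrary: v n rule: less_induct)
  case less
  note v = less.prems(1,2) and span = less.prems(3)
  have F0: "F 0 = 0" using F_add[of 0 0] by simp
  have Fi0: "(F ^^ i) 0 = 0" for i by (induction i) (simp_all add: F0)
  have Fi_add: "(F ^^ i) (x + y) = (F ^^ i) x + (F ^^ i) y" for i x y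
    by (induction i) (simp_all add: F_add)
  have Fi_scale: "(F ^^ i) (c \<cdot> x) = (\<sigma> ^^ i) c \<cdot> (F ^^ i) x" for i c x
    by (induction i) (simp_all add: F_scale)
  have Fi_sum: "(F ^^ i) (\<Sum>j\<in>A. g j) = (\<Sum>j\<in>A. (F ^^ i) (g j))" for i and g :: "'c \<Rightarrow> 'b" and A
    by (induction A rule: infinite_finite_induct) (simp_all add: Fi0 Fi_add)
  have Fi_S: "x \<in> S \<Longrightarrow> (F ^^ i) x \<in> S" for i x by (induction i) (simp_all add: S)
  have \<sigma>i0: "(\<sigma> ^^ i) c = 0 \<longleftrightarrow> c = 0" for i c
  proof -
    have "\<sigma> c = 0 \<longleftrightarrow> c = 0" for c using \<sigma> by (metis bij_is_inj injD)
    then show ?thesis by (induction i) simp_all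
  qed
  have \<sigma>i_surj: "\<exists>y. (\<sigma> ^^ i) y = x" for i x
    using bij_is_surj[OF bij_fn[OF \<sigma>(1)]] by (metis surj_def)
  have van: "(F ^^ i) (v j) = 0" if "j < k" "n j \<le> i" for i j
  proof -
    have "(F ^^ i) (v j) = (F ^^ (i - n j)) ((F ^^ n j) (v j))"
      using that by (simp flip: funpow_add add: comp_apply[of "F ^^ (i - n j)" "F ^^ n j", symmetric] del: comp_apply)
    then show ?thesis using v(2)[OF that(1)] Fi0 by simp
  qed
  show ?case
  proof (cases "\<forall>c. (\<Sum>(j, i)\<in>(SIGMA j:{..<k}. {..<n j}). c j i \<cdot> (F ^^ i) (v j)) = 0
          \<longrightarrow> (\<forall>j<k. \<forall>i<n j. c j i = 0)")
    case True
    then show ?thesis using v span by (intro exI[of _ v] exI[of _ n]) simp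
  next
    case False
    then obtain c j1 i1 where rel: "(\<Sum>(j, i)\<in>(SIGMA j:{..<k}. {..<n j}). c j i \<cdot> (F ^^ i) (v j)) = 0"
      and ji1: "j1 < k" "i1 < n j1" "c j1 i1 \<noteq> 0" by blast
    define T where "T = {(j, i). j < k \<and> i < n j \<and> c j i \<noteq> 0}"
    have "T \<subseteq> (SIGMA j:{..<k}. {..<n j})" by (auto simp: T_def)
    then have finT: "finite T" by (rule finite_subset) auto
    \<comment> \<open>The largest distance of a vector occurring in the relation from the end of its
      chain. Applying \<open>F\<close> exactly \<open>s\<close> times kills every occurring vector
      except those at this distance, which become the last vectors of their chains.\<close>
    define s where "s = Max ((\<lambda>(j, i). n j - 1 - i) ` T)"
    have s_ge: "n j - 1 - i \<le> s" if "(j, i) \<in> T" for j i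
      unfolding s_def using that finT by (intro Max_ge) (auto intro!: image_eqI[where x = "(j, i)"])
    have "s \<in> (\<lambda>(j, i). n j - 1 - i) ` T"
      unfolding s_def using finT ji1 by (intro Max_in) (auto simp: T_def)
    then obtain j2 i2 where ji2: "(j2, i2) \<in> T" "s = n j2 - 1 - i2" by auto
    define d where "d j = (if s < n j then (\<sigma> ^^ s) (c j (n j - 1 - s)) else 0)" for j
    have block: "(\<Sum>i<n j. (\<sigma> ^^ s) (c j i) \<cdot> (F ^^ (s + i)) (v j)) = d j \<cdot> (F ^^ (n j - 1)) (v j)"
      if j: "j < k" for j
    proof (cases "s < n j")
      case True
      define i0 where "i0 = n j - 1 - s"
      have i0: "i0 < n j" "s + i0 = n j - 1" using True by (auto simp: i0_def)
      have "(\<sigma> ^^ s) (c j i) \<cdot> (F ^^ (s + i)) (v j) = 0" if "i < n j" "i \<noteq> i0" for i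
      proof (cases "c j i = 0")
        case False
        then have "n j - 1 - i \<le> s" using s_ge that j by (auto simp: T_def)
        then have "n j \<le> s + i" using that i0 by linarith
        then show ?thesis using van[OF j] by simp
      qed (simp add: \<sigma>i0)
      then have "(\<Sum>i\<in>{..<n j} - {i0}. (\<sigma> ^^ s) (c j i) \<cdot> (F ^^ (s + i)) (v j)) = 0"
        by (intro sum.neutral) auto
      then show ?thesis
        using sum.remove[of "{..<n j}" i0 "\<lambda>i. (\<sigma> ^^ s) (c j i) \<cdot> (F ^^ (s + i)) (v j)"] i0 True
        by (simp add: d_def i0_def)
    next
      case False
      then show ?thesis using van[OF j] by (simp add: d_def)
    qed
    have "0 = (F ^^ s) (\<Sum>j<k. \<Sum>i<n j. c j i \<cdot> (F ^^ i) (v j))"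
      using rel by (simp add: sum.Sigma Fi0)
    also have "\<dots> = (\<Sum>j<k. d j \<cdot> (F ^^ (n j - 1)) (v j))"
      using block by (simp add: Fi_sum Fi_scale funpow_add)
    finally have top: "(\<Sum>j<k. d j \<cdot> (F ^^ (n j - 1)) (v j)) = 0" by simp
    define Q where "Q = {j. j < k \<and> d j \<noteq> 0}"
    have finQ: "finite Q" by (simp add: Q_def)
    have "j2 \<in> Q"
    proof -
      have "s < n j2" "n j2 - 1 - s = i2" using ji2 by (auto simp: T_def)
      then show ?thesis using ji2 by (simp add: Q_def d_def T_def \<sigma>i0)
    qed
    then obtain j0 where "is_arg_min n (\<lambda>j. j \<in> Q) j0"
      using ex_is_arg_min_if_finite[OF finQ, of n] by blast
    then have j0: "j0 \<in> Q" and j0_min: "\<And>j. j \<in> Q \<Longrightarrow> n j0 \<le> n j"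
      by (auto simp: is_arg_min_def not_less)
    have nj: "s < n j" if "j \<in> Q" for j using that by (auto simp: Q_def d_def split: if_splits)
    define m where "m = n j0 - 1"
    have nm: "n j0 = Suc m" using nj[OF j0] by (simp add: m_def)
    have "\<forall>j. \<exists>y. (\<sigma> ^^ m) y = d j" using \<sigma>i_surj by blast
    from choice[OF this] obtain e where e: "\<And>j. (\<sigma> ^^ m) (e j) = d j" by blast
    have e0: "e j0 \<noteq> 0" using e[of j0] j0 \<sigma>i0[of m "e j0"] by (auto simp: Q_def)
    \<comment> \<open>A quotient of the relation \<open>top\<close> by \<open>F ^^ m\<close>. The
      exponents \<open>n j - n j0\<close> make sense by minimality of \<open>n j0\<close>, and the
      \<open>e j\<close> undo the twist of the scalars by \<open>\<sigma> ^^ m\<close>.\<close>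
    define w where "w = (\<Sum>j\<in>Q. e j \<cdot> (F ^^ (n j - n j0)) (v j))"
    have "(F ^^ m) w = (\<Sum>j\<in>Q. d j \<cdot> (F ^^ (n j - 1)) (v j))"
      unfolding w_def Fi_sum Fi_scale e
    proof (rule sum.cong[OF refl])
      fix j assume "j \<in> Q"
      then have "m + (n j - n j0) = n j - 1" using j0_min nm by fastforce
      then show "d j \<cdot> (F ^^ m) ((F ^^ (n j - n j0)) (v j)) = d j \<cdot> (F ^^ (n j - 1)) (v j)"
        by (metis funpow_add comp_apply)
    qed
    also have "\<dots> = (\<Sum>j<k. d j \<cdot> (F ^^ (n j - 1)) (v j))"
      by (rule sum.mono_neutral_left) (auto simp: Q_def)
    finally have Fw: "(F ^^ m) w = 0" using top by simp
    have wS: "w \<in> S"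
      unfolding w_def using v(1) S by (intro subspace_sum subspace_scale Fi_S) (auto simp: Q_def)
    \<comment> \<open>\<open>w\<close> replaces the generator \<open>v j0\<close>; its chain has
      length at most \<open>m = n j0 - 1\<close>, so the total length drops by one.\<close>
    define v' where "v' = v(j0 := w)"
    define n' where "n' = n(j0 := m)"
    have j0k: "j0 < k" using j0 by (simp add: Q_def)
    have less_sum: "(\<Sum>j<k. n' j) < (\<Sum>j<k. n j)"
      by (rule sum_strict_mono_ex1) (use j0k in \<open>auto simp: n'_def nm\<close>)
    let ?new = "span ((\<lambda>(j, i). (F ^^ i) (v' j)) ` (SIGMA j:{..<k}. {..<n' j}))"
    have base: "(F ^^ i) (v' j) \<in> ?new" if "j < k" "i < n' j" for j i
      using that by (intro span_base) (auto intro!: image_eqI[where x = "(j, i)"])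
    have other: "(F ^^ i) (v j) \<in> ?new" if "j < k" "j \<noteq> j0" for j i
    proof (cases "i < n j")
      case True
      then show ?thesis using base[of j i] that by (simp add: v'_def n'_def)
    next
      case False
      then show ?thesis using van[OF that(1)] by (simp add: span_zero)
    qed
    \<comment> \<open>\<open>v j0\<close> occurs in \<open>w\<close> with the nonzero coefficient
      \<open>e j0\<close>, so the vectors of the old chain can be solved for in terms of
      \<open>w\<close> and the other chains.\<close>
    have shortest: "(F ^^ i) (v j0) \<in> ?new" if i: "i < n j0" for i
    proof -
      have "w = e j0 \<cdot> v j0 + (\<Sum>j\<in>Q - {j0}. e j \<cdot> (F ^^ (n j - n j0)) (v j))"
        unfolding w_def by (subst sum.remove[OF finQ j0]) simp
      then have "(F ^^ i) w = (\<sigma> ^^ i) (e j0) \<cdot> (F ^^ i) (v j0)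
          + (\<Sum>j\<in>Q - {j0}. (\<sigma> ^^ i) (e j) \<cdot> (F ^^ (i + (n j - n j0))) (v j))"
        by (simp add: Fi_add Fi_sum Fi_scale funpow_add)
      then have "(\<sigma> ^^ i) (e j0) \<cdot> (F ^^ i) (v j0)
          = (F ^^ i) w - (\<Sum>j\<in>Q - {j0}. (\<sigma> ^^ i) (e j) \<cdot> (F ^^ (i + (n j - n j0))) (v j))"
        by (simp add: algebra_simps)
      moreover have "(F ^^ i) w \<in> ?new"
      proof (cases "i < m")
        case True
        then show ?thesis using base[of j0 i] j0k by (simp add: v'_def n'_def)
      next
        case False
        then have "i = m" using i nm by simp
        then show ?thesis using Fw by (simp add: span_zero)
      qed
      ultimately have "(\<sigma> ^^ i) (e j0) \<cdot> (F ^^ i) (v j0) \<in> ?new"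
        using other by (auto intro!: span_diff span_sum span_scale simp: Q_def)
      then have "inverse ((\<sigma> ^^ i) (e j0)) \<cdot> ((\<sigma> ^^ i) (e j0) \<cdot> (F ^^ i) (v j0)) \<in> ?new"
        by (rule span_scale)
      then show ?thesis using e0 by (simp add: \<sigma>i0)
    qed
    have "span ((\<lambda>(j, i). (F ^^ i) (v j)) ` (SIGMA j:{..<k}. {..<n j})) \<subseteq> ?new"
    proof (rule span_minimal[OF _ subspace_span], clarsimp)
      fix j i assume "j < k" "i < n j"
      then show "(F ^^ i) (v j) \<in> ?new" using shortest other by (cases "j = j0") auto
    qed
    then have "S \<subseteq> ?new" using span by blast
    then show ?thesis
      using v wS Fw by (intro less.hyps[OF less_sum]) (auto simp: v'_def n'_def)
  qed
qed

end


text \<open>The \<open>K j i\<close> are the rows of an invertible matrix \<open>K\<close> with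
  \<open>K A = T conj(K)\<close>, where \<open>T\<close> is the direct sum of the matrices
  \<open>T_mat (n j)\<close>; equivalently the basis change \<open>B = K\<^sup>-\<^sup>1\<close>
  gives \<open>B\<^sup>-\<^sup>1 A conj(B) = T\<close>. Unique solvability encodes invertibility and
  forces the \<open>n j\<close> to add up to \<open>N\<close>.\<close>

definition chain_matrix ::
    "nat \<Rightarrow> complex mat \<Rightarrow> nat \<Rightarrow> (nat \<Rightarrow> nat) \<Rightarrow> (nat \<Rightarrow> nat \<Rightarrow> nat \<Rightarrow> complex) \<Rightarrow> bool" where
  "chain_matrix N A \<mu> n K \<longleftrightarrow>
     (\<forall>j\<in>{1..\<mu>}. \<forall>i\<in>{1..n j}. \<forall>s<N.
        (\<Sum>r<N. K j i r * A $$ (r, s)) = (if i = 1 then 0 else cnj (K j (i - 1) s))) \<and>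
     (\<forall>w. \<exists>!c. c \<in> carrier_vec N \<and>
        (\<forall>j\<in>{1..\<mu>}. \<forall>i\<in>{1..n j}. (\<Sum>s<N. vec_index c s * K j i s) = w j i))"

section \<open>Existence of chains of rows\<close>

interpretation fun_space: vector_space "\<lambda>c f s. c * f s :: complex"
  by unfold_locales (auto simp: fun_eq_iff algebra_simps)

lemma fun_sum_apply: "(\<Sum>i\<in>A. f i) x = (\<Sum>i\<in>A. f i x)" for f :: "'a \<Rightarrow> 'b \<Rightarrow> 'c::comm_monoid_add"
  by (induction A rule: infinite_finite_induct) auto

text \<open>The operator of the rows, \<open>y \<mapsto> conj (A\<^sup>T y)\<close>, is nilpotent since it is adjoint to
  \<open>w \<mapsto> A conj w\<close>.\<close>

definition row_op :: "nat \<Rightarrow> complex mat \<Rightarrow> (nat \<Rightarrow> complex) \<Rightarrow> nat \<Rightarrow> complex" where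
  "row_op N A y = (\<lambda>s. if s < N then cnj (\<Sum>r<N. y r * A $$ (r, s)) else 0)"

lemma row_op_nilpotent:
  assumes A: "A \<in> carrier_mat N N" and nil: "antilinear_nilpotent A"
  obtains m where "\<And>y. y \<in> cspace {..<N} \<Longrightarrow> (row_op N A ^^ m) y = 0"
proof -
  let ?F = "\<lambda>w. A *\<^sub>v conjugate w"
  obtain m where m: "\<And>w. w \<in> carrier_vec N \<Longrightarrow> (?F ^^ m) w = 0\<^sub>v N"
    using nil A unfolding antilinear_nilpotent_def by auto
  have carr: "(?F ^^ i) w \<in> carrier_vec N" if "w \<in> carrier_vec N" for i w
    using that A by (induction i) auto
  define pair where "pair y w = (\<Sum>r<N. y r * vec_index w r)" for y :: "nat \<Rightarrow> complex" and w
  have step: "pair y (?F w) = cnj (pair (row_op N A y) w)" if w: "w \<in> carrier_vec N" for y w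
  proof -
    have "pair y (?F w) = (\<Sum>r<N. \<Sum>s<N. y r * (A $$ (r, s) * cnj (vec_index w s)))"
      unfolding pair_def
    proof (rule sum.cong[OF refl])
      fix r assume "r \<in> {..<N}"
      then have "vec_index (?F w) r = (\<Sum>s<N. A $$ (r, s) * cnj (vec_index w s))"
        using w A by (simp add: scalar_prod_def atLeast0LessThan)
      then show "y r * vec_index (?F w) r = (\<Sum>s<N. y r * (A $$ (r, s) * cnj (vec_index w s)))"
        by (simp add: sum_distrib_left)
    qed
    also have "\<dots> = (\<Sum>s<N. \<Sum>r<N. y r * (A $$ (r, s) * cnj (vec_index w s)))" by (rule sum.swap)
    also have "\<dots> = cnj (pair (row_op N A y) w)"
      unfolding pair_def cnj_sum
      by (intro sum.cong) (auto simp: row_op_def sum_distrib_right mult.assoc)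
    finally show ?thesis .
  qed
  have pow: "pair y ((?F ^^ i) w) = 0 \<longleftrightarrow> pair ((row_op N A ^^ i) y) w = 0" if w: "w \<in> carrier_vec N" for i y w
    using w
  proof (induction i arbitrary: w)
    case (Suc i)
    have "(?F ^^ Suc i) w = (?F ^^ i) (?F w)" by (simp only: funpow_Suc_right o_apply)
    then have "pair y ((?F ^^ Suc i) w) = 0 \<longleftrightarrow> pair ((row_op N A ^^ i) y) (?F w) = 0"
      using Suc.IH[of "?F w"] A Suc.prems by simp
    then show ?case using step[OF Suc.prems] by simp
  qed simp
  have "(row_op N A ^^ m) y = 0" if y: "y \<in> cspace {..<N}" for y
  proof
    fix s
    show "(row_op N A ^^ m) y s = 0 s"
    proof (cases "s < N")
      case True
      have "pair y ((?F ^^ m) (unit_vec N s)) = 0" by (simp add: m pair_def)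
      then have "pair ((row_op N A ^^ m) y) (unit_vec N s) = 0" by (simp add: pow)
      moreover have "pair z (unit_vec N s) = z s" for z
      proof -
        have "pair z (unit_vec N s) = (\<Sum>r<N. if r = s then z r else 0)"
          unfolding pair_def by (rule sum.cong) (auto simp: unit_vec_def)
        then show ?thesis using True by simp
      qed
      ultimately show ?thesis by simp
    next
      case False
      then show ?thesis using y by (cases m) (auto simp: row_op_def cspace_def)
    qed
  qed
  then show thesis by (rule that)
qed

text \<open>The rows are chains of \<open>row_op\<close>, for which passing from row
  \<open>i\<close> to row \<open>i - 1\<close> is precisely the required relation with
  \<open>A\<close>. Chains of length at least 2 are numbered first, since linking builds their
  blocks before extensions add the others; \<open>A \<noteq> 0\<close> guarantees that one
  exists.\<close>

lemma chain_matrix_exists: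
  assumes A: "A \<in> carrier_mat N N" and nil: "antilinear_nilpotent A" and A0: "A \<noteq> 0\<^sub>m N N"
  obtains \<mu> \<mu>' n K where "1 \<le> \<mu>" "\<mu> \<le> \<mu>'" "\<And>j. j \<in> {1..\<mu>} \<Longrightarrow> n j \<ge> 2" "\<And>j. j \<in> {\<mu><..\<mu>'} \<Longrightarrow> n j = 1"
    "chain_matrix N A \<mu>' n K"
proof -
  let ?S = "cspace {..<N} :: (nat \<Rightarrow> complex) set"
  let ?F = "row_op N A"
  define e where "e s = (\<lambda>r. if r = s then 1 else 0 :: complex)" for s :: nat
  obtain m where m: "\<And>y. y \<in> ?S \<Longrightarrow> (?F ^^ m) y = 0" using row_op_nilpotent[OF A nil] by blast
  have S: "fun_space.subspace ?S" by (auto simp: fun_space.subspace_def cspace_def)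
  have FS: "?F y \<in> ?S" for y by (simp add: row_op_def cspace_def)
  have eS: "e s \<in> ?S" if "s < N" for s using that by (auto simp: e_def cspace_def)
  have expand: "y = (\<Sum>s<N. (\<lambda>r. y s * e s r))" if y: "y \<in> ?S" for y
  proof
    fix r
    have "(\<Sum>s<N. y s * e s r) = (\<Sum>s<N. if s = r then y s else 0)" by (rule sum.cong) (auto simp: e_def)
    also have "\<dots> = y r" using y by (simp add: cspace_def)
    finally show "y r = (\<Sum>s<N. (\<lambda>r. y s * e s r)) r" by (simp add: fun_sum_apply)
  qed
  \<comment> \<open>The initial system has a chain starting at every unit vector. The length
    \<open>Suc m\<close> is positive even for \<open>m = 0\<close>, so the unit vectors themselves
    belong to it.\<close>
  have "?S \<subseteq> fun_space.span ((\<lambda>(j, i). (?F ^^ i) (e j)) ` (SIGMA j:{..<N}. {..<Suc m}))" (is "_ \<subseteq> ?sp")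
  proof
    fix y assume y: "y \<in> ?S"
    have "e s \<in> ?sp" if "s < N" for s
      using that by (intro fun_space.span_base) (auto intro!: image_eqI[where x = "(s, 0)"])
    then have "(\<Sum>s<N. (\<lambda>r. y s * e s r)) \<in> ?sp"
      by (intro fun_space.span_sum fun_space.span_scale) auto
    then show "y \<in> ?sp" using expand[OF y] by simp
  qed
  moreover have "(?F ^^ Suc m) (e j) = 0" if "j < N" for j
    using m[OF FS[of "e j"]] by (simp add: funpow_Suc_right del: funpow.simps)
  moreover have "bij cnj" by (rule involuntory_imp_bij) simp
  moreover have "?F (x + y) = ?F x + ?F y" for x y
    by (auto simp: row_op_def fun_eq_iff sum.distrib algebra_simps)
  moreover have "?F (\<lambda>s. c * y s) = (\<lambda>s. cnj c * ?F y s)" for c y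
    by (auto simp: row_op_def fun_eq_iff sum_distrib_left mult.assoc)
  ultimately obtain v n where "\<forall>j<N. v j \<in> ?S \<and> (?F ^^ n j) (v j) = 0"
    and span: "?S \<subseteq> fun_space.span ((\<lambda>(j, i). (?F ^^ i) (v j)) ` (SIGMA j:{..<N}. {..<n j}))"
    and indep: "\<forall>c. (\<Sum>(j, i)\<in>(SIGMA j:{..<N}. {..<n j}). (\<lambda>s. c j i * (?F ^^ i) (v j) s)) = 0
          \<longrightarrow> (\<forall>j<N. \<forall>i<n j. c j i = 0)"
    using fun_space.semilinear_nilpotent_chains[of ?F cnj ?S N e "\<lambda>_. Suc m"] S FS eS complex_cnj_zero
    by blast
  then have v: "\<And>j. j < N \<Longrightarrow> v j \<in> ?S" "\<And>j. j < N \<Longrightarrow> (?F ^^ n j) (v j) = 0" by simp_all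
  define D where "D = (SIGMA j:{..<N}. {..<n j})"
  define b where "b = (\<lambda>(j, i). (?F ^^ i) (v j))"
  have finD: "finite D" by (simp add: D_def)
  have bS: "b d \<in> ?S" if "d \<in> D" for d
  proof -
    have "(?F ^^ i) y \<in> ?S" if "y \<in> ?S" for y i using that FS by (induction i) auto
    then show ?thesis using that v by (auto simp: b_def D_def)
  qed
  have "\<exists>c. e s = (\<Sum>d\<in>D. (\<lambda>r. c d * b d r))" if "s < N" for s
    using fun_space.span_image_sum[OF finD, of "e s" b] span eS[OF that] by (auto simp: b_def D_def)
  then obtain R where R: "\<And>s. s < N \<Longrightarrow> e s = (\<Sum>d\<in>D. (\<lambda>r. R s d * b d r))" by metis
  have RK: "(\<Sum>d\<in>D. R s d * b d r) = (if r = s then 1 else 0)" if "s < N" for s r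
    using fun_cong[OF R[OF that], of r] by (simp add: fun_sum_apply e_def)
  \<comment> \<open>\<open>R\<close> expands the unit vectors in the chains, which makes it a
    one-sided inverse. Linear independence of the chains makes it two-sided without counting
    dimensions.\<close>
  have KR: "(\<Sum>s<N. b d s * R s d') = (if d' = d then 1 else 0)" if d: "d \<in> D" "d' \<in> D" for d d'
  proof -
    define c where "c d' = (\<Sum>s<N. b d s * R s d') - (if d' = d then 1 else 0)" for d'
    have "(\<Sum>d'\<in>D. c d' * b d' r) = 0" for r
    proof -
      have "(\<Sum>d'\<in>D. (if d' = d then 1 else 0) * b d' r) = (\<Sum>d'\<in>D. if d' = d then b d' r else 0)"
        by (rule sum.cong) auto
      then have 1: "(\<Sum>d'\<in>D. (if d' = d then 1 else 0) * b d' r) = b d r" using d finD by simp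
      have "(\<Sum>d'\<in>D. (\<Sum>s<N. b d s * R s d') * b d' r) = (\<Sum>s<N. b d s * (\<Sum>d'\<in>D. R s d' * b d' r))"
        unfolding sum_distrib_left sum_distrib_right by (subst sum.swap) (simp add: mult.assoc)
      also have "\<dots> = (\<Sum>s<N. if s = r then b d s else 0)"
        by (rule sum.cong) (auto simp: RK)
      also have "\<dots> = b d r" using bS[OF d(1)] by (simp add: cspace_def)
      finally show ?thesis using 1 by (simp add: c_def left_diff_distrib sum_subtractf)
    qed
    then have "(\<Sum>d'\<in>D. (\<lambda>r. c d' * b d' r)) = 0" by (simp add: fun_eq_iff fun_sum_apply)
    also have "(\<Sum>d'\<in>D. (\<lambda>r. c d' * b d' r)) = (\<Sum>(j, i)\<in>D. (\<lambda>r. c (j, i) * (?F ^^ i) (v j) r))"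
      by (rule sum.cong) (auto simp: b_def)
    finally have "\<forall>j<N. \<forall>i<n j. c (j, i) = 0"
      using indep[THEN spec, of "\<lambda>j i. c (j, i)"] unfolding D_def by blast
    then have "c d' = 0" using d(2) by (auto simp: D_def)
    then show ?thesis by (simp add: c_def)
  qed
  have unique: "\<exists>!c. c \<in> carrier_vec N \<and> (\<forall>d\<in>D. (\<Sum>s<N. vec_index c s * b d s) = w d)" for w
  proof (rule ex1I[of _ "vec N (\<lambda>s. \<Sum>d\<in>D. R s d * w d)"], intro conjI ballI)
    fix d assume d: "d \<in> D"
    have "(\<Sum>s<N. (\<Sum>d'\<in>D. R s d' * w d') * b d s) = (\<Sum>d'\<in>D. (\<Sum>s<N. b d s * R s d') * w d')"
      unfolding sum_distrib_right by (subst sum.swap) (simp add: mult_ac)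
    also have "\<dots> = (\<Sum>d'\<in>D. if d' = d then w d' else 0)" by (rule sum.cong) (auto simp: KR[OF d])
    also have "\<dots> = w d" using d finD by simp
    finally show "(\<Sum>s<N. vec_index (vec N (\<lambda>s. \<Sum>d\<in>D. R s d * w d)) s * b d s) = w d" by simp
  next
    fix c :: "complex vec" assume c: "c \<in> carrier_vec N \<and> (\<forall>d\<in>D. (\<Sum>s<N. vec_index c s * b d s) = w d)"
    show "c = vec N (\<lambda>s. \<Sum>d\<in>D. R s d * w d)"
    proof (rule eq_vecI)
      fix s assume "s < dim_vec (vec N (\<lambda>s. \<Sum>d\<in>D. R s d * w d))"
      then have s: "s < N" by simp
      have "(\<Sum>d\<in>D. R s d * w d) = (\<Sum>d\<in>D. R s d * (\<Sum>r<N. vec_index c r * b d r))"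
        using c by (simp cong: sum.cong)
      also have "\<dots> = (\<Sum>r<N. vec_index c r * (\<Sum>d\<in>D. R s d * b d r))"
        unfolding sum_distrib_left by (subst sum.swap) (simp add: mult_ac)
      also have "\<dots> = (\<Sum>r<N. if r = s then vec_index c r else 0)" by (rule sum.cong) (auto simp: RK[OF s])
      also have "\<dots> = vec_index c s" using s by simp
      finally show "vec_index c s = vec_index (vec N (\<lambda>s. \<Sum>d\<in>D. R s d * w d)) s" using s by simp
    qed (use c in simp)
  qed simp
  have row: "(\<Sum>r<N. y r * A $$ (r, s)) = cnj (?F y s)" if "s < N" for y s
    using that by (simp add: row_op_def)
  \<comment> \<open>Chains of length 0, which the decomposition may produce, are discarded
    here.\<close>
  define B2 where "B2 = {j. j < N \<and> n j \<ge> 2}"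
  define B1 where "B1 = {j. j < N \<and> n j = 1}"
  have fin: "finite B1" "finite B2" by (auto simp: B1_def B2_def)
  define \<mu> where "\<mu> = card B2"
  define \<mu>' where "\<mu>' = card B2 + card B1"
  obtain h2 where h2: "bij_betw h2 {1..\<mu>} B2"
    using fin ex_bij_betw_nat_finite_1[of B2] by (auto simp: \<mu>_def)
  obtain h1 where h1: "bij_betw h1 {1..card B1} B1"
    using fin ex_bij_betw_nat_finite_1[of B1] by auto
  have "bij_betw (\<lambda>j. j - \<mu>) {\<mu><..\<mu>'} {1..card B1}"
    by (rule bij_betw_byWitness[where f' = "\<lambda>j. j + \<mu>"]) (auto simp: \<mu>'_def \<mu>_def)
  from bij_betw_trans[OF this h1] have h1': "bij_betw (\<lambda>j. h1 (j - \<mu>)) {\<mu><..\<mu>'} B1"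
    by (simp add: comp_def)
  define h where "h j = (if j \<le> \<mu> then h2 j else h1 (j - \<mu>))" for j
  have h_2: "bij_betw h {1..\<mu>} B2" using h2 by (rule bij_betw_cong[THEN iffD1, rotated]) (auto simp: h_def)
  have h_1: "bij_betw h {\<mu><..\<mu>'} B1" using h1' by (rule bij_betw_cong[THEN iffD1, rotated]) (auto simp: h_def)
  have disj: "B2 \<inter> B1 = {}" by (auto simp: B1_def B2_def)
  have "{1..\<mu>} \<union> {\<mu><..\<mu>'} = {1..\<mu>'}" by (auto simp: \<mu>_def \<mu>'_def)
  then have h: "bij_betw h {1..\<mu>'} (B2 \<union> B1)"
    using bij_betw_combine[OF h_2 h_1] disj by simp
  have n2: "n (h j) \<ge> 2" if "j \<in> {1..\<mu>}" for j
    using bij_betwE[OF h_2] that by (auto simp: B2_def)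
  have n1: "n (h j) = 1" if "j \<in> {\<mu><..\<mu>'}" for j
    using bij_betwE[OF h_1] that by (auto simp: B1_def)
  have hN: "h j < N" if "j \<in> {1..\<mu>'}" for j
    using bij_betwE[OF h] that by (auto simp: B1_def B2_def)
  \<comment> \<open>Each chain is read backwards: row 1 is its last vector and row
    \<open>n (h j)\<close> its generator, so \<open>?F\<close> lowers the index, matching the ones
    below the diagonal of \<open>T_mat\<close>.\<close>
  define K where "K j i = (?F ^^ (n (h j) - i)) (v (h j))" for j i
  have "chain_matrix N A \<mu>' (\<lambda>j. n (h j)) K"
    unfolding chain_matrix_def
  proof (intro conjI ballI allI impI)
    fix j i s assume j: "j \<in> {1..\<mu>'}" and i: "i \<in> {1..n (h j)}" and s: "s < N"
    have "?F (K j i) = (?F ^^ Suc (n (h j) - i)) (v (h j))" by (simp add: K_def)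
    also have "Suc (n (h j) - i) = n (h j) - (i - 1)" using i by auto
    finally have "?F (K j i) s = (if i = 1 then 0 else K j (i - 1) s)"
      using fun_cong[OF v(2)[OF hN[OF j]], of s] by (simp add: K_def)
    then show "(\<Sum>r<N. K j i r * A $$ (r, s)) = (if i = 1 then 0 else cnj (K j (i - 1) s))"
      unfolding row[OF s] by simp
  next
    fix w :: "nat \<Rightarrow> nat \<Rightarrow> complex"
    define w' where "w' = (\<lambda>(j, i). w (inv_into {1..\<mu>'} h j) (n j - i))"
    have "(\<forall>j\<in>{1..\<mu>'}. \<forall>i\<in>{1..n (h j)}. (\<Sum>s<N. vec_index c s * K j i s) = w j i)
        \<longleftrightarrow> (\<forall>d\<in>D. (\<Sum>s<N. vec_index c s * b d s) = w' d)" for c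
    proof
      assume L: "\<forall>j\<in>{1..\<mu>'}. \<forall>i\<in>{1..n (h j)}. (\<Sum>s<N. vec_index c s * K j i s) = w j i"
      show "\<forall>d\<in>D. (\<Sum>s<N. vec_index c s * b d s) = w' d"
      proof
        fix d assume "d \<in> D"
        then obtain j i where d: "d = (j, i)" and j: "j < N" and i: "i < n j" by (auto simp: D_def)
        have "j \<in> B2 \<union> B1" using i j by (auto simp: B1_def B2_def)
        then have "j \<in> h ` {1..\<mu>'}" using bij_betw_imp_surj_on[OF h] by simp
        then obtain j' where j': "j' \<in> {1..\<mu>'}" "j = h j'" by blast
        have "inv_into {1..\<mu>'} h j = j'" using h j' by (simp add: bij_betw_def inv_into_f_f)
        moreover have "n j - (n j - i) = i" "n j - i \<in> {1..n (h j')}" using i j' by auto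
        ultimately show "(\<Sum>s<N. vec_index c s * b d s) = w' d"
          using L j' by (force simp: d b_def w'_def K_def)
      qed
    next
      assume R: "\<forall>d\<in>D. (\<Sum>s<N. vec_index c s * b d s) = w' d"
      show "\<forall>j\<in>{1..\<mu>'}. \<forall>i\<in>{1..n (h j)}. (\<Sum>s<N. vec_index c s * K j i s) = w j i"
      proof (intro ballI)
        fix j i assume j: "j \<in> {1..\<mu>'}" and i: "i \<in> {1..n (h j)}"
        have "(h j, n (h j) - i) \<in> D" using hN[OF j] i by (auto simp: D_def)
        moreover have "inv_into {1..\<mu>'} h (h j) = j" using h j by (simp add: bij_betw_def inv_into_f_f)
        ultimately show "(\<Sum>s<N. vec_index c s * K j i s) = w j i"
          using R i by (force simp: b_def w'_def K_def)
      qed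
    qed
    then show "\<exists>!c. c \<in> carrier_vec N \<and>
        (\<forall>j\<in>{1..\<mu>'}. \<forall>i\<in>{1..n (h j)}. (\<Sum>s<N. vec_index c s * K j i s) = w j i)"
      using unique[of w'] by simp
  qed
  moreover have "1 \<le> \<mu>"
  proof (rule ccontr)
    assume "\<not> 1 \<le> \<mu>"
    then have "card B2 = 0" by (simp add: \<mu>_def)
    then have B2: "B2 = {}" using fin by simp
    \<comment> \<open>If all chains have length at most 1, \<open>?F\<close> annihilates every row,
      so each column of \<open>A\<close> solves the homogeneous system of the invertible matrix of
      rows.\<close>
    have "A $$ (r, s) = 0" if r: "r < N" and s: "s < N" for r s
    proof -
      have "(\<Sum>r<N. vec_index (vec N (\<lambda>r. A $$ (r, s))) r * b d r) = 0" if d: "d \<in> D" for d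
      proof -
        obtain j i where ji: "d = (j, i)" "j < N" "i < n j" using d by (auto simp: D_def)
        then have "n j = 1" using B2 by (force simp: B2_def)
        then have "?F (b d) = 0" using v(2)[OF ji(2)] ji by (simp add: b_def)
        then show ?thesis using row[OF s, of "b d"] by (simp add: mult.commute)
      qed
      moreover have "(\<Sum>r<N. vec_index (0\<^sub>v N) r * b d r) = 0" for d by simp
      moreover obtain c0 where "\<forall>c. c \<in> carrier_vec N \<and> (\<forall>d\<in>D. (\<Sum>r<N. vec_index c r * b d r) = 0) \<longrightarrow> c = c0"
        using unique[of "\<lambda>_. 0"] by (elim ex1E) (rule that)
      ultimately have "vec N (\<lambda>r. A $$ (r, s)) = c0" "0\<^sub>v N = c0" by auto
      then have "vec_index (vec N (\<lambda>r. A $$ (r, s))) r = vec_index (0\<^sub>v N) r" by simp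
      then show ?thesis using r by simp
    qed
    then have "A = 0\<^sub>m N N" using A by (intro eq_matI) auto
    then show False using A0 by simp
  qed
  moreover have "\<mu> \<le> \<mu>'" by (simp add: \<mu>_def \<mu>'_def)
  ultimately show thesis
    using n2 n1 by (intro that[of \<mu> \<mu>' "\<lambda>j. n (h j)" K])
qed


section \<open>The block family\<close>

text \<open>The coordinates \<open>y = (1 - t T)\<^sup>-\<^sup>1 a\<close>, in which the Levi kernel field of a block is constant:
  \<open>y\<^sub>r = a\<^sub>r + t y\<^sub>r\<^sub>-\<^sub>1\<close>, with indices starting from 1.\<close>

fun resolvent :: "'a::comm_ring_1 \<Rightarrow> (nat \<Rightarrow> 'a) \<Rightarrow> nat \<Rightarrow> 'a" where
  "resolvent t a 0 = 0"
| "resolvent t a (Suc r) = a (Suc r) + t * resolvent t a r"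

lemma resolvent_eq_sum: "resolvent t a r = (\<Sum>k=1..r. t ^ (r - k) * a k)"
proof (induction r)
  case (Suc r)
  have "(\<Sum>k=1..r. t ^ (Suc r - k) * a k) = t * (\<Sum>k=1..r. t ^ (r - k) * a k)"
    unfolding sum_distrib_left by (rule sum.cong) (auto simp: Suc_diff_le mult.assoc)
  then show ?case using Suc by simp
qed simp

lemma resolvent_cong: "(\<And>i. 1 \<le> i \<Longrightarrow> i \<le> r \<Longrightarrow> a i = b i) \<Longrightarrow> resolvent t a r = resolvent t b r"
  unfolding resolvent_eq_sum by (rule sum.cong) auto

lemma resolvent_zero: "(\<And>i. 1 \<le> i \<Longrightarrow> i \<le> r \<Longrightarrow> a i = 0) \<Longrightarrow> resolvent t a r = 0"
  unfolding resolvent_eq_sum by (rule sum.neutral) auto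

lemma resolvent_sum: "resolvent t (\<lambda>i. \<Sum>c\<in>C. a c i * d c) r = (\<Sum>c\<in>C. resolvent t (a c) r * d c)"
  by (induction r) (simp_all add: sum.distrib sum_distrib_left algebra_simps)

lemma of_real_resolvent:
  "of_real (resolvent t a r) = resolvent (of_real t :: complex) (\<lambda>i. of_real (a i)) r"
  by (induction r) simp_all

lemma sum_atLeast1_rev: "(\<Sum>i=1..m. f i (m + 1 - i)) = (\<Sum>i=1..m. f (m + 1 - i) i)"
  for f :: "nat \<Rightarrow> nat \<Rightarrow> 'a::comm_monoid_add"
  by (rule sum.reindex_bij_witness[of _ "\<lambda>i. m + 1 - i" "\<lambda>i. m + 1 - i"]) auto

text \<open>The matrix of \<open>(1 - t T)\<^sup>-\<^sup>1\<close> is a Toeplitz matrix, so that reversing its rows makes it symmetric.\<close>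

lemma resolvent_symmetric:
  "(\<Sum>i=1..m. a i * resolvent t b (m + 1 - i)) = (\<Sum>i=1..m. b i * resolvent t a (m + 1 - i))"
proof (induction m)
  case (Suc m)
  have step: "(\<Sum>i=1..Suc m. a i * resolvent t b (Suc m + 1 - i))
      = (\<Sum>i=1..Suc m. a i * b (Suc m + 1 - i)) + t * (\<Sum>i=1..m. a i * resolvent t b (m + 1 - i))" for a b
  proof -
    have "(\<Sum>i=1..Suc m. a i * resolvent t b (Suc m + 1 - i))
        = (\<Sum>i=1..Suc m. a i * b (Suc m + 1 - i) + t * (a i * resolvent t b (Suc m - i)))"
      by (rule sum.cong) (auto simp: Suc_diff_le algebra_simps)
    also have "\<dots> = (\<Sum>i=1..Suc m. a i * b (Suc m + 1 - i)) + t * (\<Sum>i=1..Suc m. a i * resolvent t b (Suc m - i))"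
      by (simp only: sum.distrib sum_distrib_left)
    finally show ?thesis by simp
  qed
  show ?case
    unfolding step Suc using sum_atLeast1_rev[of "\<lambda>i k. a i * b k" "Suc m"] by (simp only: mult.commute)
qed simp

text \<open>Both sides are the convolution of \<open>A\<close> and \<open>B\<close> at
  \<open>m\<close>; the boundary terms vanish because of the values at 0. It merges the mixed terms
  in the derivative of the \<open>\<xi>\<close>-component of the gradient.\<close>

lemma sum_shift_rev:
  fixes A B :: "nat \<Rightarrow> 'a::comm_ring_1"
  assumes "A 0 = 0" "B 0 = 0"
  shows "(\<Sum>i=1..m. A (i - 1) * B (m + 1 - i)) = (\<Sum>i=1..m. B (i - 1) * A (m + 1 - i))"
proof -
  have "(\<Sum>i=1..m. A (i - 1) * B (m + 1 - i)) = (\<Sum>r\<le>m. A r * B (m - r))" if "B 0 = 0" for A B :: "nat \<Rightarrow> 'a"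
  proof -
    have "(\<Sum>i=1..m. A (i - 1) * B (m + 1 - i)) = (\<Sum>r<m. A r * B (m - r))"
      by (rule sum.reindex_bij_witness[of _ Suc "\<lambda>i. i - 1"]) auto
    also have "\<dots> = (\<Sum>r\<le>m. A r * B (m - r))"
      using that by (simp add: lessThan_Suc_atMost[symmetric])
    finally show ?thesis .
  qed
  moreover have "(\<Sum>r\<le>m. A r * B (m - r)) = (\<Sum>r\<le>m. B r * A (m - r))"
    by (rule sum.reindex_bij_witness[of _ "\<lambda>i. m - i" "\<lambda>i. m - i"]) (auto simp: mult.commute)
  ultimately show ?thesis using assms by metis
qed

text \<open>For fixed \<open>j\<close> the sum over \<open>k\<close> is the coordinate
  \<open>y\<^sub>m\<^sub>+\<^sub>1\<^sub>-\<^sub>j\<close>. This is where the polynomial of the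
  family meets the resolvent.\<close>

lemma resolvent_quadratic:
  "(\<Sum>(j, k) \<in> {(j, k). j \<ge> 1 \<and> k \<ge> 1 \<and> j + k \<le> m + 1}. x j * x k * t ^ (m + 1 - j - k))
    = (\<Sum>i=1..m. x i * resolvent t x (m + 1 - i))"
proof -
  have "{(j, k). j \<ge> 1 \<and> k \<ge> 1 \<and> j + k \<le> m + 1} = (SIGMA j:{1..m}. {1..m + 1 - j})" by auto
  then have "(\<Sum>(j, k) \<in> {(j, k). j \<ge> 1 \<and> k \<ge> 1 \<and> j + k \<le> m + 1}. x j * x k * t ^ (m + 1 - j - k))
     = (\<Sum>j=1..m. \<Sum>k=1..m + 1 - j. x j * x k * t ^ (m + 1 - j - k))"
    by (simp add: sum.Sigma)
  also have "\<dots> = (\<Sum>i=1..m. x i * resolvent t x (m + 1 - i))"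
    unfolding resolvent_eq_sum sum_distrib_left
    by (intro sum.cong refl) (simp add: mult_ac)
  finally show ?thesis .
qed

text \<open>For \<open>m \<ge> 2\<close> the equation with \<open>i = m\<close> reads
  \<open>2 * d 1 = 0\<close>, so the term with \<open>h\<close> disappears and all resolvent
  coordinates vanish. For \<open>m = 1\<close> the only equation is
  \<open>(h + 2) * d 1 = 0\<close>, whence the excluded value \<open>- 2\<close>.\<close>

lemma resolvent_nondegenerate:
  fixes d :: "nat \<Rightarrow> complex"
  assumes eq: "\<And>i. i \<in> {1..m} \<Longrightarrow> (if i = 1 then h * d 1 else 0) + 2 * resolvent t d (m + 1 - i) = 0"
    and m1: "m = 1 \<Longrightarrow> h \<noteq> - 2" and i: "i \<in> {1..m}"
  shows "d i = 0"
proof (cases "m = 1")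
  case True
  then have "(h + 2) * d 1 = 0" using eq[of 1] by (simp add: algebra_simps)
  moreover have "h + 2 \<noteq> 0" using m1[OF True] by (simp add: add_eq_0_iff2)
  ultimately show ?thesis using i True by simp
next
  case False
  then have m: "m \<ge> 2" using i by auto
  have d1: "d 1 = 0" using eq[of m] m by (simp add: numeral_2_eq_2)
  have S: "resolvent t d r = 0" if "r \<le> m" for r
  proof (cases "r = 0")
    case False
    then have "m + 1 - r \<in> {1..m}" "m + 1 - (m + 1 - r) = r" using that by auto
    then show ?thesis using eq[of "m + 1 - r"] d1 by (auto split: if_splits)
  qed simp
  obtain r where r: "i = Suc r" "r < m" using i by (cases i) auto
  show ?thesis using S[of i] S[of r] r by simp
qed

text \<open>The matrix \<open>T (1 - t T)\<^sup>-\<^sup>1\<close> sends \<open>chain t i\<close> to \<open>chain t (i + 1)\<close>.\<close>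

fun chain :: "'a::comm_ring_1 \<Rightarrow> nat \<Rightarrow> nat \<Rightarrow> 'a" where
  "chain t 0 = (\<lambda>r. if r = 1 then 1 else 0)"
| "chain t (Suc i) = (\<lambda>r. resolvent t (chain t i) (r - 1))"

text \<open>\<open>T (1 - t T)\<^sup>-\<^sup>1\<close> is strictly lower triangular with ones just
  below the diagonal, so each application moves the leading 1 down by one place. The first
  \<open>m\<close> chain vectors thus form a unitriangular matrix on a block of size
  \<open>m\<close>.\<close>

lemma chain_triangular: "r \<le> i \<Longrightarrow> chain t i r = 0" "chain t i (Suc i) = 1"
proof (induction i arbitrary: r)
  case (Suc i)
  { case 1
    then show ?case using Suc.IH(1) by (auto intro!: resolvent_zero)
  next
    case 2
    have "resolvent t (chain t i) i = 0" using Suc.IH(1) by (auto intro!: resolvent_zero)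
    then show ?case using Suc.IH(2) by simp }
qed auto

lemma unitriangular_exists:
  fixes M :: "nat \<Rightarrow> nat \<Rightarrow> 'a::comm_ring_1"
  assumes "\<And>i r. r < i \<Longrightarrow> M i r = 0" "\<And>i. M i i = 1"
  shows "\<exists>c. \<forall>r\<in>{1..m}. (\<Sum>i=1..m. c i * M i r) = w r"
proof (induction m)
  case (Suc m)
  then obtain c where c: "\<forall>r\<in>{1..m}. (\<Sum>i=1..m. c i * M i r) = w r" by blast
  define c' where "c' = c(Suc m := w (Suc m) - (\<Sum>i=1..m. c i * M i (Suc m)))"
  have "(\<Sum>i=1..Suc m. c' i * M i r) = (\<Sum>i=1..m. c i * M i r) + c' (Suc m) * M (Suc m) r" for r
  proof -
    have "(\<Sum>i=1..m. c' i * M i r) = (\<Sum>i=1..m. c i * M i r)"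
      by (rule sum.cong) (auto simp: c'_def)
    then show ?thesis by simp
  qed
  then have "(\<Sum>i=1..Suc m. c' i * M i r) = w r" if "r \<in> {1..Suc m}" for r
    using c that assms by (cases "r = Suc m") (auto simp: c'_def)
  then show ?case by blast
qed simp

lemma unitriangular_inject:
  fixes M :: "nat \<Rightarrow> nat \<Rightarrow> 'a::comm_ring_1"
  assumes "\<And>i r. r < i \<Longrightarrow> M i r = 0" "\<And>i. M i i = 1"
    and eq: "\<And>r. r \<in> {1..m} \<Longrightarrow> (\<Sum>i=1..m. c i * M i r) = (\<Sum>i=1..m. d i * M i r)"
    and r: "r \<in> {1..m}"
  shows "c r = d r"
  using r
proof (induction r rule: less_induct)
  case (less r)
  have "(\<Sum>i=1..m. (c i - d i) * M i r) = 0"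
    using eq[OF less.prems] by (simp add: left_diff_distrib sum_subtractf)
  moreover have "(\<Sum>i\<in>{1..m} - {r}. (c i - d i) * M i r) = 0"
  proof (rule sum.neutral, rule ballI)
    fix i assume "i \<in> {1..m} - {r}"
    then show "(c i - d i) * M i r = 0" using less.IH[of i] assms(1)[of r i] by (cases "i < r") auto
  qed
  ultimately show ?case
    using sum.remove[of "{1..m}" r "\<lambda>i. (c i - d i) * M i r"] less.prems assms(2) by simp
qed

text \<open>Linking and extending produce numerical labels. The maps \<open>lab\<close> and \<open>il\<close> translate between these
  and the labels of the explicit family.\<close>

locale block_family =
  fixes \<mu> :: nat and n :: "nat \<Rightarrow> nat" and f :: "nat \<Rightarrow> real \<Rightarrow> real"
    and lab :: "coord \<Rightarrow> 'i" and il :: "'i \<Rightarrow> coord"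
  assumes f_diff: "j \<in> {1..\<mu>} \<Longrightarrow> twice_differentiable (f j)"
    and n_pos: "j \<in> {1..\<mu>} \<Longrightarrow> n j \<ge> 1"
    and f2: "j \<in> {1..\<mu>} \<Longrightarrow> n j = 1 \<Longrightarrow> deriv (deriv (f j)) x \<noteq> - 2"
    and il_lab: "c \<in> coords \<mu> n \<Longrightarrow> il (lab c) = c"
begin

abbreviation "J \<equiv> lab ` coords \<mu> n"
abbreviation "o' \<equiv> lab Z0"
abbreviation "\<xi> \<equiv> lab Xi"

section \<open>Gradient, Hessian and kernel field of the family\<close>

definition X :: "nat \<Rightarrow> nat \<Rightarrow> ('i \<Rightarrow> complex) \<Rightarrow> real" where
  "X j i z = Re (z (lab (Z j i)))"

definition \<Phi> :: "('i \<Rightarrow> complex) \<Rightarrow> real" where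
  "\<Phi> z = (\<Sum>j=1..\<mu>. P (f j) (n j) (\<lambda>i. X j i z) (Re (z \<xi>)))"

definition Y :: "nat \<Rightarrow> nat \<Rightarrow> ('i \<Rightarrow> complex) \<Rightarrow> real" where
  "Y j r z = resolvent (Re (z \<xi>)) (\<lambda>i. X j i z) r"

text \<open>The differential of \<open>y\<close> is \<open>(1 - t T)\<^sup>-\<^sup>1 \<delta>\<close> with \<open>\<delta>\<^sub>i = dx\<^sub>i + y\<^sub>i\<^sub>-\<^sub>1 dt\<close>; the argument \<open>c\<close> selects the
  coefficient of a coordinate differential.\<close>

definition \<delta> :: "nat \<Rightarrow> coord \<Rightarrow> ('i \<Rightarrow> complex) \<Rightarrow> nat \<Rightarrow> real" where
  "\<delta> j c z i = of_bool (c = Z j i) + of_bool (c = Xi) * Y j (i - 1) z"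

definition dY :: "nat \<Rightarrow> nat \<Rightarrow> coord \<Rightarrow> ('i \<Rightarrow> complex) \<Rightarrow> real" where
  "dY j r c z = resolvent (Re (z \<xi>)) (\<delta> j c z) r"

text \<open>The differential of the sum of
  \<open>x\<^sub>i y\<^sub>n\<^sub>+\<^sub>1\<^sub>-\<^sub>i\<close> contains
  \<open>x\<^sub>i dy\<^sub>n\<^sub>+\<^sub>1\<^sub>-\<^sub>i\<close>. By
  \<open>resolvent_symmetric\<close> the sum of these terms equals that of the
  \<open>\<delta>\<^sub>i y\<^sub>n\<^sub>+\<^sub>1\<^sub>-\<^sub>i\<close>, which leaves an
  expression in \<open>y\<close> and the derivative of \<open>f j\<close> at
  \<open>x\<^sub>1\<close>.\<close>

definition G :: "coord \<Rightarrow> ('i \<Rightarrow> complex) \<Rightarrow> real" where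
  "G c z = (\<Sum>j=1..\<mu>. deriv (f j) (X j 1 z) * of_bool (c = Z j 1)
     + (\<Sum>i=1..n j. (of_bool (c = Z j i) + \<delta> j c z i) * Y j (n j + 1 - i) z))"

definition H :: "coord \<Rightarrow> coord \<Rightarrow> ('i \<Rightarrow> complex) \<Rightarrow> real" where
  "H c c' z = (\<Sum>j=1..\<mu>. deriv (deriv (f j)) (X j 1 z) * of_bool (c = Z j 1) * of_bool (c' = Z j 1)
     + 2 * (\<Sum>i=1..n j. \<delta> j c z i * dY j (n j + 1 - i) c' z))"

fun u :: "coord \<Rightarrow> ('i \<Rightarrow> complex) \<Rightarrow> real" where
  "u Z0 z = 0"
| "u Xi z = 1"
| "u (Z j i) z = - Y j (i - 1) z"

fun U :: "coord \<Rightarrow> coord \<Rightarrow> ('i \<Rightarrow> complex) \<Rightarrow> real" where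
  "U (Z j i) c z = - dY j (i - 1) c z"
| "U Z0 c z = 0"
| "U Xi c z = 0"

section \<open>Labels and sums over blocks\<close>

lemma coords_eq: "coords \<mu> n = insert Z0 (insert Xi ((\<lambda>(j, i). Z j i) ` (SIGMA j:{1..\<mu>}. {1..n j})))"
  by (auto simp: coords_def image_iff)

lemma fin: "finite (coords \<mu> n)" by (simp add: coords_eq)

lemma coords_intros: "Z0 \<in> coords \<mu> n" "Xi \<in> coords \<mu> n"
  "j \<in> {1..\<mu>} \<Longrightarrow> i \<in> {1..n j} \<Longrightarrow> Z j i \<in> coords \<mu> n"
  by (auto simp: coords_def)

lemma lab_inj: "c \<in> coords \<mu> n \<Longrightarrow> c' \<in> coords \<mu> n \<Longrightarrow> lab c = lab c' \<longleftrightarrow> c = c'"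
  using il_lab by metis

lemma finJ: "finite J" using fin by simp

lemma block_label:
  assumes "j \<in> {1..\<mu>}" "i \<in> {1..n j}"
  shows "il (lab (Z j i)) = Z j i" "lab (Z j i) \<noteq> o'" "lab (Z j i) \<noteq> \<xi>"
  using coords_intros(3)[OF assms] by (simp_all add: il_lab lab_inj coords_intros)

lemma I_eq: "J - {o', \<xi>} = (\<lambda>(j, i). lab (Z j i)) ` (SIGMA j:{1..\<mu>}. {1..n j})"
  by (auto simp: coords_eq block_label)

lemma sum_I: "(\<Sum>l\<in>J - {o', \<xi>}. h (il l)) = (\<Sum>j=1..\<mu>. \<Sum>i=1..n j. h (Z j i))"
  for h :: "coord \<Rightarrow> 'a::comm_monoid_add"
proof -
  have inj: "inj_on (\<lambda>(j, i). lab (Z j i)) (SIGMA j:{1..\<mu>}. {1..n j})"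
    by (auto simp: inj_on_def lab_inj coords_intros)
  have "(\<Sum>l\<in>J - {o', \<xi>}. h (il l)) = (\<Sum>(j, i)\<in>(SIGMA j:{1..\<mu>}. {1..n j}). h (Z j i))"
    unfolding I_eq sum.reindex[OF inj] by (rule sum.cong) (auto simp: block_label)
  then show ?thesis by (simp add: sum.Sigma)
qed

lemma sum_N: "(\<Sum>l\<in>J - {o'}. h (il l)) = h Xi + (\<Sum>j=1..\<mu>. \<Sum>i=1..n j. h (Z j i))"
  for h :: "coord \<Rightarrow> 'a::comm_monoid_add"
proof -
  have "\<xi> \<in> J - {o'}" by (auto simp: coords_intros lab_inj)
  moreover have "J - {o'} - {\<xi>} = J - {o', \<xi>}" by auto
  ultimately show ?thesis
    using sum.remove[of "J - {o'}" \<xi> "\<lambda>l. h (il l)"] finJ sum_I[of h]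
    by (simp add: il_lab coords_intros)
qed

definition deriv_coeffs :: "(('i \<Rightarrow> complex) \<Rightarrow> real) \<Rightarrow> (coord \<Rightarrow> real) \<Rightarrow> ('i \<Rightarrow> complex) \<Rightarrow> bool" where
  "deriv_coeffs g d q \<longleftrightarrow> has_wirtinger J (\<lambda>p. of_real (g p)) (\<lambda>l. of_real (d (il l)) / 2) (\<lambda>l. of_real (d (il l)) / 2) q"

section \<open>Derivatives of the block functions\<close>

context
  fixes q assumes q: "q \<in> cspace J"
begin

lemma dc_const: "deriv_coeffs (\<lambda>z. a) (\<lambda>c. 0) q"
  using has_wirtinger_const by (simp add: deriv_coeffs_def)

lemma dc_comp:
  assumes c: "c \<in> coords \<mu> n" and g: "(g has_real_derivative D) (at (Re (q (lab c))))"
  shows "deriv_coeffs (\<lambda>z. g (Re (z (lab c)))) (\<lambda>c'. D * of_bool (c' = c)) q"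
  unfolding deriv_coeffs_def
  by (rule has_wirtinger_eq[OF has_wirtinger_of_real_Re[OF finJ q _ g]]) (use c in \<open>auto simp: il_lab lab_inj\<close>)

lemma dc_coord: "c \<in> coords \<mu> n \<Longrightarrow> deriv_coeffs (\<lambda>z. Re (z (lab c))) (\<lambda>c'. of_bool (c' = c)) q"
  using dc_comp[OF _ DERIV_ident] by simp

lemma dc_add: "deriv_coeffs g d q \<Longrightarrow> deriv_coeffs g' d' q \<Longrightarrow> deriv_coeffs (\<lambda>z. g z + g' z) (\<lambda>c. d c + d' c) q"
  unfolding deriv_coeffs_def by (rule has_wirtinger_eq[OF has_wirtinger_add]) (auto simp: add_divide_distrib)

lemma dc_mult: "deriv_coeffs g d q \<Longrightarrow> deriv_coeffs g' d' q
    \<Longrightarrow> deriv_coeffs (\<lambda>z. g z * g' z) (\<lambda>c. d c * g' q + g q * d' c) q"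
  unfolding deriv_coeffs_def
  by (rule has_wirtinger_eq[OF has_wirtinger_mult[OF finJ q]]) (auto simp: add_divide_distrib)

lemma dc_sum: "(\<And>k. k \<in> A \<Longrightarrow> deriv_coeffs (g k) (d k) q)
    \<Longrightarrow> deriv_coeffs (\<lambda>z. \<Sum>k\<in>A. g k z) (\<lambda>c. \<Sum>k\<in>A. d k c) q"
  by (induction A rule: infinite_finite_induct) (simp_all add: dc_const dc_add)

lemma dc_eq: "deriv_coeffs g d q \<Longrightarrow> (\<And>z. g z = g' z) \<Longrightarrow> (\<And>c. d c = d' c) \<Longrightarrow> deriv_coeffs g' d' q"
  by (simp add: deriv_coeffs_def)

lemma dc_X: "j \<in> {1..\<mu>} \<Longrightarrow> i \<in> {1..n j} \<Longrightarrow> deriv_coeffs (X j i) (\<lambda>c. of_bool (c = Z j i)) q"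
  unfolding X_def[abs_def] by (intro dc_coord coords_intros)

lemma dc_Y: "j \<in> {1..\<mu>} \<Longrightarrow> r \<le> n j \<Longrightarrow> deriv_coeffs (Y j r) (\<lambda>c. dY j r c q) q"
proof (induction r)
  case 0
  then show ?case using dc_const[of 0] by (simp add: Y_def[abs_def] dY_def)
next
  case (Suc r)
  have "deriv_coeffs (\<lambda>z. X j (Suc r) z + Re (z \<xi>) * Y j r z)
      (\<lambda>c. of_bool (c = Z j (Suc r)) + (of_bool (c = Xi) * Y j r q + Re (q \<xi>) * dY j r c q)) q"
    using Suc by (intro dc_add dc_mult dc_X dc_coord coords_intros) auto
  then show ?case by (rule dc_eq) (simp_all add: Y_def dY_def \<delta>_def)
qed

lemma dc_deriv_f:
  assumes j: "j \<in> {1..\<mu>}"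
  shows "deriv_coeffs (\<lambda>z. f j (X j 1 z)) (\<lambda>c. deriv (f j) (X j 1 q) * of_bool (c = Z j 1)) q"
    and "deriv_coeffs (\<lambda>z. deriv (f j) (X j 1 z)) (\<lambda>c. deriv (deriv (f j)) (X j 1 q) * of_bool (c = Z j 1)) q"
proof -
  have *: "(g has_real_derivative deriv g x) (at x)" if "g differentiable_on UNIV" for g :: "real \<Rightarrow> real" and x
    using that by (simp add: differentiable_on_def DERIV_deriv_iff_real_differentiable)
  have c: "Z j 1 \<in> coords \<mu> n" using j n_pos[OF j] by (intro coords_intros) auto
  show "deriv_coeffs (\<lambda>z. f j (X j 1 z)) (\<lambda>c. deriv (f j) (X j 1 q) * of_bool (c = Z j 1)) q"
    and "deriv_coeffs (\<lambda>z. deriv (f j) (X j 1 z)) (\<lambda>c. deriv (deriv (f j)) (X j 1 q) * of_bool (c = Z j 1)) q"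
    using f_diff[OF j] unfolding X_def by (intro dc_comp c *; simp add: twice_differentiable_def)+
qed

lemma P_eq: "P (f j) (n j) (\<lambda>i. X j i z) (Re (z \<xi>)) = f j (X j 1 z) + (\<Sum>i=1..n j. X j i z * Y j (n j + 1 - i) z)"
  unfolding P_def resolvent_quadratic Y_def ..

lemma dc_Phi: "deriv_coeffs \<Phi> (\<lambda>c. G c q) q"
proof -
  have "deriv_coeffs (\<lambda>z. \<Sum>j=1..\<mu>. f j (X j 1 z) + (\<Sum>i=1..n j. X j i z * Y j (n j + 1 - i) z))
    (\<lambda>c. \<Sum>j=1..\<mu>. deriv (f j) (X j 1 q) * of_bool (c = Z j 1)
       + (\<Sum>i=1..n j. of_bool (c = Z j i) * Y j (n j + 1 - i) q + X j i q * dY j (n j + 1 - i) c q)) q"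
    by (intro dc_sum dc_add dc_mult dc_X dc_Y dc_deriv_f) auto
  moreover have "(\<Sum>i=1..n j. of_bool (c = Z j i) * Y j (n j + 1 - i) q + X j i q * dY j (n j + 1 - i) c q)
     = (\<Sum>i=1..n j. (of_bool (c = Z j i) + \<delta> j c q i) * Y j (n j + 1 - i) q)" for j c
    unfolding distrib_right sum.distrib
    using resolvent_symmetric[of "\<lambda>i. X j i q" "Re (q \<xi>)" "\<delta> j c q" "n j"]
    unfolding Y_def[symmetric] dY_def[symmetric] by simp
  ultimately show ?thesis
    by (elim dc_eq) (simp_all only: \<Phi>_def P_eq G_def)
qed

text \<open>Differentiating \<open>\<delta>\<close> contributes only for \<open>c = Xi\<close>.
  After reversal of the summation this contribution supplies the \<open>Xi\<close> part missing from
  \<open>of_bool (c = Z j i)\<close>, and the total is \<open>2 * \<delta>\<close>.\<close>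

lemma dc_G: "deriv_coeffs (G c) (\<lambda>c'. H c c' q) q"
proof -
  have "deriv_coeffs (G c) (\<lambda>c'. \<Sum>j=1..\<mu>.
      (deriv (deriv (f j)) (X j 1 q) * of_bool (c' = Z j 1) * of_bool (c = Z j 1) + deriv (f j) (X j 1 q) * 0)
       + (\<Sum>i=1..n j. (0 + (0 + (0 * Y j (i - 1) q + of_bool (c = Xi) * dY j (i - 1) c' q))) * Y j (n j + 1 - i) q
          + (of_bool (c = Z j i) + \<delta> j c q i) * dY j (n j + 1 - i) c' q)) q"
    unfolding G_def[abs_def] \<delta>_def
    by (intro dc_sum dc_add dc_mult dc_X dc_Y dc_deriv_f dc_const) auto
  moreover have "(\<Sum>i=1..n j. (0 + (0 + (0 * Y j (i - 1) q + of_bool (c = Xi) * dY j (i - 1) c' q))) * Y j (n j + 1 - i) q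
          + (of_bool (c = Z j i) + \<delta> j c q i) * dY j (n j + 1 - i) c' q)
      = 2 * (\<Sum>i=1..n j. \<delta> j c q i * dY j (n j + 1 - i) c' q)" for j c'
  proof -
    have rev: "(\<Sum>i=1..n j. dY j (i - 1) c' q * Y j (n j + 1 - i) q) = (\<Sum>i=1..n j. Y j (i - 1) q * dY j (n j + 1 - i) c' q)"
      by (rule sum_shift_rev) (simp_all add: dY_def Y_def)
    have "(\<Sum>i=1..n j. (0 + (0 + (0 * Y j (i - 1) q + of_bool (c = Xi) * dY j (i - 1) c' q))) * Y j (n j + 1 - i) q
          + (of_bool (c = Z j i) + \<delta> j c q i) * dY j (n j + 1 - i) c' q)
       = of_bool (c = Xi) * (\<Sum>i=1..n j. dY j (i - 1) c' q * Y j (n j + 1 - i) q)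
         + (\<Sum>i=1..n j. (of_bool (c = Z j i) + \<delta> j c q i) * dY j (n j + 1 - i) c' q)"
      by (simp add: sum.distrib sum_distrib_left mult.assoc)
    also have "\<dots> = 2 * (\<Sum>i=1..n j. \<delta> j c q i * dY j (n j + 1 - i) c' q)"
      unfolding rev sum_distrib_left sum.distrib[symmetric]
      by (rule sum.cong) (simp_all add: \<delta>_def algebra_simps)
    finally show ?thesis .
  qed
  ultimately show ?thesis by (elim dc_eq) (simp_all add: H_def mult.assoc mult.commute[of "of_bool _" "of_bool _"])
qed

lemma dc_u: "c \<in> coords \<mu> n \<Longrightarrow> deriv_coeffs (u c) (\<lambda>c'. U c c' q) q"
proof (cases c)
  case (Z j i)
  assume "c \<in> coords \<mu> n"
  then have "deriv_coeffs (\<lambda>z. (- 1) * Y j (i - 1) z) (\<lambda>c'. 0 * Y j (i - 1) q + (- 1) * dY j (i - 1) c' q) q"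
    using Z by (intro dc_mult[of "\<lambda>_. - 1"] dc_const dc_Y) (auto simp: coords_def)
  then show ?thesis by (rule dc_eq) (simp_all add: Z)
qed (auto intro: dc_const dc_eq)

end

text \<open>Equality of mixed derivatives is read off the formula by
  \<open>resolvent_symmetric\<close>, since second derivatives of \<open>f j\<close> need not be
  continuous.\<close>

lemma H_sym: "H c c' z = H c' c z"
proof -
  have "(\<Sum>i=1..n j. \<delta> j c z i * dY j (n j + 1 - i) c' z) = (\<Sum>i=1..n j. \<delta> j c' z i * dY j (n j + 1 - i) c z)" for j
    unfolding dY_def by (rule resolvent_symmetric)
  then show ?thesis unfolding H_def by (simp only: mult_ac)
qed

text \<open>Evaluating \<open>dx\<^sub>i + y\<^sub>i\<^sub>-\<^sub>1 dt\<close> on \<open>u\<close>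
  gives \<open>- y\<^sub>i\<^sub>-\<^sub>1 + y\<^sub>i\<^sub>-\<^sub>1\<close>: the coordinates
  \<open>y\<close> are constant along the field.\<close>

lemma delta_u: 
  assumes "j \<in> {1..\<mu>}" "i \<in> {1..n j}"
  shows "(\<Sum>l\<in>J - {o'}. \<delta> j (il l) z i * u (il l) z) = 0"
proof -
  have "(\<Sum>j'=1..\<mu>. \<Sum>i'=1..n j'. \<delta> j (Z j' i') z i * u (Z j' i') z)
      = (\<Sum>j'=1..\<mu>. if j' = j then (\<Sum>i'=1..n j'. if i' = i then u (Z j' i') z else 0) else 0)"
  proof (intro sum.cong refl)
    fix j'
    show "(\<Sum>i'=1..n j'. \<delta> j (Z j' i') z i * u (Z j' i') z)
        = (if j' = j then (\<Sum>i'=1..n j'. if i' = i then u (Z j' i') z else 0) else 0)"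
      by (cases "j' = j") (use assms in \<open>simp_all add: \<delta>_def del: u.simps\<close>)
  qed
  also have "\<dots> = u (Z j i) z" using assms by (simp del: u.simps)
  finally show ?thesis unfolding sum_N[of "\<lambda>c. \<delta> j c z i * u c z"] by (simp add: \<delta>_def)
qed

text \<open>The resolvent part vanishes by \<open>delta_u\<close>, and the part with the second
  derivative of \<open>f j\<close> because the component of \<open>u\<close> at \<open>Z j 1\<close>
  is \<open>- Y j 0 = 0\<close>.\<close>

lemma H_ker: "(\<Sum>l\<in>J - {o'}. H c (il l) z * u (il l) z) = 0"
proof -
  have "(\<Sum>l\<in>J - {o'}. H c (il l) z * u (il l) z) = (\<Sum>l\<in>J - {o'}. \<Sum>j=1..\<mu>.
      deriv (deriv (f j)) (X j 1 z) * of_bool (c = Z j 1) * (of_bool (il l = Z j 1) * u (il l) z)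
      + 2 * (\<Sum>i=1..n j. dY j (n j + 1 - i) c z * (\<delta> j (il l) z i * u (il l) z)))"
    unfolding H_sym[of c] unfolding H_def sum_distrib_right
    by (intro sum.cong refl) (simp add: algebra_simps sum_distrib_left)
  also have "\<dots> = (\<Sum>j=1..\<mu>. \<Sum>l\<in>J - {o'}.
      deriv (deriv (f j)) (X j 1 z) * of_bool (c = Z j 1) * (of_bool (il l = Z j 1) * u (il l) z)
      + 2 * (\<Sum>i=1..n j. dY j (n j + 1 - i) c z * (\<delta> j (il l) z i * u (il l) z)))"
    by (rule sum.swap)
  also have "\<dots> = (\<Sum>j=1..\<mu>. (\<Sum>l\<in>J - {o'}.
      deriv (deriv (f j)) (X j 1 z) * of_bool (c = Z j 1) * (of_bool (il l = Z j 1) * u (il l) z))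
      + 2 * (\<Sum>i=1..n j. dY j (n j + 1 - i) c z * (\<Sum>l\<in>J - {o'}. \<delta> j (il l) z i * u (il l) z)))"
  proof (rule sum.cong[OF refl])
    fix j
    have "(\<Sum>l\<in>J - {o'}. \<Sum>i=1..n j. dY j (n j + 1 - i) c z * (\<delta> j (il l) z i * u (il l) z))
        = (\<Sum>i=1..n j. dY j (n j + 1 - i) c z * (\<Sum>l\<in>J - {o'}. \<delta> j (il l) z i * u (il l) z))"
      unfolding sum_distrib_left by (rule sum.swap)
    then show "(\<Sum>l\<in>J - {o'}.
      deriv (deriv (f j)) (X j 1 z) * of_bool (c = Z j 1) * (of_bool (il l = Z j 1) * u (il l) z)
      + 2 * (\<Sum>i=1..n j. dY j (n j + 1 - i) c z * (\<delta> j (il l) z i * u (il l) z)))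
      = (\<Sum>l\<in>J - {o'}.
      deriv (deriv (f j)) (X j 1 z) * of_bool (c = Z j 1) * (of_bool (il l = Z j 1) * u (il l) z))
      + 2 * (\<Sum>i=1..n j. dY j (n j + 1 - i) c z * (\<Sum>l\<in>J - {o'}. \<delta> j (il l) z i * u (il l) z))"
      by (simp add: sum.distrib sum_distrib_left[symmetric])
  qed
  also have "\<dots> = 0"
  proof (rule sum.neutral, rule ballI)
    fix j assume j: "j \<in> {1..\<mu>}"
    have zero: "of_bool (il l = Z j 1) * u (il l) z = 0" for l by (auto simp: Y_def)
    have A: "(\<Sum>l\<in>J - {o'}.
        deriv (deriv (f j)) (X j 1 z) * of_bool (c = Z j 1) * (of_bool (il l = Z j 1) * u (il l) z)) = 0"
      by (simp only: zero mult_zero_right sum.neutral_const)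
    have B: "(\<Sum>i=1..n j. dY j (n j + 1 - i) c z * (\<Sum>l\<in>J - {o'}. \<delta> j (il l) z i * u (il l) z)) = 0"
      by (rule sum.neutral) (simp add: delta_u[OF j])
    show "(\<Sum>l\<in>J - {o'}.
      deriv (deriv (f j)) (X j 1 z) * of_bool (c = Z j 1) * (of_bool (il l = Z j 1) * u (il l) z))
      + 2 * (\<Sum>i=1..n j. dY j (n j + 1 - i) c z * (\<Sum>l\<in>J - {o'}. \<delta> j (il l) z i * u (il l) z)) = 0"
      unfolding A B by simp
  qed
  finally show ?thesis .
qed

text \<open>The block components of \<open>u\<close> are, up to sign, coordinates \<open>y\<close>,
  and these are constant along \<open>u\<close>.\<close>

lemma U_ker:
  assumes "c \<in> coords \<mu> n"
  shows "(\<Sum>l\<in>J - {o'}. U c (il l) z * u (il l) z) = 0"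
proof (cases c)
  case (Z j i)
  then have ji: "j \<in> {1..\<mu>}" "i \<in> {1..n j}" using assms by (auto simp: coords_def)
  have "(\<Sum>l\<in>J - {o'}. dY j (i - 1) (il l) z * u (il l) z)
      = resolvent (Re (z \<xi>)) (\<lambda>i. \<Sum>l\<in>J - {o'}. \<delta> j (il l) z i * u (il l) z) (i - 1)"
    unfolding dY_def by (rule resolvent_sum[symmetric])
  also have "\<dots> = 0" using ji by (intro resolvent_zero delta_u) auto
  finally show ?thesis by (simp add: Z sum_negf)
qed auto

text \<open>On the labels in \<open>I\<close> the differential \<open>dt\<close> is absent and
  \<open>\<delta>\<^sub>i\<close> reduces to \<open>dx\<^sub>i\<close>, so the matrix of
  \<open>dY\<close> is \<open>(1 - t T)\<^sup>-\<^sup>1\<close> on each block. Both the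
  nondegeneracy of the Hessian and the adjoint operator rest on this.\<close>

lemma sum_dY:
  fixes d :: "coord \<Rightarrow> complex"
  assumes j: "j \<in> {1..\<mu>}" and r: "r \<le> n j"
  shows "(\<Sum>l\<in>J - {o', \<xi>}. of_real (dY j r (il l) z) * d (il l)) = resolvent (of_real (Re (z \<xi>))) (\<lambda>i. d (Z j i)) r"
proof -
  have "(\<Sum>l\<in>J - {o', \<xi>}. of_real (dY j r (il l) z) * d (il l))
      = resolvent (of_real (Re (z \<xi>))) (\<lambda>i. \<Sum>l\<in>J - {o', \<xi>}. of_real (\<delta> j (il l) z i) * d (il l)) r"
    unfolding dY_def of_real_resolvent by (rule resolvent_sum[symmetric])
  also have "\<dots> = resolvent (of_real (Re (z \<xi>))) (\<lambda>i. d (Z j i)) r"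
  proof (rule resolvent_cong)
    fix i assume i: "1 \<le> i" "i \<le> r"
    have "(\<Sum>j'=1..\<mu>. \<Sum>i'=1..n j'. of_real (\<delta> j (Z j' i') z i) * d (Z j' i'))
        = (\<Sum>j'=1..\<mu>. if j' = j then (\<Sum>i'=1..n j'. if i' = i then d (Z j' i') else 0) else 0)"
    proof (intro sum.cong refl)
      fix j'
      show "(\<Sum>i'=1..n j'. of_real (\<delta> j (Z j' i') z i) * d (Z j' i'))
          = (if j' = j then (\<Sum>i'=1..n j'. if i' = i then d (Z j' i') else 0) else 0)"
        by (cases "j' = j") (auto simp: \<delta>_def intro: sum.neutral intro!: sum.cong[OF refl] simp del: sum.delta sum.delta')
    qed
    also have "\<dots> = d (Z j i)" using i r j by simp
    finally show "(\<Sum>l\<in>J - {o', \<xi>}. of_real (\<delta> j (il l) z i) * d (il l)) = d (Z j i)"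
      unfolding sum_I[of "\<lambda>c. of_real (\<delta> j c z i) * d c"] .
  qed
  finally show ?thesis .
qed

lemma H_block:
  assumes j: "j \<in> {1..\<mu>}" and i: "i \<in> {1..n j}"
  shows "H (Z j i) c z = deriv (deriv (f j)) (X j 1 z) * of_bool (i = 1) * of_bool (c = Z j 1)
    + 2 * dY j (n j + 1 - i) c z"
proof -
  have "H (Z j i) c z = (\<Sum>j'=1..\<mu>. if j' = j then
      deriv (deriv (f j')) (X j' 1 z) * of_bool (i = 1) * of_bool (c = Z j' 1)
      + 2 * (\<Sum>i'=1..n j'. if i' = i then dY j' (n j' + 1 - i') c z else 0) else 0)"
    unfolding H_def by (intro sum.cong refl) (auto simp: \<delta>_def intro!: sum.neutral sum.cong)
  then show ?thesis using i j by simp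
qed

lemma H_nondeg:
  fixes d :: "'i \<Rightarrow> complex"
  assumes H0: "\<forall>k\<in>J - {o', \<xi>}. (\<Sum>l\<in>J - {o', \<xi>}. of_real (H (il k) (il l) z) * d l) = 0"
    and l: "l \<in> J - {o', \<xi>}"
  shows "d l = 0"
proof -
  obtain j i where ji: "j \<in> {1..\<mu>}" "i \<in> {1..n j}" and l: "l = lab (Z j i)"
    using l by (auto simp: coords_eq)
  have labI: "lab (Z j i) \<in> J - {o', \<xi>}" if "i \<in> {1..n j}" for i
    using that ji by (auto simp: lab_inj coords_intros)
  let ?d = "\<lambda>c. d (lab c)"
  have d: "d l = ?d (il l)" if "l \<in> J - {o', \<xi>}" for l using that by (auto simp: il_lab)
  have "?d (Z j i) = 0"
  proof (rule resolvent_nondegenerate[where m = "n j" and d = "\<lambda>i. ?d (Z j i)", OF _ _ ji(2)])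
    show "n j = 1 \<Longrightarrow> complex_of_real (deriv (deriv (f j)) (X j 1 z)) \<noteq> - 2"
      using f2[OF ji(1), of "X j 1 z"] of_real_eq_iff[of "deriv (deriv (f j)) (X j 1 z)" "- 2", where 'a = complex] by simp
    fix i assume i: "i \<in> {1..n j}"
    have "0 = (\<Sum>l\<in>J - {o', \<xi>}. of_real (H (Z j i) (il l) z) * ?d (il l))"
    proof -
      have "(\<Sum>l\<in>J - {o', \<xi>}. of_real (H (Z j i) (il l) z) * ?d (il l))
          = (\<Sum>l\<in>J - {o', \<xi>}. of_real (H (Z j i) (il l) z) * d l)"
        by (rule sum.cong[OF refl]) (simp only: d[symmetric])
      then show ?thesis using H0[rule_format, OF labI[OF i]] block_label[OF ji(1) i] by simp
    qed
    also have "\<dots> = of_real (deriv (deriv (f j)) (X j 1 z)) * of_bool (i = 1)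
          * (\<Sum>l\<in>J - {o', \<xi>}. of_bool (il l = Z j 1) * ?d (il l))
        + 2 * (\<Sum>l\<in>J - {o', \<xi>}. of_real (dY j (n j + 1 - i) (il l) z) * ?d (il l))"
    proof -
      have "complex_of_real (of_bool b) = of_bool b" for b by (cases b) auto
      then show ?thesis
        unfolding H_block[OF ji(1) i] by (simp add: distrib_right sum.distrib sum_distrib_left mult.assoc)
    qed
    also have "(\<Sum>l\<in>J - {o', \<xi>}. of_bool (il l = Z j 1) * ?d (il l)) = ?d (Z j 1)"
    proof -
      have "(\<Sum>j'=1..\<mu>. \<Sum>i'=1..n j'. of_bool (Z j' i' = Z j 1) * ?d (Z j' i'))
          = (\<Sum>j'=1..\<mu>. if j' = j then (\<Sum>i'=1..n j'. if i' = 1 then ?d (Z j' i') else 0) else 0)"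
        by (intro sum.cong refl) (auto intro!: sum.neutral sum.cong)
      then show ?thesis
        unfolding sum_I[of "\<lambda>c. of_bool (c = Z j 1) * ?d c"] using ji n_pos[OF ji(1)] by simp
    qed
    also have "(\<Sum>l\<in>J - {o', \<xi>}. of_real (dY j (n j + 1 - i) (il l) z) * ?d (il l))
        = resolvent (of_real (Re (z \<xi>))) (\<lambda>i. ?d (Z j i)) (n j + 1 - i)"
      using i by (intro sum_dY[OF ji(1)]) auto
    finally show "(if i = 1 then of_real (deriv (deriv (f j)) (X j 1 z)) * ?d (Z j 1) else 0)
        + 2 * resolvent (of_real (Re (z \<xi>))) (\<lambda>i. ?d (Z j i)) (n j + 1 - i) = 0"
      by (auto split: if_splits)
  qed
  then show ?thesis using l by simp
qed

section \<open>The block family as a tube and its adjoint operators\<close>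

sublocale tube J o' \<xi> \<Phi> "\<lambda>l. G (il l)" "\<lambda>l l'. H (il l) (il l')" "\<lambda>l. u (il l)" "\<lambda>l l'. U (il l) (il l')"
proof
  have Z0: "il o' = Z0" "il \<xi> = Xi" by (simp_all add: il_lab coords_intros)
  show "finite J" by (rule finJ)
  show "o' \<in> J" "\<xi> \<in> J" by (simp_all add: coords_intros)
  show ox: "o' \<noteq> \<xi>" by (simp add: lab_inj coords_intros)
  show "has_wirtinger J (\<lambda>p. of_real (\<Phi> p)) (\<lambda>j. of_real (G (il j) q) / 2) (\<lambda>j. of_real (G (il j) q) / 2) q"
    if "q \<in> cspace J" for q using dc_Phi[OF that] by (simp add: deriv_coeffs_def)
  have delta0: "\<delta> j Z0 q i = 0" for j q i by (simp add: \<delta>_def)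
  have dY0: "dY j r Z0 q = 0" for j q r by (simp add: dY_def delta0 resolvent_zero)
  show "G (il o') q = 0" for q by (simp add: Z0 G_def delta0)
  show "H (il k) (il o') q = 0" for q k by (simp add: Z0 H_def dY0)
  show "U (il k) (il o') q = 0" for q k by (cases "il k") (simp_all add: Z0 dY0)
  show "\<Phi> (q(o' := c)) = \<Phi> q" for q c
  proof -
    have "P (f j) (n j) (\<lambda>i. X j i (q(o' := c))) t = P (f j) (n j) (\<lambda>i. X j i q) t" if j: "j \<in> {1..\<mu>}" for j t
    proof -
      have X: "X j i (q(o' := c)) = X j i q" if "i \<in> {1..n j}" for i
        using j that by (simp add: X_def lab_inj coords_intros)
      then have "X j 1 (q(o' := c)) = X j 1 q" using n_pos[OF j] by simp
      moreover have "resolvent t (\<lambda>i. X j i (q(o' := c))) r = resolvent t (\<lambda>i. X j i q) r" if "r \<le> n j" for r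
        using that X by (intro resolvent_cong) auto
      ultimately show ?thesis
        unfolding P_def resolvent_quadratic using X by (intro arg_cong2[of _ _ _ _ "(+)"] sum.cong) auto
    qed
    then show ?thesis using ox unfolding \<Phi>_def by (intro sum.cong) auto
  qed
  show "has_wirtinger J (\<lambda>p. of_real (G (il k) p)) (\<lambda>l. of_real (H (il k) (il l) q) / 2) (\<lambda>l. of_real (H (il k) (il l) q) / 2) q"
    if "q \<in> cspace J" for q k using dc_G[OF that] by (simp add: deriv_coeffs_def)
  show "H (il k) (il l) q = H (il l) (il k) q" for k l q by (rule H_sym)
  show "(\<Sum>l\<in>J - {o'}. H (il k) (il l) q * u (il l) q) = 0" for k q by (rule H_ker)
  show "d l = 0" if "\<forall>k\<in>J - {o', \<xi>}. (\<Sum>l\<in>J - {o', \<xi>}. of_real (H (il k) (il l) q) * d l) = 0"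
    "l \<in> J - {o', \<xi>}" for q l and d :: "'i \<Rightarrow> complex"
    using H_nondeg that by blast
  show "u (il \<xi>) q = 1" for q by (simp add: Z0)
  show "has_wirtinger J (\<lambda>p. of_real (u (il r) p)) (\<lambda>l. of_real (U (il r) (il l) q) / 2) (\<lambda>l. of_real (U (il r) (il l) q) / 2) q"
    if "q \<in> cspace J" "r \<in> J - {o', \<xi>}" for q r
    using dc_u[OF that(1), of "il r"] that(2) by (auto simp: deriv_coeffs_def il_lab)
  show "(\<Sum>l\<in>J - {o'}. U (il r) (il l) q * u (il l) q) = 0" if "r \<in> J - {o', \<xi>}" for r q
    using that by (intro U_ker) (auto simp: il_lab)
qed

text \<open>Let \<open>C\<close> have the chain vectors as columns in each block and put
  \<open>E = C K\<close>. Since \<open>t\<close> is real, \<open>conj(C) = C\<close>, hence \<open>-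
  U conj(E) = T (1 - t T)\<^sup>-\<^sup>1 C conj(K) = C T conj(K) = C K A = E A\<close>, where
  \<open>T\<close> now denotes the direct sum of the blocks.\<close>

theorem block_ad_represented:
  assumes q: "q \<in> hypersurface J (graph_eq o' \<Phi>)" and A: "A \<in> carrier_mat m m"
    and K: "chain_matrix m A \<mu> n K"
  shows "ad_represented_by J (graph_eq o' \<Phi>) q A"
proof -
  define t where "t = complex_of_real (Re (q \<xi>))"
  have cnj_t: "cnj t = t" by (simp add: t_def)
  have cnj_resolvent: "cnj (resolvent t a r) = resolvent t (\<lambda>i. cnj (a i)) r" for a r
    by (induction r) (simp_all add: cnj_t)
  have cnj_chain: "cnj (chain t i r) = chain t i r" for i r
    by (induction i arbitrary: r) (simp_all add: cnj_resolvent)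
  define e where "e s c = (case c of Z j r \<Rightarrow> \<Sum>i=1..n j. K j i s * chain t (i - 1) r | _ \<Rightarrow> 0)" for s c
  have chain_row: "(\<Sum>s<m. K j i s * A $$ (s, s')) = (if i = 1 then 0 else cnj (K j (i - 1) s'))"
    if "j \<in> {1..\<mu>}" "i \<in> {1..n j}" "s' < m" for j i s'
    using K that by (simp add: chain_matrix_def)
  have I: "(\<forall>l\<in>J - {o', \<xi>}. Q (il l)) \<longleftrightarrow> (\<forall>j\<in>{1..\<mu>}. \<forall>r\<in>{1..n j}. Q (Z j r))" for Q
    unfolding I_eq by (auto simp: block_label)
  show ?thesis
  proof (rule ad_represented_byI[OF q A, where e = "\<lambda>s l. e s (il l)"])
    fix w :: "'i \<Rightarrow> complex"
    have tri: "chain t (i - 1) r = 0" if "r < i" for i r using that by (intro chain_triangular) auto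
    \<comment> \<open>Chain vectors are shifted to start from index 1; the values at index 0 are
      padding that keeps \<open>M\<close> unitriangular for all indices.\<close>
    define M where "M i r = (if i = 0 then if r = 0 then 1 else 0 else chain t (i - 1) r)" for i r
    have M: "M i r = 0" if "r < i" for i r using that tri by (simp add: M_def)
    have M1: "M i i = 1" for i by (cases i) (simp_all add: M_def chain_triangular)
    have "\<exists>\<kappa>. \<forall>r\<in>{1..n j}. (\<Sum>i=1..n j. \<kappa> i * M i r) = w (lab (Z j r))" for j
      by (rule unitriangular_exists[OF M M1])
    then obtain \<kappa> where \<kappa>: "\<And>j r. r \<in> {1..n j} \<Longrightarrow> (\<Sum>i=1..n j. \<kappa> j i * M i r) = w (lab (Z j r))" by metis
    have sum_e: "(\<Sum>s<m. vec_index c s * e s (Z j r)) = (\<Sum>i=1..n j. (\<Sum>s<m. vec_index c s * K j i s) * M i r)" for c j r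
    proof -
      have "(\<Sum>s<m. vec_index c s * e s (Z j r)) = (\<Sum>i=1..n j. \<Sum>s<m. vec_index c s * (K j i s * chain t (i - 1) r))"
        unfolding e_def coord.case sum_distrib_left by (rule sum.swap)
      also have "\<dots> = (\<Sum>i=1..n j. (\<Sum>s<m. vec_index c s * K j i s) * M i r)"
        unfolding sum_distrib_right by (intro sum.cong refl) (auto simp: M_def)
      finally show ?thesis .
    qed
    have "(\<forall>l\<in>J - {o', \<xi>}. (\<Sum>s<m. vec_index c s * e s (il l)) = w l)
        \<longleftrightarrow> (\<forall>j\<in>{1..\<mu>}. \<forall>i\<in>{1..n j}. (\<Sum>s<m. vec_index c s * K j i s) = \<kappa> j i)" (is "?L \<longleftrightarrow> ?R") for c
    proof -
      have "?L \<longleftrightarrow> (\<forall>l\<in>J - {o', \<xi>}. (\<Sum>s<m. vec_index c s * e s (il l)) = w (lab (il l)))"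
        by (intro ball_cong) (auto simp: il_lab)
      also have "\<dots> \<longleftrightarrow> (\<forall>j\<in>{1..\<mu>}. \<forall>r\<in>{1..n j}.
          (\<Sum>i=1..n j. (\<Sum>s<m. vec_index c s * K j i s) * M i r) = (\<Sum>i=1..n j. \<kappa> j i * M i r))"
        unfolding I[of "\<lambda>d. (\<Sum>s<m. vec_index c s * e s d) = w (lab d)"] sum_e
        by (intro ball_cong refl) (simp only: \<kappa>)
      also have "\<dots> \<longleftrightarrow> ?R"
      proof
        assume L: "\<forall>j\<in>{1..\<mu>}. \<forall>r\<in>{1..n j}.
          (\<Sum>i=1..n j. (\<Sum>s<m. vec_index c s * K j i s) * M i r) = (\<Sum>i=1..n j. \<kappa> j i * M i r)"
        show ?R
        proof (intro ballI)
          fix j i assume "j \<in> {1..\<mu>}" "i \<in> {1..n j}"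
          then show "(\<Sum>s<m. vec_index c s * K j i s) = \<kappa> j i"
            using L by (intro unitriangular_inject[OF M M1, where m = "n j"]) auto
        qed
      qed (auto intro!: sum.cong)
      finally show ?thesis .
    qed
    then show "\<exists>!c. c \<in> carrier_vec m \<and> (\<forall>l\<in>J - {o', \<xi>}. (\<Sum>s<m. vec_index c s * e s (il l)) = w l)"
      using K by (simp add: chain_matrix_def)
  next
    fix s l assume s: "s < m" and "l \<in> J - {o', \<xi>}"
    then obtain p where "p \<in> (SIGMA j:{1..\<mu>}. {1..n j})" "l = (\<lambda>(j, i). lab (Z j i)) p"
      unfolding I_eq by blast
    then obtain j r where jr: "j \<in> {1..\<mu>}" "r \<in> {1..n j}" and "l = lab (Z j r)"
      by (intro that[of "fst p" "snd p"]) auto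
    then have l: "il l = Z j r" by (simp add: block_label)
    have "- (\<Sum>k\<in>J - {o', \<xi>}. of_real (U (il l) (il k) q) * cnj (e s (il k)))
        = (\<Sum>k\<in>J - {o', \<xi>}. of_real (dY j (r - 1) (il k) q) * cnj (e s (il k)))"
      by (simp add: l sum_negf)
    also have "\<dots> = resolvent t (\<lambda>k. cnj (e s (Z j k))) (r - 1)"
      unfolding t_def using jr by (intro sum_dY) auto
    also have "(\<lambda>k. cnj (e s (Z j k))) = (\<lambda>k. \<Sum>i=1..n j. chain t (i - 1) k * cnj (K j i s))"
      by (simp add: e_def cnj_chain mult.commute)
    also have "resolvent t (\<lambda>k. \<Sum>i=1..n j. chain t (i - 1) k * cnj (K j i s)) (r - 1)
        = (\<Sum>i=1..n j. resolvent t (chain t (i - 1)) (r - 1) * cnj (K j i s))"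
      by (rule resolvent_sum)
    also have "\<dots> = (\<Sum>i=1..n j. chain t i r * cnj (K j i s))"
    proof (rule sum.cong[OF refl])
      fix i assume "i \<in> {1..n j}"
      then show "resolvent t (chain t (i - 1)) (r - 1) * cnj (K j i s) = chain t i r * cnj (K j i s)"
        by (cases i) auto
    qed
    also have "\<dots> = (\<Sum>i=1..n j. (if i = 1 then 0 else cnj (K j (i - 1) s)) * chain t (i - 1) r)"
    proof -
      \<comment> \<open>The image of the last chain vector lies beyond the block, so the shift of
        the summation index loses nothing.\<close>
      have "chain t (n j) r = 0" using jr by (intro chain_triangular) auto
      then have "(\<Sum>i=1..n j. chain t i r * cnj (K j i s)) = (\<Sum>i\<in>{1..n j} - {n j}. chain t i r * cnj (K j i s))"
        by (intro sum.mono_neutral_right) auto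
      also have "\<dots> = (\<Sum>i\<in>{1..n j} - {1}. cnj (K j (i - 1) s) * chain t (i - 1) r)"
        by (rule sum.reindex_bij_witness[of _ "\<lambda>i. i - 1" Suc]) auto
      also have "\<dots> = (\<Sum>i\<in>{1..n j} - {1}. (if i = 1 then 0 else cnj (K j (i - 1) s)) * chain t (i - 1) r)"
        by (rule sum.cong) auto
      also have "\<dots> = (\<Sum>i=1..n j. (if i = 1 then 0 else cnj (K j (i - 1) s)) * chain t (i - 1) r)"
        by (rule sum.mono_neutral_left) auto
      finally show ?thesis .
    qed
    also have "\<dots> = (\<Sum>i=1..n j. \<Sum>k<m. A $$ (k, s) * (K j i k * chain t (i - 1) r))"
    proof (rule sum.cong[OF refl])
      fix i assume i: "i \<in> {1..n j}"
      show "(if i = 1 then 0 else cnj (K j (i - 1) s)) * chain t (i - 1) r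
          = (\<Sum>k<m. A $$ (k, s) * (K j i k * chain t (i - 1) r))"
        unfolding chain_row[OF jr(1) i s, symmetric] sum_distrib_right
        by (rule sum.cong) (simp_all only: mult_ac)
    qed
    also have "\<dots> = (\<Sum>k<m. A $$ (k, s) * e k (il l))"
      unfolding l e_def coord.case sum_distrib_left by (rule sum.swap)
    finally show "- (\<Sum>k\<in>J - {o', \<xi>}. of_real (U (il l) (il k) q) * cnj (e s (il k)))
        = (\<Sum>k<m. A $$ (k, s) * e k (il l))" .
  qed
qed

text \<open>In a block of size at least 2 the entry of \<open>U\<close> at \<open>Z j 2\<close> and
  \<open>Z j 1\<close> is the constant -1, because \<open>y\<^sub>1 = x\<^sub>1\<close>.\<close>

theorem block_uniformly_2_nondegenerate:
  assumes j: "j \<in> {1..\<mu>}" "n j \<ge> 2"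
  shows "uniformly_2_nondegenerate J (graph_eq o' \<Phi>)"
proof (rule uniformly_2_nondegenerateI, intro bexI)
  fix q
  have c: "Z j 1 \<in> coords \<mu> n" "Z j 2 \<in> coords \<mu> n" using j by (auto intro: coords_intros)
  show "U (il (lab (Z j 2))) (il (lab (Z j 1))) q \<noteq> 0"
    using c by (simp add: il_lab dY_def \<delta>_def numeral_2_eq_2)
  show "lab (Z j 2) \<in> J - {o', \<xi>}" "lab (Z j 1) \<in> J - {o', \<xi>}"
    using c by (auto simp: lab_inj coords_intros)
qed

end


section \<open>Linking and extending\<close>

lemma P_cong: "m \<ge> 1 \<Longrightarrow> (\<And>i. i \<in> {1..m} \<Longrightarrow> x i = x' i) \<Longrightarrow> P f m x t = P f m x' t"
  unfolding P_def by (intro arg_cong2[of _ _ _ _ "(+)"] sum.cong) auto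

text \<open>The number of variables of \<open>model\<close> includes \<open>\<xi>\<close>, so it
  exceeds the size of the block by one; \<open>n > 2\<close> corresponds to blocks of size at least
  2.\<close>

lemma model_eq_P: "model (m + 1) f = (\<lambda>z. P f m (\<lambda>i. Re (z i)) (Re (z (m + 1))))"
proof -
  have "{(j, k). 0 < j \<and> j < j + k \<and> j + k \<le> m + 1} = {(j, k). j \<ge> 1 \<and> k \<ge> 1 \<and> j + k \<le> m + 1}" by auto
  then show ?thesis by (simp only: model_def[abs_def] P_def)
qed

lemma twice_differentiable_zero: "twice_differentiable (\<lambda>_. 0)"
  by (simp add: twice_differentiable_def)

text \<open>With zero functions a block of size 1 is the square added by an extension with sign 1,
  and the second derivative avoids -2. The labelling is a parameter because linking renumbers the
  coordinates.\<close>

definition family_fun :: "nat \<Rightarrow> (nat \<Rightarrow> nat) \<Rightarrow> (coord \<Rightarrow> 'i) \<Rightarrow> ('i \<Rightarrow> complex) \<Rightarrow> real" where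
  "family_fun \<mu> n lab z = (\<Sum>j=1..\<mu>. P (\<lambda>_. 0) (n j) (\<lambda>i. Re (z (lab (Z j i)))) (Re (z (lab Xi))))"

lemma family_block:
  assumes n: "\<forall>j\<in>{1..\<mu>}. n j \<ge> 1" and lab: "bij_betw lab (coords \<mu> n) J"
  shows "block_family \<mu> n (\<lambda>_ _. 0) lab (inv_into (coords \<mu> n) lab)"
    "lab ` coords \<mu> n = J" "block_family.\<Phi> \<mu> n (\<lambda>_ _. 0) lab = family_fun \<mu> n lab"
proof -
  show *: "block_family \<mu> n (\<lambda>_ _. 0) lab (inv_into (coords \<mu> n) lab)"
    using n lab by unfold_locales (auto simp: twice_differentiable_zero bij_betw_def inv_into_f_f)
  show "lab ` coords \<mu> n = J" using lab by (simp add: bij_betw_def)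
  show "block_family.\<Phi> \<mu> n (\<lambda>_ _. 0) lab = family_fun \<mu> n lab"
    by (rule ext) (simp add: block_family.\<Phi>_def[OF *] block_family.X_def[OF *] family_fun_def)
qed

lemma family_uniformly_2_nondegenerate:
  assumes "\<forall>j\<in>{1..\<mu>}. n j \<ge> 1" "bij_betw lab (coords \<mu> n) J" "j \<in> {1..\<mu>}" "n j \<ge> 2"
  shows "uniformly_2_nondegenerate J (graph_eq (lab Z0) (family_fun \<mu> n lab))"
  using block_family.block_uniformly_2_nondegenerate[OF family_block(1)[OF assms(1,2)] assms(3,4)]
  unfolding family_block(2,3)[OF assms(1,2)] .

text \<open>A vector of the Levi kernel is determined by its \<open>\<xi>\<close>-coordinate,
  whereas \<open>tangent_field\<close> number \<open>k\<close> has \<open>\<xi>\<close>-coordinate 0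
  and \<open>k\<close>-coordinate 1.\<close>

lemma family_linkable:
  assumes \<mu>: "\<mu> \<ge> 1" and n: "\<forall>j\<in>{1..\<mu>}. n j \<ge> 2"
    and lab: "bij_betw lab (coords \<mu> n) {0..N}" "lab Z0 = 0" "lab Xi = N" and N: "N \<ge> 1"
  shows "linkable N (family_fun \<mu> n lab)"
proof -
  have n1: "\<forall>j\<in>{1..\<mu>}. n j \<ge> 1" using n by fastforce
  interpret block_family \<mu> n "\<lambda>_ _. 0" lab "inv_into (coords \<mu> n) lab"
    by (rule family_block(1)[OF n1 lab(1)])
  have "tangent_field \<Phi> k q \<notin> levi_kernel J (graph_eq (lab Z0) \<Phi>) q"
    if k: "k \<in> {1..<N}" and q: "q \<in> hypersurface J (graph_eq (lab Z0) \<Phi>)" for k q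
  proof
    assume "tangent_field \<Phi> k q \<in> levi_kernel J (graph_eq (lab Z0) \<Phi>) q"
    moreover have "k \<in> J - {lab Z0, lab Xi}" using k lab family_block(2)[OF n1 lab(1)] by auto
    ultimately have "fst (tangent_field \<Phi> k q) k = fst (tangent_field \<Phi> k q) (lab Xi)
        * of_real (u (inv_into (coords \<mu> n) lab k) q)"
      unfolding levi_kernel_iff[OF q] by blast
    then show False using k lab by (simp add: tangent_field_def)
  qed
  moreover have "uniformly_2_nondegenerate J (graph_eq (lab Z0) \<Phi>)"
    using \<mu> n by (intro block_uniformly_2_nondegenerate[of 1]) auto
  ultimately show ?thesis
    using N unfolding linkable_def family_block(2,3)[OF n1 lab(1)] lab(2) by simp
qed

section \<open>Labels under linking and extending\<close>

lemma single_label: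
  fixes n :: "nat \<Rightarrow> nat"
  defines "lab \<equiv> \<lambda>c. case c of Z0 \<Rightarrow> 0 | Xi \<Rightarrow> n 1 + 1 | Z j i \<Rightarrow> i"
  shows "bij_betw lab (coords 1 n) {0..n 1 + 1}" "family_fun 1 n lab = model (n 1 + 1) (\<lambda>_. 0)"
proof -
  show "bij_betw lab (coords 1 n) {0..n 1 + 1}"
    by (rule bij_betw_byWitness[where f' = "\<lambda>x. if x = 0 then Z0 else if x = n 1 + 1 then Xi else Z 1 x"])
      (auto simp: coords_def lab_def)
  show "family_fun 1 n lab = model (n 1 + 1) (\<lambda>_. 0)"
    unfolding model_eq_P by (rule ext) (simp add: family_fun_def lab_def)
qed

text \<open>Linking identifies last coordinates, so the induction maintains that \<open>Xi\<close>
  carries the last label. An extension puts its new variable last, which is why all blocks of size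
  at least 2 are linked before anything is extended.\<close>

lemma obtainable_blocks:
  assumes "\<mu> \<ge> 1" "\<forall>j\<in>{1..\<mu>}. n j \<ge> 2"
  shows "\<exists>N lab. bij_betw lab (coords \<mu> n) {0..N} \<and> lab Z0 = 0 \<and> lab Xi = N \<and> N \<ge> 1
    \<and> obtainable N (family_fun \<mu> n lab)"
  using assms
proof (induction \<mu> rule: dec_induct)
  case base
  let ?lab = "\<lambda>c. case c of Z0 \<Rightarrow> 0 | Xi \<Rightarrow> n 1 + 1 | Z j i \<Rightarrow> i"
  have "obtainable (n 1 + 1) (family_fun 1 n ?lab)"
    unfolding single_label(2) using base by (intro obtainable_model twice_differentiable_zero) auto
  then show ?case using single_label(1)[of n] by (intro exI[of _ "n 1 + 1"] exI[of _ ?lab]) simp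
next
  case (step \<mu>)
  have n: "\<forall>j\<in>{1..\<mu>}. n j \<ge> 2" using step.prems by auto
  obtain N lab where lab: "bij_betw lab (coords \<mu> n) {0..N}" "lab Z0 = 0" "lab Xi = N" and N: "N \<ge> 1"
    and ob: "obtainable N (family_fun \<mu> n lab)"
    using step.IH n by blast
  define m where "m = n (Suc \<mu>)"
  have m: "m \<ge> 2" using step by (simp add: m_def)
  let ?lab1 = "\<lambda>c. case c of Z0 \<Rightarrow> 0 | Xi \<Rightarrow> m + 1 | Z j i \<Rightarrow> i"
  note single = single_label[of "\<lambda>_. m"]
  have link1: "linkable N (family_fun \<mu> n lab)"
    using step n lab N by (intro family_linkable) auto
  have "linkable (m + 1) (family_fun 1 (\<lambda>_. m) ?lab1)"
    using m single(1) by (intro family_linkable) auto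
  then have link2: "linkable (m + 1) (model (m + 1) (\<lambda>_. 0))" unfolding single(2) .
  have "obtainable (m + 1) (model (m + 1) (\<lambda>_. 0))"
    using m by (intro obtainable_model twice_differentiable_zero) auto
  from obtainable_link[OF ob this link1 link2]
  have ob': "obtainable (N + m) (link N (family_fun \<mu> n lab) (m + 1) (model (m + 1) (\<lambda>_. 0)))" by simp
  \<comment> \<open>The renumbering performed by \<open>link\<close>: old block labels, which are
    below \<open>N\<close>, stay; the new block occupies \<open>N\<close> to
    \<open>N + m - 1\<close>; the common variable moves from \<open>N\<close> to
    \<open>N + m\<close>.\<close>
  define lab' where "lab' c = (case c of Z0 \<Rightarrow> 0 | Xi \<Rightarrow> N + m
    | Z j i \<Rightarrow> if j = Suc \<mu> then N - 1 + i else lab (Z j i))" for c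
  have inj: "inj_on lab (coords \<mu> n)" and surj: "lab ` coords \<mu> n = {0..N}"
    using lab(1) by (simp_all add: bij_betw_def)
  have range: "0 < lab (Z j i)" "lab (Z j i) < N" if "j \<in> {1..\<mu>}" "i \<in> {1..n j}" for j i
  proof -
    have c: "Z j i \<in> coords \<mu> n" "Z0 \<in> coords \<mu> n" "Xi \<in> coords \<mu> n" using that by (auto simp: coords_def)
    have "lab (Z j i) \<in> {0..N}" using c surj by blast
    moreover have "lab (Z j i) \<noteq> 0" "lab (Z j i) \<noteq> N"
      using inj_onD[OF inj, of "Z j i" Z0] inj_onD[OF inj, of "Z j i" Xi] c lab by auto
    ultimately show "0 < lab (Z j i)" "lab (Z j i) < N" by auto
  qed
  have coords': "coords (Suc \<mu>) n = insert Z0 (insert Xi ((\<lambda>(j, i). Z j i) ` (SIGMA j:{1..\<mu>}. {1..n j}) \<union> Z (Suc \<mu>) ` {1..m}))"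
    by (auto simp: coords_def m_def image_iff le_Suc_eq)
  have image: "lab' ` coords (Suc \<mu>) n = {0..N + m}"
  proof (intro equalityI subsetI)
    fix x assume "x \<in> lab' ` coords (Suc \<mu>) n"
    then show "x \<in> {0..N + m}" unfolding coords' using range by (fastforce simp: lab'_def)
  next
    fix x assume x: "x \<in> {0..N + m}"
    consider "x = N + m" | "N \<le> x" "x < N + m" | "x < N" using x by fastforce
    then show "x \<in> lab' ` coords (Suc \<mu>) n"
    proof cases
      case 1
      then show ?thesis by (intro image_eqI[of _ _ Xi]) (auto simp: lab'_def coords')
    next
      case 2
      then show ?thesis using N
        by (intro image_eqI[of _ _ "Z (Suc \<mu>) (x - N + 1)"]) (auto simp: lab'_def coords')
    next
      case 3
      then have "x \<in> lab ` coords \<mu> n" using surj by auto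
      then obtain c where c: "c \<in> coords \<mu> n" "x = lab c" by blast
      then have "c \<noteq> Xi" using 3 lab by auto
      then have "lab' c = x" "c \<in> coords (Suc \<mu>) n"
        using c lab by (auto simp: lab'_def coords_def)
      then show ?thesis by blast
    qed
  qed
  have "coords (Suc \<mu>) n = coords \<mu> n \<union> Z (Suc \<mu>) ` {1..m}"
    by (auto simp: coords_def m_def image_iff le_Suc_eq)
  moreover have "finite (coords \<mu> n)" using bij_betw_finite[OF lab(1)] by simp
  moreover have "coords \<mu> n \<inter> Z (Suc \<mu>) ` {1..m} = {}" by (auto simp: coords_def)
  moreover have "card (coords \<mu> n) = N + 1" using bij_betw_same_card[OF lab(1)] by simp
  moreover have "card (Z (Suc \<mu>) ` {1..m}) = m" by (subst card_image) (auto simp: inj_on_def)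
  ultimately have "finite (coords (Suc \<mu>) n)" "card (coords (Suc \<mu>) n) = N + 1 + m"
    by (simp_all add: card_Un_disjoint)
  then have "inj_on lab' (coords (Suc \<mu>) n)" by (intro eq_card_imp_inj_on) (simp_all add: image)
  then have "bij_betw lab' (coords (Suc \<mu>) n) {0..N + m}" using image by (simp add: bij_betw_def)
  moreover have "link N (family_fun \<mu> n lab) (m + 1) (model (m + 1) (\<lambda>_. 0)) = family_fun (Suc \<mu>) n lab'"
  proof
    fix z :: "nat \<Rightarrow> complex"
    let ?z1 = "\<lambda>i. if 1 \<le> i \<and> i < N then z i else if i = N then z (N + m) else 0"
    let ?z2 = "\<lambda>i. if 1 \<le> i \<and> i < m + 1 then z (N - 1 + i) else if i = m + 1 then z (N + m) else 0"
    have xi_label: "N + (m + 1) - 1 = N + m" by simp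
    have "link N (family_fun \<mu> n lab) (m + 1) (model (m + 1) (\<lambda>_. 0)) z
        = family_fun \<mu> n lab ?z1 + P (\<lambda>_. 0) m (\<lambda>i. Re (?z2 i)) (Re (?z2 (m + 1)))"
      unfolding link_def Let_def model_eq_P xi_label ..
    also have "family_fun \<mu> n lab ?z1
        = (\<Sum>j=1..\<mu>. P (\<lambda>_. 0) (n j) (\<lambda>i. Re (z (lab' (Z j i)))) (Re (z (lab' Xi))))"
      unfolding family_fun_def
    proof (rule sum.cong[OF refl])
      fix j assume j: "j \<in> {1..\<mu>}"
      have "Re (?z1 (lab (Z j i))) = Re (z (lab' (Z j i)))" if "i \<in> {1..n j}" for i
        using range[OF j that] j by (simp add: lab'_def)
      moreover have "?z1 (lab Xi) = z (lab' Xi)" using lab by (simp add: lab'_def)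
      moreover have "2 \<le> n j" using n j by blast
      ultimately show "P (\<lambda>_. 0) (n j) (\<lambda>i. Re (?z1 (lab (Z j i)))) (Re (?z1 (lab Xi)))
          = P (\<lambda>_. 0) (n j) (\<lambda>i. Re (z (lab' (Z j i)))) (Re (z (lab' Xi)))"
        by (simp only:) (rule P_cong, auto)
    qed
    also have "P (\<lambda>_. 0) m (\<lambda>i. Re (?z2 i)) (Re (?z2 (m + 1)))
        = P (\<lambda>_. 0) m (\<lambda>i. Re (z (lab' (Z (Suc \<mu>) i)))) (Re (z (lab' Xi)))"
    proof -
      have "?z2 (m + 1) = z (lab' Xi)" by (simp add: lab'_def)
      then show ?thesis using m by (simp only:) (rule P_cong, auto simp: lab'_def)
    qed
    finally show "link N (family_fun \<mu> n lab) (m + 1) (model (m + 1) (\<lambda>_. 0)) z = family_fun (Suc \<mu>) n lab' z"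
      by (simp add: family_fun_def[abs_def] m_def)
  qed
  moreover have "lab' Z0 = 0" "lab' Xi = N + m" "N + m \<ge> 1" using N by (simp_all add: lab'_def)
  ultimately show ?case
    using ob' by (intro exI[of _ "N + m"] exI[of _ lab']) simp
qed

lemma obtainable_family:
  assumes "1 \<le> \<mu>" "\<forall>j\<in>{1..\<mu>}. n j \<ge> 2" "\<forall>j\<in>{\<mu><..\<mu>'}. n j = 1" "\<mu> \<le> \<mu>'"
  shows "\<exists>N lab. bij_betw lab (coords \<mu>' n) {0..N} \<and> lab Z0 = 0 \<and> obtainable N (family_fun \<mu>' n lab)"
  using assms(4,3)
proof (induction \<mu>' rule: dec_induct)
  case base
  then show ?case using obtainable_blocks[OF assms(1,2)] by blast
next
  case (step \<mu>')
  then obtain N lab where lab: "bij_betw lab (coords \<mu>' n) {0..N}" "lab Z0 = 0"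
    and ob: "obtainable N (family_fun \<mu>' n lab)" by auto
  have n1: "n (Suc \<mu>') = 1" using step by simp
  define lab' where "lab' = lab(Z (Suc \<mu>') 1 := N + 1)"
  have coords': "coords (Suc \<mu>') n = coords \<mu>' n \<union> {Z (Suc \<mu>') 1}"
    by (auto simp: coords_def n1 le_Suc_eq)
  have new: "Z (Suc \<mu>') 1 \<notin> coords \<mu>' n" by (auto simp: coords_def)
  have "bij_betw lab' (coords \<mu>' n) {0..N}"
    using lab(1) by (rule bij_betw_cong[THEN iffD1, rotated]) (use new in \<open>auto simp: lab'_def\<close>)
  then have "bij_betw lab' (coords (Suc \<mu>') n) ({0..N} \<union> {lab' (Z (Suc \<mu>') 1)})"
    unfolding coords' using new by (subst notIn_Un_bij_betw3[symmetric]) (auto simp: lab'_def)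
  moreover have "{0..N} \<union> {lab' (Z (Suc \<mu>') 1)} = {0..N + 1}" by (auto simp: lab'_def)
  ultimately have bij: "bij_betw lab' (coords (Suc \<mu>') n) {0..N + 1}" by simp
  have "extension N 1 (family_fun \<mu>' n lab) = family_fun (Suc \<mu>') n lab'"
  proof
    fix z
    \<comment> \<open>A block of size 1 does not involve \<open>\<xi>\<close>: the only pair of
      indices is (1, 1), and the exponent of \<open>t\<close> is 0.\<close>
    have "P (\<lambda>_. 0) 1 x t = (x 1)\<^sup>2" for x t
      unfolding P_def resolvent_quadratic by (simp add: power2_eq_square)
    then have "family_fun (Suc \<mu>') n lab' z = (\<Sum>j=1..\<mu>'. P (\<lambda>_. 0) (n j) (\<lambda>i. Re (z (lab' (Z j i)))) (Re (z (lab' Xi))))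
        + (Re (z (N + 1)))\<^sup>2"
      by (simp add: family_fun_def n1 lab'_def)
    also have "(\<Sum>j=1..\<mu>'. P (\<lambda>_. 0) (n j) (\<lambda>i. Re (z (lab' (Z j i)))) (Re (z (lab' Xi)))) = family_fun \<mu>' n lab z"
      unfolding family_fun_def by (rule sum.cong) (auto simp: lab'_def)
    finally show "extension N 1 (family_fun \<mu>' n lab) z = family_fun (Suc \<mu>') n lab' z"
      by (simp add: extension_def)
  qed
  then have "obtainable (N + 1) (family_fun (Suc \<mu>') n lab')"
    using obtainable_extension[OF ob, of 1] by simp
  moreover have "lab' Z0 = 0" using lab(2) by (simp add: lab'_def)
  ultimately show ?case using bij by blast
qed

section \<open>The direct sum of the matrices \<open>T_mat\<close>\<close>

lemma diag_T_dim: "dim_row (diag_block_mat (map T_mat ns)) = sum_list ns" "dim_col (diag_block_mat (map T_mat ns)) = sum_list ns"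
  by (induction ns) (simp_all add: Let_def T_mat_def)

lemma diag_T_index:
  assumes "j < length ns" "i < ns ! j" "s < sum_list ns"
  shows "diag_block_mat (map T_mat ns) $$ (sum_list (take j ns) + i, s)
    = (if 0 < i \<and> s = sum_list (take j ns) + (i - 1) then 1 else 0)"
  using assms
proof (induction ns arbitrary: j s)
  case (Cons k ns)
  have dim: "dim_row (T_mat k) = k" "dim_col (T_mat k) = k" by (simp_all add: T_mat_def)
  have T: "T_mat k $$ (i, s) = (if i = s + 1 then 1 else 0)" if "i < k" "s < k" for i s
    using that by (simp add: T_mat_def)
  show ?case
  proof (cases j)
    case 0
    then have i: "i < k" using Cons.prems by simp
    then show ?thesis
      using Cons.prems 0 T[OF i] by (cases "s < k") (auto simp: Let_def diag_T_dim dim)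
  next
    case (Suc j')
    have "sum_list (take j' ns) + ns ! j' \<le> sum_list ns"
      using Cons.prems Suc
      by (metis (no_types, lifting) add_leD1 append_take_drop_id id_take_nth_drop length_Cons less_Suc_eq_le not_less_eq
          nth_Cons_Suc sum_list.Cons sum_list.append add.assoc le_add1)
    then have r: "sum_list (take j' ns) + i < sum_list ns" using Cons.prems Suc by simp
    show ?thesis
    proof (cases "s < k")
      case True
      then show ?thesis using Cons.prems Suc r by (simp add: Let_def diag_T_dim dim)
    next
      case False
      then show ?thesis using Cons.prems Suc r Cons.IH[of j' "s - k"] by (auto simp: Let_def diag_T_dim dim)
    qed
  qed
qed simp

lemma sum_blocks_unique:
  fixes n :: "nat \<Rightarrow> nat"
  assumes "(\<Sum>k\<in>{1..<j}. n k) + i = (\<Sum>k\<in>{1..<j'}. n k) + i'" "i < n j" "i' < n j'" "1 \<le> j" "1 \<le> j'"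
  shows "j = j'" "i = i'"
proof -
  have le: "(\<Sum>k\<in>{1..<j}. n k) + n j \<le> (\<Sum>k\<in>{1..<j'}. n k)" if "j < j'" "1 \<le> j" for j j'
  proof -
    have "(\<Sum>k\<in>{1..<Suc j}. n k) \<le> (\<Sum>k\<in>{1..<j'}. n k)" using that by (intro sum_mono2) auto
    then show ?thesis using that by simp
  qed
  show "j = j'" using le[of j j'] le[of j' j] assms by (cases j j' rule: linorder_cases) auto
  then show "i = i'" using assms by simp
qed

lemma sum_blocks_exists:
  fixes n :: "nat \<Rightarrow> nat"
  assumes "s < (\<Sum>k=1..\<mu>. n k)"
  shows "\<exists>j\<in>{1..\<mu>}. \<exists>i<n j. s = (\<Sum>k\<in>{1..<j}. n k) + i"
  using assms
proof (induction \<mu>)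
  case (Suc \<mu>)
  show ?case
  proof (cases "s < (\<Sum>k=1..\<mu>. n k)")
    case True
    then show ?thesis using Suc.IH by fastforce
  next
    case False
    then show ?thesis
      using Suc.prems by (intro bexI[of _ "Suc \<mu>"] exI[of _ "s - (\<Sum>k=1..\<mu>. n k)"])
        (auto simp: atLeastLessThanSuc_atLeastAtMost)
  qed
qed simp

text \<open>The rows are those of the identity matrix, relabelled by block and index; as they are
  real, \<open>K A = T conj(K)\<close> just says that \<open>A\<close> is the direct sum itself.
  Positions in the matrix count from 0, indices in a block from 1, hence
  \<open>i - 1\<close>.\<close>

lemma chain_matrix_diag_T:
  fixes n :: "nat \<Rightarrow> nat" and \<mu> :: nat
  defines "m \<equiv> (\<Sum>k=1..\<mu>. n k)"
  shows "diag_block_mat (map (\<lambda>j. T_mat (n j)) [1..<\<mu> + 1]) \<in> carrier_mat m m"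
    and "chain_matrix m (diag_block_mat (map (\<lambda>j. T_mat (n j)) [1..<\<mu> + 1])) \<mu> n
      (\<lambda>j i s. if s = (\<Sum>k\<in>{1..<j}. n k) + (i - 1) then 1 else 0)"
proof -
  define ns where "ns = map n [1..<\<mu> + 1]"
  let ?A = "diag_block_mat (map (\<lambda>j. T_mat (n j)) [1..<\<mu> + 1])"
  define off where "off j = (\<Sum>k\<in>{1..<j}. n k)" for j
  have A: "?A = diag_block_mat (map T_mat ns)" by (simp add: ns_def comp_def del: upt_Suc)
  have "sum_list ns = m"
    unfolding ns_def m_def by (simp add: interv_sum_list_conv_sum_set_nat atLeastLessThanSuc_atLeastAtMost del: upt_Suc)
  then have dim: "dim_row ?A = m" "dim_col ?A = m" "sum_list ns = m" by (simp_all only: A diag_T_dim)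
  show carr: "?A \<in> carrier_mat m m" by (rule carrier_matI[OF dim(1,2)])
  have off_take: "sum_list (take (j - 1) ns) = off j" "ns ! (j - 1) = n j" "j - 1 < length ns" if "j \<in> {1..\<mu>}" for j
  proof -
    have "take (j - 1) [1..<\<mu> + 1] = [1..<j]" using that by (subst take_upt) auto
    then show "sum_list (take (j - 1) ns) = off j"
      unfolding ns_def off_def by (simp add: take_map interv_sum_list_conv_sum_set_nat del: upt_Suc)
    show "ns ! (j - 1) = n j" "j - 1 < length ns" using that by (auto simp: ns_def simp del: upt_Suc)
  qed
  have off_less: "off j + i < m" if "j \<in> {1..\<mu>}" "i < n j" for j i
  proof -
    have "off j + n j = (\<Sum>k\<in>{1..<Suc j}. n k)" using that by (simp add: off_def)
    also have "\<dots> \<le> m" unfolding m_def using that by (intro sum_mono2) auto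
    finally show ?thesis using that by simp
  qed
  define pos where "pos j i = off j + (i - 1)" for j i
  have pos: "pos j i < m" if "j \<in> {1..\<mu>}" "i \<in> {1..n j}" for j i
    using off_less[of j "i - 1"] that by (auto simp: pos_def)
  have pos_inj: "j = j' \<and> i = i'" if "pos j i = pos j' i'" "j \<in> {1..\<mu>}" "i \<in> {1..n j}" "j' \<in> {1..\<mu>}" "i' \<in> {1..n j'}" for j i j' i'
    using sum_blocks_unique[of n j "i - 1" j' "i' - 1"] that by (fastforce simp: pos_def off_def)
  have pos_surj: "\<exists>j\<in>{1..\<mu>}. \<exists>i\<in>{1..n j}. s = pos j i" if s: "s < m" for s
  proof -
    obtain j i where "j \<in> {1..\<mu>}" "i < n j" "s = off j + i"
      using sum_blocks_exists[of s n \<mu>] s unfolding m_def off_def by blast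
    then show ?thesis by (intro bexI[of _ j] bexI[of _ "i + 1"]) (auto simp: pos_def)
  qed
  have pick: "(\<Sum>s<m. g s * (if s = pos j i then 1 else 0)) = g (pos j i)"
    "(\<Sum>s<m. (if s = pos j i then 1 else 0) * g s) = g (pos j i)"
    if "j \<in> {1..\<mu>}" "i \<in> {1..n j}" for j i and g :: "nat \<Rightarrow> complex"
  proof -
    have "(\<Sum>s<m. if s = pos j i then g s else 0) = g (pos j i)" using pos[OF that] by simp
    moreover have "g s * (if s = pos j i then 1 else 0) = (if s = pos j i then g s else 0)"
      "(if s = pos j i then 1 else 0) * g s = (if s = pos j i then g s else 0)" for s by auto
    ultimately show "(\<Sum>s<m. g s * (if s = pos j i then 1 else 0)) = g (pos j i)"
      "(\<Sum>s<m. (if s = pos j i then 1 else 0) * g s) = g (pos j i)" by (simp_all only:)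
  qed
  have "chain_matrix m ?A \<mu> n (\<lambda>j i s. if s = pos j i then 1 else 0)"
    unfolding chain_matrix_def
  proof (intro conjI ballI allI impI)
    fix j i s assume j: "j \<in> {1..\<mu>}" and i: "i \<in> {1..n j}" and s: "s < m"
    have "?A $$ (pos j i, s) = (if 0 < i - 1 \<and> s = off j + (i - 1 - 1) then 1 else 0)"
      using diag_T_index[of "j - 1" ns "i - 1" s] off_take[OF j] i s dim unfolding A pos_def by auto
    also have "\<dots> = (if i = 1 then 0 else cnj (if s = pos j (i - 1) then 1 else 0))"
      using i by (auto simp: pos_def)
    finally show "(\<Sum>r<m. (if r = pos j i then 1 else 0) * ?A $$ (r, s))
        = (if i = 1 then 0 else cnj (if s = pos j (i - 1) then 1 else 0))"
      unfolding pick(2)[OF j i] .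
  next
    fix w :: "nat \<Rightarrow> nat \<Rightarrow> complex"
    \<comment> \<open>The prescribed values are read back from positions; \<open>pos_inj\<close>
      makes the description unique.\<close>
    define c where "c = vec m (\<lambda>s. THE x. \<exists>j\<in>{1..\<mu>}. \<exists>i\<in>{1..n j}. s = pos j i \<and> x = w j i)"
    have c: "vec_index c (pos j i) = w j i" if "j \<in> {1..\<mu>}" "i \<in> {1..n j}" for j i
    proof -
      have "(THE x. \<exists>j'\<in>{1..\<mu>}. \<exists>i'\<in>{1..n j'}. pos j i = pos j' i' \<and> x = w j' i') = w j i"
        by (rule the_equality) (use that pos_inj in blast)+
      then show ?thesis using pos[OF that] by (simp add: c_def)
    qed
    show "\<exists>!c. c \<in> carrier_vec m \<and> (\<forall>j\<in>{1..\<mu>}. \<forall>i\<in>{1..n j}.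
        (\<Sum>s<m. vec_index c s * (if s = pos j i then 1 else 0)) = w j i)"
    proof (rule ex1I[of _ c], intro conjI ballI)
      show "c \<in> carrier_vec m" by (simp add: c_def)
      show "(\<Sum>s<m. vec_index c s * (if s = pos j i then 1 else 0)) = w j i"
        if "j \<in> {1..\<mu>}" "i \<in> {1..n j}" for j i using pick(1)[OF that] c[OF that] by simp
      fix d :: "complex vec"
      assume d: "d \<in> carrier_vec m \<and> (\<forall>j\<in>{1..\<mu>}. \<forall>i\<in>{1..n j}.
        (\<Sum>s<m. vec_index d s * (if s = pos j i then 1 else 0)) = w j i)"
      show "d = c"
      proof (rule eq_vecI)
        fix s assume "s < dim_vec c"
        then obtain j i where ji: "j \<in> {1..\<mu>}" "i \<in> {1..n j}" "s = pos j i"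
          using pos_surj[of s] by (auto simp: c_def)
        then show "vec_index d s = vec_index c s"
          using d c[OF ji(1,2)] pick(1)[OF ji(1,2), of "vec_index d"] by simp
      qed (use d in \<open>simp add: c_def\<close>)
    qed
  qed
  then show "chain_matrix m ?A \<mu> n (\<lambda>j i s. if s = (\<Sum>k\<in>{1..<j}. n k) + (i - 1) then 1 else 0)"
    by (simp only: pos_def off_def)
qed

text \<open>The zero matrix is excluded in the first part because zero adjoint operators are not
  injective on a kernel of rank 1. In the second part a block of size 1 has Hessian
  \<open>deriv (deriv (f j)) + 2\<close>; where this vanishes, its direction joins the Levi kernel
  and the rank exceeds 1.\<close>

theorem theorem4p4:
  shows
    "(\<forall>(N::nat) (A::complex mat).
        A \<in> carrier_mat N N \<and> antilinear_nilpotent A \<and> A \<noteq> 0\<^sub>m N N \<longrightarrow>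
        (\<exists>n \<Phi>. obtainable n \<Phi>
           \<and> uniformly_2_nondegenerate {0..n} (graph_eq 0 \<Phi>)
           \<and> (\<forall>q\<in>hypersurface {0..n} (graph_eq 0 \<Phi>).
                has_rank (levi_kernel {0..n} (graph_eq 0 \<Phi>) q) 1
                \<and> ad_represented_by {0..n} (graph_eq 0 \<Phi>) q A)))
     \<and>
     (\<forall>(\<mu>::nat) (f :: nat \<Rightarrow> real \<Rightarrow> real) (n :: nat \<Rightarrow> nat).
        \<mu> \<ge> 1
        \<and> (\<forall>j\<in>{1..\<mu>}. twice_differentiable (f j) \<and> n j \<ge> 1)
        \<and> (\<forall>j\<in>{1..\<mu>}. n j = 1 \<longrightarrow> (\<forall>x. deriv (deriv (f j)) x \<noteq> -2)) \<longrightarrow>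
        (\<forall>q\<in>hypersurface (coords \<mu> n) (family_eq \<mu> f n).
           ad_represented_by (coords \<mu> n) (family_eq \<mu> f n) q
             (diag_block_mat (map (\<lambda>j. T_mat (n j)) [1..<\<mu> + 1]))))"
proof (intro conjI allI impI)
  fix N :: nat and A :: "complex mat"
  assume A: "A \<in> carrier_mat N N \<and> antilinear_nilpotent A \<and> A \<noteq> 0\<^sub>m N N"
  then obtain \<mu> \<mu>' n K where \<mu>: "1 \<le> \<mu>" "\<mu> \<le> \<mu>'" and n2: "\<forall>j\<in>{1..\<mu>}. n j \<ge> 2"
    and n1: "\<forall>j\<in>{\<mu><..\<mu>'}. n j = 1" and K: "chain_matrix N A \<mu>' n K"
    using chain_matrix_exists[of A N] by metis
  have n: "\<forall>j\<in>{1..\<mu>'}. n j \<ge> 1"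
  proof
    fix j assume "j \<in> {1..\<mu>'}"
    then have "j \<in> {1..\<mu>} \<or> j \<in> {\<mu><..\<mu>'}" by auto
    then have "n j \<ge> 2 \<or> n j = 1" using n2 n1 by blast
    then show "n j \<ge> 1" by linarith
  qed
  obtain k lab where lab: "bij_betw lab (coords \<mu>' n) {0..k}" "lab Z0 = 0"
    and ob: "obtainable k (family_fun \<mu>' n lab)"
    using obtainable_family[OF \<mu>(1) n2 n1 \<mu>(2)] by blast
  have "uniformly_2_nondegenerate {0..k} (graph_eq 0 (family_fun \<mu>' n lab))"
    using family_uniformly_2_nondegenerate[OF n lab(1), of 1] \<mu> n2 lab(2) by simp
  moreover have rep: "ad_represented_by {0..k} (graph_eq 0 (family_fun \<mu>' n lab)) q A"
    if "q \<in> hypersurface {0..k} (graph_eq 0 (family_fun \<mu>' n lab))" for q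
    using block_family.block_ad_represented[OF family_block(1)[OF n lab(1)] _ _ K, of q]
    unfolding family_block(2,3)[OF n lab(1)] lab(2) using that A by blast
  moreover have "has_rank (levi_kernel {0..k} (graph_eq 0 (family_fun \<mu>' n lab)) q) 1"
    if "q \<in> hypersurface {0..k} (graph_eq 0 (family_fun \<mu>' n lab))" for q
    using rep[OF that] by (simp add: ad_represented_by_def)
  ultimately show "\<exists>n \<Phi>. obtainable n \<Phi>
           \<and> uniformly_2_nondegenerate {0..n} (graph_eq 0 \<Phi>)
           \<and> (\<forall>q\<in>hypersurface {0..n} (graph_eq 0 \<Phi>).
                has_rank (levi_kernel {0..n} (graph_eq 0 \<Phi>) q) 1
                \<and> ad_represented_by {0..n} (graph_eq 0 \<Phi>) q A)"
    using ob by (intro exI[of _ k] exI[of _ "family_fun \<mu>' n lab"]) simp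
next
  fix \<mu> :: nat and f :: "nat \<Rightarrow> real \<Rightarrow> real" and n :: "nat \<Rightarrow> nat"
  assume *: "\<mu> \<ge> 1
        \<and> (\<forall>j\<in>{1..\<mu>}. twice_differentiable (f j) \<and> n j \<ge> 1)
        \<and> (\<forall>j\<in>{1..\<mu>}. n j = 1 \<longrightarrow> (\<forall>x. deriv (deriv (f j)) x \<noteq> -2))"
  interpret block_family \<mu> n f "\<lambda>c. c" "\<lambda>c. c"
    using * by unfold_locales auto
  have eq: "graph_eq Z0 \<Phi> = family_eq \<mu> f n"
    by (simp add: family_eq_def \<Phi>_def[abs_def] X_def)
  show "\<forall>q\<in>hypersurface (coords \<mu> n) (family_eq \<mu> f n).
           ad_represented_by (coords \<mu> n) (family_eq \<mu> f n) q
             (diag_block_mat (map (\<lambda>j. T_mat (n j)) [1..<\<mu> + 1]))"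
    using block_ad_represented[OF _ chain_matrix_diag_T] unfolding eq image_ident by blast
qed

end
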